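(* There are morphisms of chain complexes $TR:\mathcal{E}(r)\to\mathcal{X}(r)$ and $TC:\mathcal{X}(r)\to\mathcal{E}(r)$, given for all $r\geq 1$, such that: (1) in degree $0$, the morphisms $TR$ and $TC$ are the identity of $\mathbf{Z}[\Sigma_r]=\mathcal{E}(r)_0=\mathcal{X}(r)_0$; (2) $TR\cdot TC=\mathrm{Id}_{\mathcal{X}}$; (3) $TR$ and $TC$ preserve the cellular $E$-infinity structures and the operad filtrations, that is, $TR(F_{n_{ij},w}\mathcal{E}(r))\subset F_{n_{ij},w}\mathcal{X}(r)$ and $TC(F_{n_{ij},w}\mathcal{X}(r))\subset F_{n_{ij},w}\mathcal{E}(r)$ for every cell index $(n_{ij},w)$, and $TR(F_n\mathcal{E}(r))\subset F_n\mathcal{X}(r)$, $TC(F_n\mathcal{X}(r))\subset F_n\mathcal{E}(r)$ for every $n$; (4) $TR:\mathcal{E}\to\mathcal{X}$ is a morphism of operads.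
   Context: All modules are over $\mathbf{Z}$. A permutation $w\in\Sigma_r$ is written as the sequence $(w(1),\dots,w(r))$. **Barratt-Eccles operad.** $\mathcal{W}(r)$ is the simplicial set with $\mathcal{W}(r)_n=\Sigma_r^{n+1}$, $d_i(w_0,\dots,w_n)=(w_0,\dots,\widehat{w_i},\dots,w_n)$, $s_j(w_0,\dots,w_n)=(w_0,\dots,w_j,w_j,\dots,w_n)$. $\mathcal{E}(r)$ is its normalized chain complex (tuples with $w_i=w_{i+1}$ for some $i$ are set to $0$; $\delta=\sum_i(-1)^i d_i$). $\Sigma_r$ acts by $\sigma\cdot(w_0,\dots,w_n)=(\sigma w_0,\dots,\sigma w_n)$. For $u\in\Sigma_r$, $v\in\Sigma_s$, $u\circ_k v\in\Sigma_{r+s-1}$ is obtained from the sequence $u$ by increasing the values $>k$ by $s-1$ and replacing the value $k$ by the sequence $(v(1)+k-1,\dots,v(s)+k-1)$. Applied levelwise, this makes $\mathcal{W}$ a simplicial operad. On $\mathcal{E}$ the composite is induced through the Eilenberg-Zilber map: $(u_0,\dots,u_d)\circ_k(v_0,\dots,v_e)=\sum\pm(u_{x_0}\circ_k v_{y_0},\dots,u_{x_{d+e}}\circ_k v_{y_{d+e}})$, the sum running over lattice paths $(x_*,y_* )$ from $(0,0)$ to $(d,e)$ with unit steps, $\pm$ being the signature of the corresponding shuffle (positive when all $x$-steps precede all $y$-steps). **Surjection operad.** $\mathcal{X}(r)_d$ is the free module on the non-degenerate surjections $u:\{1,\dots,r+d\}\to\{1,\dots,r\}$, i.e. those with $u(i)\neq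 u(i+1)$ for all $i$; degenerate surjections and non-surjective maps represent $0$. A surjection is written as the sequence $(u(1),\dots,u(r+d))$. $\Sigma_r$ acts by composition on values. A term $u(i)$ is a *caesura* if it is not the last occurrence of its value; there are $d$ caesuras. The differential is $\delta u=\sum_i\pm(u(1),\dots,\widehat{u(i)},\dots,u(r+d))$, where the caesuras, in order, have the signs $+,-,+,\dots$, and the last occurrence of a value that occurs at least twice has the sign opposite to that of the previous occurrence of the same value. For $u\in\mathcal{X}(r)_d$ and $v\in\mathcal{X}(s)_e$, suppose $k$ has $n$ occurrences in $u$. Then $u\circ_k v=\sum\pm c_j$, the sum over $1=j_0\leq j_1\leq\dots\leq j_{n-1}\leq j_n=s+e$, where $c_j$ is obtained by replacing, for $m=1,\dots,n$, the $m$-th occurrence of $k$ in $u$ by $(v(j_{m-1}),\dots,v(j_m))$, with the terms from $v$ increased by $k-1$ and the terms of $u$ greater than $k$ increased by $s-1$. Sign: each of the $d+e$ caesuras of $c_j$ is of type $u$ or $v$; it has type $u$ if it comes from a term $\neq k$ of $u$ or is the end term of the segment inserted for the $m$-th occurrence of $k$ with $m<n$, and type $v$ otherwise; $\pm$ is the signature of the shuffle moving all type-$u$ caesuras before all type-$v$ caesuras, preserving the order within each type. **Cellular $E$-infinity structures.** Cells are indexed by pairs $(n_{ij},w)$ of a collection $n_{ij}\in\mathbf{N}$, $1\leq i<j\leq r$, and a permutation $w\in\Sigma_r$. For a sequence $w$ write $w|_{ij}$ for its subsequence of terms in $\{i,j\}$. $F_{n_{ij},w}\mathcal{W}(r)$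 consists of the simplices $(w_0,\dots,w_d)$ such that for all $i<j$ the sequence $(w_0|_{ij},\dots,w_d|_{ij})$ has either fewer than $n_{ij}$ variations (indices $l$ with $w_l|_{ij}\neq w_{l+1}|_{ij}$), or exactly $n_{ij}$ variations and $w_0|_{ij}=w|_{ij}$. $F_{n_{ij},w}\mathcal{E}(r)$ is the submodule of $\mathcal{E}(r)$ generated by these simplices. $F_{n_{ij},w}\mathcal{X}(r)$ is generated by the surjections $u$ such that for all $i<j$, denoting by $m_{ij}+1$ the number of pairs of unequal consecutive terms in $u|_{ij}$, either $m_{ij}<n_{ij}$, or $m_{ij}=n_{ij}$ and the order of the first occurrences of $i$ and $j$ in $u$ is $w|_{ij}$. For $n=1,2,\dots$, $F_n\mathcal{E}(r)$ and $F_n\mathcal{X}(r)$ are the sums of the corresponding cells over all $w$ and all $(n_{ij})$ with $n_{ij}<n$ for all $i<j$; $F_\infty\mathcal{E}=\mathcal{E}$ and $F_\infty\mathcal{X}=\mathcal{X}$. *)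

theory Defs
  imports
    "HOL-Algebra.Free_Abelian_Groups"
    "HOL-Algebra.Generated_Groups"
    "HOL-Combinatorics.Permutations"
    "HOL-Combinatorics.Multiset_Permutations"
    "HOL-Library.Extended_Nat"
begin

section \<open>Operads with a cellular structure\<close>

text \<open>
  A symmetric sequence of graded free abelian groups, given by bases, together with a boundary,
  symmetric group actions, a unit, partial composites and cells. This is only the data: the
  operad axioms are not part of the record. In \<open>op_comp C r s k a b\<close> the chain \<open>a\<close> has arity \<open>r\<close>
  and \<open>b\<close> has arity \<open>s\<close>. A permutation \<open>w\<close> of \<open>{1..r}\<close> is either a function, or the list
  \<open>w(1), \<dots>, w(r)\<close>, that is, an element of \<open>permutations_of_set {1..r}\<close>.
\<close>

record 'a cellular_operad =
  op_basis :: "nat \<Rightarrow> nat \<Rightarrow> 'a set"  \<comment> \<open>arity, degree\<close>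
  op_bd :: "nat \<Rightarrow> ('a \<Rightarrow>\<^sub>0 int) \<Rightarrow> ('a \<Rightarrow>\<^sub>0 int)"
  op_act :: "(nat \<Rightarrow> nat) \<Rightarrow> ('a \<Rightarrow>\<^sub>0 int) \<Rightarrow> ('a \<Rightarrow>\<^sub>0 int)"
  op_one :: "'a \<Rightarrow>\<^sub>0 int"
  op_comp :: "nat \<Rightarrow> nat \<Rightarrow> nat \<Rightarrow> ('a \<Rightarrow>\<^sub>0 int) \<Rightarrow> ('a \<Rightarrow>\<^sub>0 int) \<Rightarrow> ('a \<Rightarrow>\<^sub>0 int)"
  op_cell :: "nat \<Rightarrow> (nat \<Rightarrow> nat \<Rightarrow> nat) \<Rightarrow> nat list \<Rightarrow> ('a \<Rightarrow>\<^sub>0 int) set"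

definition graded_part :: "'a cellular_operad \<Rightarrow> nat \<Rightarrow> nat \<Rightarrow> ('a \<Rightarrow>\<^sub>0 int) monoid" where
  "graded_part C r d = free_Abelian_group (op_basis C r d)"

definition op_total :: "'a cellular_operad \<Rightarrow> nat \<Rightarrow> ('a \<Rightarrow>\<^sub>0 int) monoid" where
  "op_total C r = free_Abelian_group (\<Union>d. op_basis C r d)"

text \<open>The sum of a family of subgroups is the subgroup generated by their union.\<close>

definition op_filt :: "'a cellular_operad \<Rightarrow> enat \<Rightarrow> nat \<Rightarrow> ('a \<Rightarrow>\<^sub>0 int) set" where
  "op_filt C N r = (case N of
      enat m \<Rightarrow> generate (op_total C r)
        (\<Union> {op_cell C r n w | n w.
              w \<in> permutations_of_set {1..r} \<and> (\<forall>i j. 1 \<le> i \<and> i < j \<and> j \<le> r \<longrightarrow> n i j < m)})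
    | \<infinity> \<Rightarrow> carrier (op_total C r))"

definition chain_morphism ::
  "'a cellular_operad \<Rightarrow> 'b cellular_operad \<Rightarrow> nat \<Rightarrow> (('a \<Rightarrow>\<^sub>0 int) \<Rightarrow> ('b \<Rightarrow>\<^sub>0 int)) \<Rightarrow> bool" where
  "chain_morphism C D r f \<longleftrightarrow>
     f \<in> hom (op_total C r) (op_total D r) \<and>
     (\<forall>d. f ` carrier (graded_part C r d) \<subseteq> carrier (graded_part D r d)) \<and>
     (\<forall>c \<in> carrier (op_total C r). f (op_bd C r c) = op_bd D r (f c))"

definition operad_morphism ::
  "'a cellular_operad \<Rightarrow> 'b cellular_operad \<Rightarrow> (nat \<Rightarrow> ('a \<Rightarrow>\<^sub>0 int) \<Rightarrow> ('b \<Rightarrow>\<^sub>0 int)) \<Rightarrow> bool" where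
  "operad_morphism C D f \<longleftrightarrow>
     (\<forall>r \<ge> 1. chain_morphism C D r (f r)) \<and>
     (\<forall>r \<ge> 1. \<forall>\<sigma> c. \<sigma> permutes {1..r} \<and> c \<in> carrier (op_total C r) \<longrightarrow>
        f r (op_act C \<sigma> c) = op_act D \<sigma> (f r c)) \<and>
     f 1 (op_one C) = op_one D \<and>
     (\<forall>r \<ge> 1. \<forall>s \<ge> 1. \<forall>k \<in> {1..r}. \<forall>a \<in> carrier (op_total C r). \<forall>b \<in> carrier (op_total C s).
        f (r + s - 1) (op_comp C r s k a b) = op_comp D r s k (f r a) (f s b))"

section \<open>Sequences and shuffles\<close>

definition omit :: "nat \<Rightarrow> 'a list \<Rightarrow> 'a list" where
  "omit i xs = take i xs @ drop (Suc i) xs"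

definition restrict_pair :: "nat \<Rightarrow> nat \<Rightarrow> nat list \<Rightarrow> nat list" where
  "restrict_pair i j w = filter (\<lambda>x. x \<in> {i, j}) w"

definition variations :: "'a list \<Rightarrow> nat" where
  "variations xs = card {l \<in> {..<length xs - 1}. xs ! l \<noteq> xs ! Suc l}"

definition first_occurrences :: "'a list \<Rightarrow> 'a list" where
  "first_occurrences xs = rev (remdups (rev xs))"

text \<open>
  The permutation of the positions \<open>{..<length ts}\<close> of a word \<open>ts\<close> that moves the letters \<open>True\<close>
  before the letters \<open>False\<close> and preserves the order of equal letters.
\<close>

definition shuffle_perm :: "bool list \<Rightarrow> nat \<Rightarrow> nat" where
  "shuffle_perm ts i =
     (if i < length ts then
        if ts ! i then count_list (take i ts) True
        else count_list ts True + count_list (take i ts) False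
      else i)"

definition shuffle_sign :: "bool list \<Rightarrow> int" where
  "shuffle_sign ts = sign (shuffle_perm ts)"

section \<open>The Barratt-Eccles operad\<close>

definition W_simplices :: "nat \<Rightarrow> nat \<Rightarrow> nat list list set" where
  "W_simplices r d = {ws. length ws = d + 1 \<and> set ws \<subseteq> permutations_of_set {1..r}}"

text \<open>
  The normalized complex is free on the nondegenerate simplices. The class of a simplex in it is
  given by \<open>E_norm\<close>, which also kills the empty list, so that boundaries vanish in degree 0.
\<close>

definition E_basis :: "nat \<Rightarrow> nat \<Rightarrow> nat list list set" where
  "E_basis r d = {ws \<in> W_simplices r d. distinct_adj ws}"

definition E_norm :: "nat list list \<Rightarrow> (nat list list \<Rightarrow>\<^sub>0 int)" where
  "E_norm ws = (if ws \<noteq> [] \<and> distinct_adj ws then frag_of ws else 0)"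

definition E_bd :: "nat \<Rightarrow> (nat list list \<Rightarrow>\<^sub>0 int) \<Rightarrow> (nat list list \<Rightarrow>\<^sub>0 int)" where
  "E_bd r = frag_extend (\<lambda>ws. \<Sum>i<length ws. frag_cmul ((- 1) ^ i) (E_norm (omit i ws)))"

definition E_act :: "(nat \<Rightarrow> nat) \<Rightarrow> (nat list list \<Rightarrow>\<^sub>0 int) \<Rightarrow> (nat list list \<Rightarrow>\<^sub>0 int)" where
  "E_act \<sigma> = frag_extend (\<lambda>ws. frag_of (map (map \<sigma>) ws))"

definition perm_comp :: "nat \<Rightarrow> nat list \<Rightarrow> nat list \<Rightarrow> nat list" where
  "perm_comp k u v = concat (map (\<lambda>a.
      if a = k then map (\<lambda>b. b + k - 1) v
      else if a > k then [a + length v - 1]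
      else [a]) u)"

text \<open>
  A lattice path is encoded by its word of steps: \<open>True\<close> for an \<open>x\<close>-step, \<open>False\<close> for a \<open>y\<close>-step.
\<close>

definition lattice_paths :: "nat \<Rightarrow> nat \<Rightarrow> bool list set" where
  "lattice_paths d e = {ts. length ts = d + e \<and> count_list ts True = d}"

lemma finite_lattice_paths: "finite (lattice_paths d e)"
  by (rule finite_subset[OF _ finite_lists_length_eq[of "UNIV :: bool set" "d + e"]])
    (auto simp: lattice_paths_def)

definition W_path :: "nat \<Rightarrow> nat list list \<Rightarrow> nat list list \<Rightarrow> bool list \<Rightarrow> nat list list" where
  "W_path k us vs ts = map (\<lambda>i.
      perm_comp k (us ! count_list (take i ts) True) (vs ! count_list (take i ts) False))
    [0..<length ts + 1]"

definition E_comp :: "nat \<Rightarrow> nat \<Rightarrow> nat \<Rightarrow>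
    (nat list list \<Rightarrow>\<^sub>0 int) \<Rightarrow> (nat list list \<Rightarrow>\<^sub>0 int) \<Rightarrow> (nat list list \<Rightarrow>\<^sub>0 int)" where
  "E_comp r s k a b = frag_extend (\<lambda>us. frag_extend (\<lambda>vs.
      \<Sum>ts \<in> lattice_paths (length us - 1) (length vs - 1).
        frag_cmul (shuffle_sign ts) (E_norm (W_path k us vs ts))) b) a"

definition W_cell :: "nat \<Rightarrow> (nat \<Rightarrow> nat \<Rightarrow> nat) \<Rightarrow> nat list \<Rightarrow> nat list list set" where
  "W_cell r n w = {ws \<in> (\<Union>d. W_simplices r d).
     \<forall>i j. 1 \<le> i \<and> i < j \<and> j \<le> r \<longrightarrow>
       (let m = variations (map (restrict_pair i j) ws)
        in m < n i j \<or> m = n i j \<and> restrict_pair i j (hd ws) = restrict_pair i j w)}"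

definition E_cell ::
  "nat \<Rightarrow> (nat \<Rightarrow> nat \<Rightarrow> nat) \<Rightarrow> nat list \<Rightarrow> (nat list list \<Rightarrow>\<^sub>0 int) set" where
  "E_cell r n w = generate (free_Abelian_group (\<Union>d. E_basis r d)) (E_norm ` W_cell r n w)"

definition barratt_eccles :: "nat list list cellular_operad" where
  "barratt_eccles = \<lparr>op_basis = E_basis, op_bd = E_bd, op_act = E_act,
     op_one = frag_of [[1]], op_comp = E_comp, op_cell = E_cell\<rparr>"

section \<open>The surjection operad\<close>

text \<open>Positions in a sequence are counted from 0 below.\<close>

definition X_basis :: "nat \<Rightarrow> nat \<Rightarrow> nat list set" where
  "X_basis r d = {u. length u = r + d \<and> set u = {1..r} \<and> distinct_adj u}"

definition X_norm :: "nat \<Rightarrow> nat list \<Rightarrow> (nat list \<Rightarrow>\<^sub>0 int)" where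
  "X_norm r u = (if set u = {1..r} \<and> distinct_adj u then frag_of u else 0)"

definition caesura :: "nat list \<Rightarrow> nat \<Rightarrow> bool" where
  "caesura u i \<longleftrightarrow> i < length u \<and> u ! i \<in> set (drop (Suc i) u)"

definition caesura_sign :: "nat list \<Rightarrow> nat \<Rightarrow> int" where
  "caesura_sign u i = (- 1) ^ card {j \<in> {..<i}. caesura u j}"

text \<open>
  The sign 0 is given to a value that occurs only once: omitting it leaves a non-surjective map.
\<close>

definition X_bd_sign :: "nat list \<Rightarrow> nat \<Rightarrow> int" where
  "X_bd_sign u i =
     (if caesura u i then caesura_sign u i
      else if u ! i \<in> set (take i u) then - caesura_sign u (Max {j \<in> {..<i}. u ! j = u ! i})
      else 0)"

definition X_bd :: "nat \<Rightarrow> (nat list \<Rightarrow>\<^sub>0 int) \<Rightarrow> (nat list \<Rightarrow>\<^sub>0 int)" where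
  "X_bd r = frag_extend (\<lambda>u. \<Sum>i<length u. frag_cmul (X_bd_sign u i) (X_norm r (omit i u)))"

definition X_act :: "(nat \<Rightarrow> nat) \<Rightarrow> (nat list \<Rightarrow>\<^sub>0 int) \<Rightarrow> (nat list \<Rightarrow>\<^sub>0 int)" where
  "X_act \<sigma> = frag_extend (\<lambda>u. frag_of (map \<sigma> u))"

text \<open>
  The sequences \<open>1 = j_0 \<le> \<dots> \<le> j_n = l\<close>. The entries are positions counted from 1, while the
  list itself is indexed from 0.
\<close>

definition subdivisions :: "nat \<Rightarrow> nat \<Rightarrow> nat list set" where
  "subdivisions n l = {js. length js = n + 1 \<and> sorted js \<and> js ! 0 = 1 \<and> js ! n = l}"

lemma finite_subdivisions: "finite (subdivisions n l)"
proof (rule finite_subset)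
  show "subdivisions n l \<subseteq> {js. set js \<subseteq> {..l} \<and> length js = n + 1}"
    by (auto simp: subdivisions_def in_set_conv_nth intro!: sorted_nth_mono)
  show "finite {js. set js \<subseteq> {..l} \<and> length js = n + 1}"
    by (rule finite_lists_length_eq) simp
qed

text \<open>
  The terms of \<open>c_j\<close>, each paired with a flag which is true if the term has type \<open>u\<close>; only the
  flags of caesuras matter.
\<close>

definition X_insert ::
  "nat \<Rightarrow> nat \<Rightarrow> nat list \<Rightarrow> nat list \<Rightarrow> nat list \<Rightarrow> (nat \<times> bool) list" where
  "X_insert s k u v js = concat (map (\<lambda>i.
      if u ! i = k then
        (let m = count_list (take (Suc i) u) k
         in map (\<lambda>l. (v ! (l - 1) + k - 1, l = js ! m \<and> m < count_list u k))
              [js ! (m - 1)..<Suc (js ! m)])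
      else if u ! i > k then [(u ! i + s - 1, True)]
      else [(u ! i, True)])
    [0..<length u])"

definition caesura_types :: "(nat \<times> bool) list \<Rightarrow> bool list" where
  "caesura_types c = map (\<lambda>i. snd (c ! i)) (filter (caesura (map fst c)) [0..<length c])"

definition X_comp :: "nat \<Rightarrow> nat \<Rightarrow> nat \<Rightarrow>
    (nat list \<Rightarrow>\<^sub>0 int) \<Rightarrow> (nat list \<Rightarrow>\<^sub>0 int) \<Rightarrow> (nat list \<Rightarrow>\<^sub>0 int)" where
  "X_comp r s k a b = frag_extend (\<lambda>u. frag_extend (\<lambda>v.
      \<Sum>js \<in> subdivisions (count_list u k) (length v).
        frag_cmul (shuffle_sign (caesura_types (X_insert s k u v js)))
          (X_norm (r + s - 1) (map fst (X_insert s k u v js)))) b) a"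

text \<open>
  Both \<open>i\<close> and \<open>j\<close> occur in a surjection, so that the subtraction in \<open>m\<close> is not truncated.
\<close>

definition X_cell_basis :: "nat \<Rightarrow> (nat \<Rightarrow> nat \<Rightarrow> nat) \<Rightarrow> nat list \<Rightarrow> nat list set" where
  "X_cell_basis r n w = {u \<in> (\<Union>d. X_basis r d).
     \<forall>i j. 1 \<le> i \<and> i < j \<and> j \<le> r \<longrightarrow>
       (let m = variations (restrict_pair i j u) - 1
        in m < n i j \<or>
           m = n i j \<and> first_occurrences (restrict_pair i j u) = restrict_pair i j w)}"

definition X_cell ::
  "nat \<Rightarrow> (nat \<Rightarrow> nat \<Rightarrow> nat) \<Rightarrow> nat list \<Rightarrow> (nat list \<Rightarrow>\<^sub>0 int) set" where
  "X_cell r n w = generate (free_Abelian_group (\<Union>d. X_basis r d)) (frag_of ` X_cell_basis r n w)"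

definition surjection_operad :: "nat list cellular_operad" where
  "surjection_operad = \<lparr>op_basis = X_basis, op_bd = X_bd, op_act = X_act,
     op_one = frag_of [1], op_comp = X_comp, op_cell = X_cell\<rparr>"

end

theory Submission
  imports Defs "HOL-Library.Sublist"
begin

text \<open>
  \<open>TR\<close> is read off the table letter by letter: if \<open>a\<close> is the first letter of the current row, then
  \<open>TR((a q), w\<^sub>1, \<dots>, w\<^sub>d) = a (TR(q, w\<^sub>1 - a, \<dots>, w\<^sub>d - a) + TR(w\<^sub>1, \<dots>, w\<^sub>d))\<close>, where \<open>w - a\<close> omits \<open>a\<close>
  from \<open>w\<close> and words with two equal consecutive letters vanish. The boundary of a surjection and
  the partial composites satisfy recursions of the same kind, so that the compatibility of \<open>TR\<close> with
  them is an induction on the number of letters. For the composites, a step in the first direction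
  of a lattice path gives a caesura of type \<open>u\<close>, and a step in the second direction one of type
  \<open>v\<close>; a step of the second kind after a letter that is not in the inserted block repeats this
  letter and vanishes.

  A surjection \<open>u\<close> in which \<open>i\<close> occurs \<open>d\<^sub>i + 1\<close> times determines a map from the product of the simplices
  of dimension \<open>d\<^sub>i\<close>, whose vertices choose an occurrence of each value, to the Barratt-Eccles
  operad, and \<open>TC(u)\<close> is the image of the fundamental chain. Recursively, \<open>TC(u) = w\<^sub>0 TC(\<partial>\<^sub>1 u)\<close>,
  where \<open>w\<^sub>0\<close> is the order of the first occurrences and \<open>\<partial>\<^sub>1\<close> is the part of the boundary that omits
  first occurrences. Only the path through the caesuras in their order in \<open>u\<close> contributes to \<open>TR(TC(u))\<close>.
\<close>

section \<open>Free abelian groups on words\<close>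

text \<open>Reading a letter deletes it from the later rows, so that the set of values shrinks and
  rows may become equal. Hence \<open>reduce\<close> is studied for permutations of an arbitrary set
  and on degenerate tables too; normalization enters afterwards, through the vanishing of
  \<open>reduce\<close> on them. The boundary of simplices is augmented so that its recursion on the
  first vertex has no exception in degree 0.

  That \<open>TC\<close> respects boundaries is not read off from the product of simplices, where
  the signs of all faces of all paths would have to be matched. It comes from \<open>TR\<close>: the
  identity \<open>TR TC = 1\<close> carries \<partial>\<partial> = 0 from simplices to surjections,
  and this is what the recursion of \<open>TC\<close> needs, starting in degree 1.

  For composites the obstacle is an inserted block that is used up during the induction. Composing
  with an empty block deletes \<open>k\<close>, whereas the rule for words needs a letter of the
  block at every occurrence of \<open>k\<close>; this case is computed separately.\<close>

abbreviation keys :: "('a \<Rightarrow>\<^sub>0 int) \<Rightarrow> 'a set" where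
  "keys \<equiv> Poly_Mapping.keys"

lemma frag_cmul_diff_distrib2: "frag_cmul c (a - b) = frag_cmul c a - frag_cmul c b"
  by (simp add: int_distrib(4) lookup_minus poly_mapping_eqI)

lemma frag_extend_frag_extend:
  "frag_extend f (frag_extend g c) = frag_extend (\<lambda>x. frag_extend f (g x)) c"
  using subset_UNIV
  by (induction c rule: frag_induction) (auto simp: frag_extend_diff)

lemma frag_extend_fun_add:
  "frag_extend (\<lambda>x. f x + g x) c = frag_extend f c + frag_extend g c"
  using subset_UNIV
  by (induction c rule: frag_induction) (auto simp: frag_extend_diff)

lemma frag_extend_fun_diff:
  "frag_extend (\<lambda>x. f x - g x) c = frag_extend f c - frag_extend g c"
  using subset_UNIV
  by (induction c rule: frag_induction) (auto simp: frag_extend_diff)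

lemma frag_extend_fun_cmul:
  "frag_extend (\<lambda>x. frag_cmul m (f x)) c = frag_cmul m (frag_extend f c)"
  using subset_UNIV
  by (induction c rule: frag_induction)
    (auto simp: frag_extend_diff frag_cmul_diff_distrib2)

lemma frag_extend_swap:
  "frag_extend (\<lambda>x. frag_extend (\<lambda>y. f x y) d) c = frag_extend (\<lambda>y. frag_extend (\<lambda>x. f x y) c) d"
  using subset_UNIV
  by (induction c rule: frag_induction) (auto simp: frag_extend_diff frag_extend_fun_diff frag_extend_eq_0)

lemma frag_extend_frag_of [simp]: "frag_extend frag_of c = c"
  using frag_expansion by metis

lemmas frag_linear = frag_extend_add frag_extend_diff frag_extend_minus frag_extend_cmul

text \<open>Prepending a letter, in the quotient by the words with two equal consecutive letters.\<close>

definition pre :: "'a \<Rightarrow> ('a list \<Rightarrow>\<^sub>0 int) \<Rightarrow> ('a list \<Rightarrow>\<^sub>0 int)" where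
  "pre a = frag_extend (\<lambda>w. if w \<noteq> [] \<and> hd w = a then 0 else frag_of (a # w))"

lemma pre_of: "pre a (frag_of w) = (if w \<noteq> [] \<and> hd w = a then 0 else frag_of (a # w))"
  by (simp add: pre_def)

lemma pre_0 [simp]: "pre a 0 = 0"
  by (simp add: pre_def)

lemma pre_add: "pre a (x + y) = pre a x + pre a y"
  and pre_diff: "pre a (x - y) = pre a x - pre a y"
  and pre_minus: "pre a (- x) = - pre a x"
  and pre_cmul: "pre a (frag_cmul m x) = frag_cmul m (pre a x)"
  by (simp_all add: pre_def frag_linear)

lemmas pre_linear = pre_add pre_diff pre_minus pre_cmul

lemma pre_frag_extend: "pre a (frag_extend f c) = frag_extend (\<lambda>x. pre a (f x)) c"
  by (simp add: pre_def frag_extend_frag_extend)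

lemma pre_pre [simp]: "pre a (pre a x) = 0"
  unfolding pre_def frag_extend_frag_extend by (intro frag_extend_eq_0) (simp split: if_splits)

text \<open>Opens \<open>pre\<close> under a linear map. It remains to show that the map is
  consistent with degenerate words, as in \<open>word_bd_pre\<close> and its analogues.\<close>

lemma frag_extend_pre:
  "frag_extend f (pre a x) = frag_extend (\<lambda>w. if w \<noteq> [] \<and> hd w = a then 0 else f (a # w)) x"
  unfolding pre_def frag_extend_frag_extend by (intro frag_extend_eq) simp

lemma keys_pre: "w \<in> keys (pre a x) \<Longrightarrow> \<exists>u \<in> keys x. w = a # u \<and> (u = [] \<or> a \<noteq> hd u)"
  unfolding pre_def by (drule subsetD[OF keys_frag_extend]) (auto split: if_splits)

section \<open>Table reduction\<close>

lemma sum_list_length_removeAll_le: "sum_list (map (length \<circ> removeAll a) ws) \<le> sum_list (map length ws)"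
  by (induction ws) (auto intro: add_mono)

text \<open>
  The table is read letter by letter. The first letter \<open>a\<close> of the current row either is not the
  last letter of this row, and then it does not occur any more, or it is the caesura that ends the row.
\<close>

function reduce :: "'a list list \<Rightarrow> ('a list \<Rightarrow>\<^sub>0 int)" where
  "reduce [] = 0"
| "reduce ([] # ws) = (if ws = [] then frag_of [] else 0)"
| "reduce ((a # q) # ws) = pre a (reduce (q # map (removeAll a) ws) + reduce ws)"
  by pat_completeness auto
termination
  by (relation "measure (\<lambda>ws. sum_list (map length ws))")
    (use sum_list_length_removeAll_le in \<open>auto simp: less_Suc_eq_le\<close>)

text \<open>The invariant of the inductions along \<open>reduce\<close>: the rows remain
  permutations of one set, which loses \<open>a\<close> only in the branch where \<open>a\<close> is
  no caesura.\<close>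

lemma perms_Cons_Cons:
  assumes "set ((a # q) # ws) \<subseteq> permutations_of_set S"
  shows "a \<in> S" "finite S" "set (q # map (removeAll a) ws) \<subseteq> permutations_of_set (S - {a})"
    "set ws \<subseteq> permutations_of_set S" "a \<notin> set q" "removeAll a q = q"
  using assms by (auto simp: permutations_of_set_def distinct_removeAll)

text \<open>Each value has one last occurrence, and the caesuras are the ends of the rows other than
  the last; this gives the length, and so the degree. The 1 on the left avoids a truncated
  subtraction.\<close>

lemma keys_reduce:
  assumes "set ws \<subseteq> permutations_of_set S" "u \<in> keys (reduce ws)"
  shows "set u = S \<and> distinct_adj u \<and> length u + 1 = card S + length ws"
  using assms
proof (induction ws arbitrary: S u rule: reduce.induct)
  case (2 ws)
  then show ?case by (auto simp: permutations_of_set_def split: if_splits)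
next
  case (3 a q ws)
  note p = perms_Cons_Cons[OF "3.prems"(1)]
  have "u \<in> keys (pre a (reduce (q # map (removeAll a) ws) + reduce ws))"
    using "3.prems"(2) by simp
  then obtain v where v: "v \<in> keys (reduce (q # map (removeAll a) ws) + reduce ws)"
    "u = a # v" "v = [] \<or> a \<noteq> hd v"
    by (blast dest: keys_pre)
  from v(1) have v': "v \<in> keys (reduce (q # map (removeAll a) ws)) \<union> keys (reduce ws)"
    by (rule subsetD[OF keys_add])
  have S: "Suc (card (S - {a})) = card S" "insert a S = S"
    using card.remove[OF p(2,1)] p(1) by auto
  from v' show ?case
  proof
    assume "v \<in> keys (reduce (q # map (removeAll a) ws))"
    from "3.IH"(1)[OF p(3) this] v(2,3) S show ?thesis
      by (simp add: distinct_adj_Cons del: card_Diff_insert)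
  next
    assume "v \<in> keys (reduce ws)"
    from "3.IH"(2)[OF p(4) this] v(2,3) S show ?thesis
      by (simp add: distinct_adj_Cons)
  qed
qed auto

text \<open>If the first two rows agree, both branches vanish: deleting \<open>a\<close> from the
  second row leaves \<open>q\<close>, again a repetition, and ending the first row at
  \<open>a\<close> puts \<open>a\<close> before words that begin with \<open>a\<close>. A repetition
  further down survives in both branches.\<close>

lemma reduce_degenerate:
  assumes "set ws \<subseteq> permutations_of_set S" "\<not> distinct_adj ws"
  shows "reduce ws = 0"
  using assms
proof (induction ws arbitrary: S rule: reduce.induct)
  case (3 a q ws)
  note p = perms_Cons_Cons[OF "3.prems"(1)]
  show ?case
  proof (cases "distinct_adj ws")
    case True
    with "3.prems"(2) obtain ws' where ws: "ws = (a # q) # ws'"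
      by (cases ws) (auto simp: distinct_adj_Cons)
    have "reduce (q # map (removeAll a) ws) = 0"
      by (rule "3.IH"(1)[OF p(3)]) (use p(6) ws in auto)
    then show ?thesis
      by (simp add: ws)
  next
    case False
    then have "\<not> distinct_adj (q # map (removeAll a) ws)"
      by (auto simp: distinct_adj_Cons dest: distinct_adj_mapD)
    then show ?thesis
      using "3.IH"(1)[OF p(3)] "3.IH"(2)[OF p(4) False] by simp
  qed
qed auto

lemma reduce_singleton:
  assumes "distinct w"
  shows "reduce [w] = frag_of w"
  using assms by (induction w) (auto simp: pre_of)

lemma pre_map:
  assumes "inj_on f (insert a (\<Union> (set ` keys x)))"
  shows "pre (f a) (frag_extend (frag_of \<circ> map f) x) = frag_extend (frag_of \<circ> map f) (pre a x)"
  unfolding pre_def frag_extend_frag_extend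
proof (intro frag_extend_eq)
  fix w assume "w \<in> keys x"
  then have "hd w = a" if "w \<noteq> []" "f (hd w) = f a"
    using assms that by (auto simp: inj_on_def)
  then show "frag_extend (\<lambda>w. if w \<noteq> [] \<and> hd w = f a then 0 else frag_of (f a # w)) ((frag_of \<circ> map f) w) =
         frag_extend (frag_of \<circ> map f) (if w \<noteq> [] \<and> hd w = a then 0 else frag_of (a # w))"
    by (auto simp: hd_map)
qed

lemma map_removeAll_inj_on:
  "inj_on f (insert a (set xs)) \<Longrightarrow> map f (removeAll a xs) = removeAll (f a) (map f xs)"
  by (induction xs) (auto simp: inj_on_def)

text \<open>Serves for the equivariance of \<open>TR\<close> and for renaming the outer letters once
  an inserted block is used up. By injectivity on \<open>S\<close>, renaming creates no new
  degenerate words.\<close>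

lemma reduce_map:
  assumes "set ws \<subseteq> permutations_of_set S" "inj_on f S"
  shows "reduce (map (map f) ws) = frag_extend (frag_of \<circ> map f) (reduce ws)"
  using assms
proof (induction ws arbitrary: S rule: reduce.induct)
  case (3 a q ws)
  note p = perms_Cons_Cons[OF "3.prems"(1)]
  have "map (removeAll (f a)) (map (map f) ws) = map (map f) (map (removeAll a) ws)"
    using p(1,4)
    by (force simp: permutations_of_set_def
        intro!: map_removeAll_inj_on[symmetric] inj_on_subset[OF "3.prems"(2)])
  moreover have "inj_on f (insert a (\<Union> (set ` keys (reduce (q # map (removeAll a) ws) + reduce ws))))"
    using keys_add[of "reduce (q # map (removeAll a) ws)" "reduce ws"]
      keys_reduce[OF p(3)] keys_reduce[OF p(4)] p(1) by (intro inj_on_subset[OF "3.prems"(2)]) blast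
  note pre_map[OF this]
  moreover have "reduce (map (map f) (q # map (removeAll a) ws)) =
      frag_extend (frag_of \<circ> map f) (reduce (q # map (removeAll a) ws))"
    by (rule "3.IH"(1)[OF p(3)]) (use "3.prems"(2) in \<open>auto intro: inj_on_diff\<close>)
  ultimately show ?case
    using "3.IH"(2)[OF p(4) "3.prems"(2)]
    by (simp only: list.map reduce.simps frag_linear)
qed auto

section \<open>Boundaries\<close>

text \<open>Keeps the empty word, unlike \<open>E_norm\<close>, and does not test surjectivity,
  unlike \<open>X_norm\<close>, so that \<open>nrm_Cons\<close> holds for all words.\<close>

definition nrm :: "'a list \<Rightarrow> ('a list \<Rightarrow>\<^sub>0 int)" where
  "nrm w = (if distinct_adj w then frag_of w else 0)"

lemma nrm_Nil [simp]: "nrm [] = frag_of []"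
  by (simp add: nrm_def)

lemma nrm_Cons: "nrm (a # w) = pre a (nrm w)"
  by (auto simp: nrm_def pre_of distinct_adj_Cons)

lemma nrm_distinct_adj: "distinct_adj w \<Longrightarrow> nrm w = frag_of w"
  by (simp add: nrm_def)

definition erase_single :: "'a \<Rightarrow> 'a list \<Rightarrow> ('a list \<Rightarrow>\<^sub>0 int)" where
  "erase_single a w = (if count_list w a = 1 then nrm (removeAll a w) else 0)"

text \<open>
  The summand with \<open>erase_single\<close> is the last occurrence of \<open>a\<close> when \<open>a\<close> occurs just twice: its sign
  is determined by the first letter.
\<close>

fun word_bd :: "'a list \<Rightarrow> ('a list \<Rightarrow>\<^sub>0 int)" where
  "word_bd [] = 0"
| "word_bd (a # u) =
    (if a \<in> set u then nrm u - pre a (word_bd u) - pre a (erase_single a u)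
     else pre a (word_bd u))"

lemma word_bd_distinct: "distinct u \<Longrightarrow> word_bd u = 0"
  by (induction u) auto

lemma erase_single_notin: "a \<notin> set u \<Longrightarrow> erase_single a u = 0"
  by (simp add: erase_single_def)

lemma erase_single_Cons: "b \<noteq> a \<Longrightarrow> erase_single a (b # w) = pre b (erase_single a w)"
  by (simp add: erase_single_def nrm_Cons)

lemma erase_single_Cons_same: "erase_single a (a # w) = (if a \<in> set w then 0 else nrm w)"
  by (simp add: erase_single_def count_list_0_iff)

text \<open>The boundary is compatible with killing degenerate words: for \<open>w = a # v\<close>
  the word \<open>a # w\<close> vanishes, and the omissions of its two leading letters cancel. The
  second omission is a term of \<open>word_bd w\<close> if \<open>a\<close> occurs in
  \<open>v\<close>, and is given by \<open>erase_single\<close> otherwise.\<close>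

lemma word_bd_pre:
  assumes "\<And>w. w \<in> keys x \<Longrightarrow> a \<in> set w \<and> distinct_adj w"
  shows "frag_extend word_bd (pre a x) =
    x - pre a (frag_extend word_bd x) - pre a (frag_extend (erase_single a) x)"
proof -
  have "(if w \<noteq> [] \<and> hd w = a then 0 else word_bd (a # w)) =
    frag_of w - pre a (word_bd w) - pre a (erase_single a w)" if "w \<in> keys x" for w
  proof (cases "w \<noteq> [] \<and> hd w = a")
    case True
    then obtain v where v: "w = a # v" by (cases w) auto
    have "frag_of w = pre a (nrm v)"
      using assms[OF that] nrm_Cons[of a v] by (simp add: v nrm_distinct_adj)
    then show ?thesis
      by (auto simp: v erase_single_Cons_same pre_linear)
  next
    case False
    then show ?thesis
      using assms[OF that] by (auto simp: nrm_distinct_adj)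
  qed
  then have "frag_extend word_bd (pre a x) =
      frag_extend (\<lambda>w. frag_of w - pre a (word_bd w) - pre a (erase_single a w)) x"
    unfolding frag_extend_pre by (rule frag_extend_eq)
  then show ?thesis
    by (simp add: frag_extend_fun_diff pre_frag_extend)
qed

lemma word_bd_pre_notin:
  assumes "\<And>w. w \<in> keys x \<Longrightarrow> a \<notin> set w"
  shows "frag_extend word_bd (pre a x) = pre a (frag_extend word_bd x)"
  unfolding frag_extend_pre pre_frag_extend
  by (rule frag_extend_eq) (use assms hd_in_set in fastforce)

lemma erase_single_pre:
  assumes "b \<noteq> a"
  shows "frag_extend (erase_single a) (pre b x) = pre b (frag_extend (erase_single a) x)"
  unfolding frag_extend_pre pre_frag_extend
proof (rule frag_extend_eq)
  fix w
  show "(if w \<noteq> [] \<and> hd w = b then 0 else erase_single a (b # w)) = pre b (erase_single a w)"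
    using assms by (cases w) (auto simp: erase_single_Cons)
qed

section \<open>Alternating sum of the faces of a simplex, before normalization\<close>

definition simplex_bd :: "'a list \<Rightarrow> ('a list \<Rightarrow>\<^sub>0 int)" where
  "simplex_bd ws = (\<Sum>i<length ws. frag_cmul ((- 1) ^ i) (frag_of (omit i ws)))"

lemma omit_Cons_0 [simp]: "omit 0 (a # u) = u"
  and omit_Cons_Suc [simp]: "omit (Suc i) (a # u) = a # omit i u"
  by (simp_all add: omit_def)

lemma simplex_bd_Nil [simp]: "simplex_bd [] = 0"
  by (simp add: simplex_bd_def)

lemma simplex_bd_Cons:
  "simplex_bd (w # ws) = frag_of ws - frag_extend (frag_of \<circ> (#) w) (simplex_bd ws)"
proof -
  have "simplex_bd (w # ws) =
      frag_of ws + (\<Sum>i<length ws. - frag_cmul ((- 1) ^ i) (frag_of (w # omit i ws)))"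
    by (simp add: simplex_bd_def sum.lessThan_Suc_shift del: sum.lessThan_Suc)
  then show ?thesis
    by (simp add: simplex_bd_def frag_extend_sum o_def frag_extend_cmul sum_negf
        del: minus_frag_cmul)
qed

lemma simplex_bd_simplex_bd: "frag_extend simplex_bd (simplex_bd ws) = 0"
proof (induction ws)
  case (Cons w ws)
  have "frag_extend simplex_bd (frag_extend (frag_of \<circ> (#) w) (simplex_bd ws)) =
      simplex_bd ws - frag_extend (frag_of \<circ> (#) w) (frag_extend simplex_bd (simplex_bd ws))"
    by (simp add: frag_extend_compose o_def simplex_bd_Cons frag_extend_fun_diff frag_extend_frag_extend)
  with Cons show ?case
    by (simp add: simplex_bd_Cons frag_linear)
qed simp

lemma simplex_bd_map:
  "simplex_bd (map f ws) = frag_extend (frag_of \<circ> map f) (simplex_bd ws)"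
proof (induction ws)
  case (Cons w ws)
  show ?case
    by (simp add: simplex_bd_Cons Cons frag_linear frag_extend_frag_extend o_def)
qed simp

lemma keys_simplex_bd:
  "z \<in> keys (simplex_bd ws) \<Longrightarrow> set z \<subseteq> set ws \<and> Suc (length z) = length ws"
proof (induction ws arbitrary: z)
  case (Cons w ws)
  then have "z \<in> keys (frag_of ws) \<union> keys (frag_extend (frag_of \<circ> (#) w) (simplex_bd ws))"
    unfolding simplex_bd_Cons by (intro subsetD[OF keys_diff])
  then show ?case
  proof
    assume "z \<in> keys (frag_extend (frag_of \<circ> (#) w) (simplex_bd ws))"
    then obtain v where "v \<in> keys (simplex_bd ws)" "z = w # v"
      by (auto dest!: subsetD[OF keys_frag_extend])
    with Cons.IH show ?thesis by fastforce
  qed auto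
qed simp

section \<open>Table reduction is a chain map\<close>

text \<open>Words in which \<open>a\<close> is a caesura contain it more than once and are killed.
  In the others \<open>a\<close> was read without ending a row, and deleting it afterwards amounts
  to deleting it from the table.\<close>

lemma erase_single_reduce:
  assumes "set ws \<subseteq> permutations_of_set S" "a \<in> S"
  shows "frag_extend (erase_single a) (reduce ws) = reduce (map (removeAll a) ws)"
  using assms
proof (induction ws arbitrary: S rule: reduce.induct)
  case (2 ws)
  then show ?case by (auto simp: permutations_of_set_def)
next
  case (3 b q ws)
  note p = perms_Cons_Cons[OF "3.prems"(1)]
  show ?case
  proof (cases "b = a")
    case True
    have "frag_extend (erase_single a) (pre a (reduce (q # map (removeAll a) ws))) =
        frag_extend frag_of (reduce (q # map (removeAll a) ws))"
      unfolding frag_extend_pre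
    proof (rule frag_extend_eq)
      fix w assume "w \<in> keys (reduce (q # map (removeAll a) ws))"
      with keys_reduce[OF p(3)] True have "a \<notin> set w" "distinct_adj w" by auto
      then show "(if w \<noteq> [] \<and> hd w = a then 0 else erase_single a (a # w)) = frag_of w"
        using hd_in_set[of w] by (auto simp: erase_single_Cons_same nrm_distinct_adj)
    qed
    moreover have "frag_extend (erase_single a) (pre a (reduce ws)) = 0"
      unfolding frag_extend_pre
    proof (rule frag_extend_eq_0)
      fix w assume "w \<in> keys (reduce ws)"
      with keys_reduce[OF p(4)] "3.prems" have "a \<in> set w" by auto
      then show "(if w \<noteq> [] \<and> hd w = a then 0 else erase_single a (a # w)) = 0"
        by (simp add: erase_single_Cons_same)
    qed
    ultimately show ?thesis
      using True p(6) by (simp add: frag_linear pre_linear)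
  next
    case False
    have "removeAll a \<circ> removeAll b = removeAll b \<circ> (removeAll a :: 'a list \<Rightarrow> _)"
      by (auto simp: fun_eq_iff removeAll_filter_not_eq intro!: filter_cong)
    then show ?thesis
      using "3.IH"(1)[OF p(3)] "3.IH"(2)[OF p(4)] False "3.prems"(2)
      by (simp add: erase_single_pre frag_linear)
  qed
qed simp

text \<open>
  Both sides are augmented: the boundary of a vertex is the empty simplex, which \<open>reduce\<close> sends to 0.
\<close>

theorem word_bd_reduce:
  assumes "set ws \<subseteq> permutations_of_set S"
  shows "frag_extend word_bd (reduce ws) = frag_extend reduce (simplex_bd ws)"
  using assms
proof (induction ws arbitrary: S rule: reduce.induct)
  case (2 ws)
  show ?case
  proof (cases ws)
    case (Cons w ws')
    then have "w = []" using 2 by (auto simp: permutations_of_set_def)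
    with Cons show ?thesis
    proof (cases ws')
      case (Cons w' ws'')
      have "frag_extend (reduce \<circ> (#) []) (simplex_bd ws) = 0"
        using \<open>ws = w # ws'\<close> Cons by (auto intro!: frag_extend_eq_0 dest!: keys_simplex_bd)
      then show ?thesis
        unfolding simplex_bd_Cons[of _ ws] frag_linear frag_extend_compose
        using \<open>ws = w # ws'\<close> Cons \<open>w = []\<close> by simp
    qed (simp add: simplex_bd_Cons)
  qed (simp add: simplex_bd_Cons)
next
  case (3 a q ws)
  note p = perms_Cons_Cons[OF "3.prems"]
  let ?R = "map (removeAll a)"
  define X Y where "X = reduce (q # ?R ws)" and "Y = reduce ws"
  define \<beta> where "\<beta> = frag_extend (\<lambda>z. reduce (q # ?R z)) (simplex_bd ws)"
  have X: "a \<notin> set w" if "w \<in> keys X" for w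
    using keys_reduce[OF p(3)] that by (auto simp: X_def)
  have Y: "a \<in> set w \<and> distinct_adj w" if "w \<in> keys Y" for w
    using keys_reduce[OF p(4)] that p(1) by (auto simp: Y_def)
  have IH1: "frag_extend word_bd X = reduce (?R ws) - \<beta>"
    using "3.IH"(1)[OF p(3)]
    by (simp add: X_def \<beta>_def simplex_bd_Cons simplex_bd_map frag_linear frag_extend_frag_extend o_def)
  have IH2: "frag_extend word_bd Y = frag_extend reduce (simplex_bd ws)"
    using "3.IH"(2)[OF p(4)] by (simp add: Y_def)
  \<comment> \<open>In the first branch, the face that omits the first row is
    \<open>reduce (?R ws)\<close>; in the second, so is the term for the last occurrence of
    \<open>a\<close>, with the opposite sign. There remain \<open>Y\<close>, the face without the
    first row, and both branches of the other faces.\<close>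
  have "frag_extend word_bd (reduce ((a # q) # ws)) =
      pre a (reduce (?R ws) - \<beta>) + (Y - pre a (frag_extend word_bd Y) - pre a (reduce (?R ws)))"
    using erase_single_reduce[OF p(4,1)] word_bd_pre[OF Y] word_bd_pre_notin[OF X]
    by (simp add: X_def[symmetric] Y_def[symmetric] IH1 pre_add frag_extend_add)
  also have "\<dots> = Y - pre a (\<beta> + frag_extend reduce (simplex_bd ws))"
    by (simp add: IH2 pre_linear)
  also have "\<dots> = Y - frag_extend (\<lambda>z. reduce ((a # q) # z)) (simplex_bd ws)"
    by (simp add: \<beta>_def pre_frag_extend frag_extend_fun_add pre_add)
  also have "\<dots> = frag_extend reduce (simplex_bd ((a # q) # ws))"
    by (simp add: Y_def simplex_bd_Cons[of _ ws] frag_linear frag_extend_frag_extend o_def)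
  finally show ?case .
qed simp

section \<open>The boundary of a surjection\<close>

lemma X_bd_sign_Cons_0:
  "X_bd_sign (a # u) 0 = (if a \<in> set u then 1 else 0)"
  by (simp add: X_bd_sign_def caesura_def caesura_sign_def)

lemma caesura_Cons_0: "caesura (a # u) 0 \<longleftrightarrow> a \<in> set u"
  and caesura_Cons_Suc [simp]: "caesura (a # u) (Suc i) \<longleftrightarrow> caesura u i"
  by (simp_all add: caesura_def)

lemma caesura_sign_Cons_Suc:
  "caesura_sign (a # u) (Suc i) = (if a \<in> set u then - caesura_sign u i else caesura_sign u i)"
proof -
  have "{j \<in> {..<Suc i}. caesura (a # u) j} =
      (if a \<in> set u then {0} else {}) \<union> Suc ` {j \<in> {..<i}. caesura u j}"
    by (auto simp: lessThan_Suc_eq_insert_0 caesura_Cons_0)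
  then show ?thesis
    by (simp add: caesura_sign_def card_image)
qed

definition second_and_last :: "'a \<Rightarrow> 'a list \<Rightarrow> nat \<Rightarrow> bool" where
  "second_and_last a u i \<longleftrightarrow> u ! i = a \<and> a \<notin> set (take i u) \<and> a \<notin> set (drop (Suc i) u)"

text \<open>The caesuras after a new caesura change sign, and a last occurrence inherits the change
  from its predecessor. Only an \<open>a\<close> that occurs once in \<open>u\<close> changes its
  nature: its sign 0 becomes the opposite of the sign 1 of the new first letter.\<close>

lemma X_bd_sign_Cons_Suc:
  assumes "i < length u"
  shows "X_bd_sign (a # u) (Suc i) = (if a \<in> set u then - X_bd_sign u i else X_bd_sign u i)
    - (if second_and_last a u i then 1 else 0)"
proof -
  consider (caes) "caesura u i"
    | (last) "\<not> caesura u i" "u ! i \<in> set (take i u)"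
    | (single) "\<not> caesura u i" "u ! i \<notin> set (take i u)" by blast
  then show ?thesis
  proof cases
    case caes
    then have "\<not> second_and_last a u i"
      by (auto simp: caesura_def second_and_last_def)
    with caes show ?thesis
      by (auto simp: X_bd_sign_def caesura_sign_Cons_Suc)
  next
    case last
    let ?M = "{j \<in> {..<i}. u ! j = u ! i}"
    have M: "?M \<noteq> {}" "finite ?M"
      using last(2) assms by (auto simp: in_set_conv_nth)
    have "{j \<in> {..<Suc i}. (a # u) ! j = (a # u) ! Suc i} =
        (if a = u ! i then {0} else {}) \<union> Suc ` ?M"
      by (auto simp: lessThan_Suc_eq_insert_0)
    moreover have "Max (Suc ` ?M) = Suc (Max ?M)"
      using mono_Max_commute[of Suc ?M] M by (auto simp: mono_def)
    ultimately have "Max {j \<in> {..<Suc i}. (a # u) ! j = (a # u) ! Suc i} = Suc (Max ?M)"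
      using M by (auto simp: Max_insert)
    moreover have "\<not> second_and_last a u i"
      using last by (auto simp: second_and_last_def)
    ultimately show ?thesis
      using last by (simp add: X_bd_sign_def caesura_sign_Cons_Suc del: nth_Cons_Suc)
  next
    case single
    then have "{j \<in> {..<i}. u ! j = u ! i} = {}"
      using assms by (auto simp: in_set_conv_nth)
    then have "{j \<in> {..<Suc i}. (a # u) ! j = (a # u) ! Suc i} = (if a = u ! i then {0} else {})"
      by (auto simp: less_Suc_eq_0_disj intro!: gr0I)
    moreover have "second_and_last a u i \<longleftrightarrow> a = u ! i"
      using single assms by (auto simp: second_and_last_def caesura_def)
    ultimately show ?thesis
      using single by (cases "a = u ! i") (simp_all add: X_bd_sign_def caesura_sign_def)
  qed
qed

lemma sum_second_and_last:
  "(\<Sum>i<length u. if second_and_last a u i then g (omit i u) else 0) =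
    (if count_list u a = 1 then g (removeAll a u) else 0)"
proof (induction u arbitrary: g)
  case (Cons b u)
  have 0: "second_and_last a (b # u) 0 \<longleftrightarrow> b = a \<and> a \<notin> set u"
    by (auto simp: second_and_last_def)
  have Suc: "second_and_last a (b # u) (Suc i) \<longleftrightarrow> b \<noteq> a \<and> second_and_last a u i" for i
    by (auto simp: second_and_last_def)
  show ?case
    using Cons[of "\<lambda>v. g (b # v)"]
    by (auto simp: sum.lessThan_Suc_shift 0 Suc count_list_0_iff
        simp del: sum.lessThan_Suc cong: if_cong)
qed simp

lemma word_bd_sum:
  "(\<Sum>i<length u. frag_cmul (X_bd_sign u i) (nrm (omit i u))) = word_bd u"
proof (induction u)
  case (Cons a u)
  define \<epsilon> :: int where "\<epsilon> = (if a \<in> set u then -1 else 1)"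
  have "(\<Sum>i<length u. frag_cmul (X_bd_sign (a # u) (Suc i)) (pre a (nrm (omit i u)))) =
      (\<Sum>i<length u. frag_cmul \<epsilon> (frag_cmul (X_bd_sign u i) (pre a (nrm (omit i u))))
         - (if second_and_last a u i then pre a (nrm (omit i u)) else 0))"
    by (intro sum.cong) (auto simp: X_bd_sign_Cons_Suc \<epsilon>_def frag_cmul_diff_distrib)
  also have "\<dots> = frag_cmul \<epsilon> (pre a (word_bd u)) - pre a (erase_single a u)"
    using sum_second_and_last[of a u "\<lambda>v. pre a (nrm v)"]
    by (simp add: sum_subtractf erase_single_def flip: Cons frag_cmul_sum)
      (simp add: pre_def frag_extend_sum o_def frag_extend_cmul frag_cmul_sum)
  finally show ?case
    by (auto simp: sum.lessThan_Suc_shift X_bd_sign_Cons_0 \<epsilon>_def nrm_Cons erase_single_notin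
        simp del: sum.lessThan_Suc)
qed simp

text \<open>Reconciles \<open>nrm\<close> with \<open>X_norm\<close>: a value is lost only if the
  omitted letter is its single occurrence, and such a letter has sign 0.\<close>

lemma X_bd_sign_eq_0:
  assumes "i < length u" "set (omit i u) \<noteq> set u"
  shows "X_bd_sign u i = 0"
proof -
  have "u = take i u @ u ! i # drop (Suc i) u"
    using assms(1) by (simp add: id_take_nth_drop)
  then have "set u = insert (u ! i) (set (omit i u))"
    unfolding omit_def by (metis Un_insert_right list.simps(15) set_append)
  with assms show ?thesis
    by (auto simp: X_bd_sign_def caesura_def omit_def)
qed

lemma X_bd_frag_of:
  assumes "set u = {1..r}"
  shows "X_bd r (frag_of u) = word_bd u"
  unfolding X_bd_def frag_extend_of word_bd_sum[symmetric]
proof (intro sum.cong refl)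
  fix i assume "i \<in> {..<length u}"
  then show "frag_cmul (X_bd_sign u i) (X_norm r (omit i u)) =
      frag_cmul (X_bd_sign u i) (nrm (omit i u))"
    using X_bd_sign_eq_0[of i u] assms by (cases "set (omit i u) = set u") (auto simp: X_norm_def nrm_def)
qed

lemma E_bd_frag_of: "E_bd r (frag_of ws) = frag_extend E_norm (simplex_bd ws)"
  by (simp add: E_bd_def simplex_bd_def frag_extend_sum o_def frag_extend_cmul)

section \<open>Table completion\<close>

lemma removeAll_commute: "removeAll a (removeAll b w) = removeAll b (removeAll a w)"
  by (auto simp: removeAll_filter_not_eq intro!: filter_cong)

lemma first_occurrences_Nil [simp]: "first_occurrences [] = []"
  by (simp add: first_occurrences_def)

lemma first_occurrences_Cons:
  "first_occurrences (a # u) = a # removeAll a (first_occurrences u)"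
proof -
  have "remdups (v @ [a]) = remdups (removeAll a v) @ [a]" for v
    by (induction v) auto
  then show ?thesis
    by (simp add: first_occurrences_def removeAll_filter_not_eq remdups_filter rev_filter)
qed

lemma set_first_occurrences [simp]: "set (first_occurrences u) = set u"
  and distinct_first_occurrences [simp]: "distinct (first_occurrences u)"
  by (simp_all add: first_occurrences_def)

lemma first_occurrences_distinct: "distinct u \<Longrightarrow> first_occurrences u = u"
  by (induction u) (auto simp: first_occurrences_Cons)

lemma first_occurrences_removeAll:
  "first_occurrences (removeAll a u) = removeAll a (first_occurrences u)"
  by (induction u) (auto simp: first_occurrences_Cons removeAll_commute)

text \<open>
  The part of the boundary that omits a first occurrence of a value outside \<open>A\<close>; only values that
  occur again contribute.
\<close>

fun first_bd :: "'a set \<Rightarrow> 'a list \<Rightarrow> ('a list \<Rightarrow>\<^sub>0 int)" where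
  "first_bd A [] = 0"
| "first_bd A (a # u) =
    (if a \<in> set u then (if a \<in> A then 0 else nrm u) - pre a (first_bd (insert a A) u)
     else pre a (first_bd A u))"

lemma keys_diffE:
  assumes "x \<in> keys (a - b)"
  obtains "x \<in> keys a" | "x \<in> keys b"
  using keys_diff assms by fastforce

lemma keys_nrm: "w \<in> keys (nrm u) \<Longrightarrow> w = u \<and> distinct_adj u"
  by (auto simp: nrm_def split: if_splits)

lemma keys_word_bd:
  "w \<in> keys (word_bd u) \<Longrightarrow> set w = set u \<and> distinct_adj w \<and> Suc (length w) = length u"
proof (induction u arbitrary: w)
  case (Cons a u)
  show ?case
  proof (cases "a \<in> set u")
    case True
    with Cons.prems have "w \<in> keys (nrm u - pre a (word_bd u) - pre a (erase_single a u))"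
      by simp
    then consider "w \<in> keys (nrm u)" | "w \<in> keys (pre a (word_bd u))"
      | "w \<in> keys (pre a (erase_single a u))"
      by (elim keys_diffE)
    then show ?thesis
    proof cases
      case 1
      with True show ?thesis by (auto dest!: keys_nrm)
    next
      case 2
      with Cons.IH True show ?thesis by (fastforce dest!: keys_pre simp: distinct_adj_Cons)
    next
      case 3
      then obtain v where v: "v \<in> keys (erase_single a u)" "w = a # v" "v = [] \<or> a \<noteq> hd v"
        by (blast dest: keys_pre)
      then have "v = removeAll a u" "distinct_adj v" "count_list u a = 1"
        by (auto simp: erase_single_def split: if_splits dest!: keys_nrm)
      moreover have "length (removeAll a u) + count_list u a = length u"
        by (induction u) auto
      ultimately show ?thesis
        using v True by (auto simp: distinct_adj_Cons)
    qed
  next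
    case False
    with Cons show ?thesis by (fastforce dest!: keys_pre simp: distinct_adj_Cons)
  qed
qed simp

lemma keys_first_bd:
  "w \<in> keys (first_bd A u) \<Longrightarrow> set w = set u \<and> distinct_adj w \<and> Suc (length w) = length u"
proof (induction u arbitrary: w A)
  case (Cons a u)
  show ?case
  proof (cases "a \<in> set u")
    case True
    with Cons.prems have "w \<in> keys ((if a \<in> A then 0 else nrm u) - pre a (first_bd (insert a A) u))"
      by simp
    then consider "w \<in> keys (if a \<in> A then 0 else nrm u)"
      | "w \<in> keys (pre a (first_bd (insert a A) u))"
      by (elim keys_diffE)
    then show ?thesis
    proof cases
      case 1
      with True show ?thesis by (auto split: if_splits dest!: keys_nrm)
    next
      case 2
      with Cons.IH True show ?thesis by (fastforce dest!: keys_pre simp: distinct_adj_Cons)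
    qed
  next
    case False
    with Cons show ?thesis by (fastforce dest!: keys_pre simp: distinct_adj_Cons)
  qed
qed simp

text \<open>The counter is the degree of \<open>u\<close>, which \<open>first_bd\<close> lowers by
  one in every term. It makes a recursion through a linear combination of words primitive.\<close>

primrec completion :: "nat \<Rightarrow> 'a list \<Rightarrow> ('a list list \<Rightarrow>\<^sub>0 int)" where
  "completion 0 u = frag_of [first_occurrences u]"
| "completion (Suc n) u = pre (first_occurrences u) (frag_extend (completion n) (first_bd {} u))"

text \<open>
  A word encodes the product of simplices whose vertices choose an occurrence of each value, hence a
  permutation; \<open>tcomplete\<close> is the sum over the monotone paths in this product. Leaving the initial
  vertex along an edge amounts to omitting the first occurrence of a value.
\<close>

definition tcomplete :: "'a list \<Rightarrow> ('a list list \<Rightarrow>\<^sub>0 int)" where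
  "tcomplete u = completion (length u - card (set u)) u"

lemma card_set_less_length: "\<not> distinct u \<Longrightarrow> card (set u) < length u"
  using card_length[of u] card_distinct[of u] by force

lemma complete_distinct: "distinct u \<Longrightarrow> tcomplete u = frag_of [u]"
  by (simp add: tcomplete_def distinct_card first_occurrences_distinct)

lemma complete_rec:
  assumes "\<not> distinct u"
  shows "tcomplete u = pre (first_occurrences u) (frag_extend tcomplete (first_bd {} u))"
proof -
  obtain n where n: "length u - card (set u) = Suc n"
    using card_set_less_length[OF assms] by (metis Suc_diff_Suc)
  have "frag_extend (completion n) (first_bd {} u) = frag_extend tcomplete (first_bd {} u)"
  proof (rule frag_extend_eq)
    fix w assume "w \<in> keys (first_bd {} u)"
    then have "length w - card (set w) = n"
      using n keys_first_bd by fastforce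
    then show "completion n w = tcomplete w"
      by (simp add: tcomplete_def)
  qed
  with n show ?thesis
    by (simp add: tcomplete_def)
qed

lemma keys_complete:
  assumes "ws \<in> keys (tcomplete u)"
  shows "ws \<noteq> [] \<and> hd ws = first_occurrences u \<and> set ws \<subseteq> permutations_of_set (set u) \<and>
    distinct_adj ws \<and> length ws + card (set u) = Suc (length u)"
  using assms
proof (induction "length u" arbitrary: u ws rule: less_induct)
  case less
  show ?case
  proof (cases "distinct u")
    case True
    with less.prems show ?thesis
      by (auto simp: complete_distinct first_occurrences_distinct distinct_card permutations_of_set_def)
  next
    case False
    with less.prems obtain z where z: "z \<in> keys (frag_extend tcomplete (first_bd {} u))"
      "ws = first_occurrences u # z" "z = [] \<or> first_occurrences u \<noteq> hd z"
      by (auto simp: complete_rec dest!: keys_pre)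
    from z(1) obtain w where w: "w \<in> keys (first_bd {} u)" "z \<in> keys (tcomplete w)"
      by (auto dest!: subsetD[OF keys_frag_extend])
    with less.hyps[of w z] keys_first_bd[OF w(1)] z show ?thesis
      by (auto simp: distinct_adj_Cons permutations_of_set_def)
  qed
qed

text \<open>All simplices of \<open>tcomplete u\<close> start at the vertex
  \<open>first_occurrences u\<close>. Hence the recursion loses every term whose initial vertex is
  unchanged.\<close>

lemma pre_complete: "pre (first_occurrences u) (tcomplete u) = 0"
  unfolding pre_def by (rule frag_extend_eq_0) (simp add: keys_complete)

lemma inj_Cons: "inj ((#) a)"
  by (simp add: inj_def)

text \<open>A value that occurs once contributes a simplex of dimension 0 to the product, so that a
  leading \<open>a\<close> leads every vertex.\<close>

lemma complete_Cons_notin: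
  assumes "a \<notin> set u"
  shows "tcomplete (a # u) = frag_extend (frag_of \<circ> map ((#) a)) (tcomplete u)"
  using assms
proof (induction "length u" arbitrary: u rule: less_induct)
  case less
  show ?case
  proof (cases "distinct u")
    case True
    with less.prems show ?thesis
      by (simp add: complete_distinct)
  next
    case False
    have *: "tcomplete (a # w) = frag_extend (frag_of \<circ> map ((#) a)) (tcomplete w)"
      "\<not> (w \<noteq> [] \<and> hd w = a)" if "w \<in> keys (first_bd {} u)" for w
      using keys_first_bd[OF that] less.prems less.hyps[of w] hd_in_set[of w] by auto
    have "frag_extend tcomplete (pre a (first_bd {} u)) =
        frag_extend (\<lambda>w. frag_extend (frag_of \<circ> map ((#) a)) (tcomplete w)) (first_bd {} u)"
      unfolding frag_extend_pre by (rule frag_extend_eq) (use * in auto)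
    then have "tcomplete (a # u) = pre (a # first_occurrences u)
        (frag_extend (frag_of \<circ> map ((#) a)) (frag_extend tcomplete (first_bd {} u)))"
      using False less.prems by (simp add: complete_rec first_occurrences_Cons frag_extend_frag_extend)
    also have "\<dots> = frag_extend (frag_of \<circ> map ((#) a)) (tcomplete u)"
      using False pre_map[where f = "(#) a" and a = "first_occurrences u"
        and x = "frag_extend tcomplete (first_bd {} u)", OF inj_on_subset[OF inj_Cons subset_UNIV]]
      by (simp add: complete_rec)
    finally show ?thesis .
  qed
qed

text \<open>A term of \<open>first_bd\<close> omits the first occurrence of one value. If this value
  is not \<open>a\<close>, the occurrences of \<open>a\<close> are untouched; if it is
  \<open>a\<close>, the order of the other values is.\<close>

lemma keys_first_bd_cases:
  "w \<in> keys (first_bd A u) \<Longrightarrow> count_list w a = count_list u a \<or>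
    removeAll a (first_occurrences w) = removeAll a (first_occurrences u)"
proof (induction u arbitrary: w A)
  case (Cons b u)
  have *: ?case if "w = b # v" "count_list v a = count_list u a \<or>
    removeAll a (first_occurrences v) = removeAll a (first_occurrences u)" for v
    using that by (auto simp: first_occurrences_Cons removeAll_commute[of a b])
  show ?case
  proof (cases "b \<in> set u")
    case True
    with Cons.prems have "w \<in> keys ((if b \<in> A then 0 else nrm u) - pre b (first_bd (insert b A) u))"
      by simp
    then consider "w \<in> keys (if b \<in> A then 0 else nrm u)"
      | "w \<in> keys (pre b (first_bd (insert b A) u))"
      by (elim keys_diffE)
    then show ?thesis
    proof cases
      case 1
      then show ?thesis by (auto split: if_splits dest!: keys_nrm simp: first_occurrences_Cons)
    next
      case 2
      then obtain v where "v \<in> keys (first_bd (insert b A) u)" "w = b # v" by (blast dest: keys_pre)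
      with * Cons.IH show ?thesis by blast
    qed
  next
    case False
    with Cons.prems obtain v where "v \<in> keys (first_bd A u)" "w = b # v" by (auto dest!: keys_pre)
    with * Cons.IH show ?thesis by blast
  qed
qed simp

lemma count_list_distinct_le_1: "distinct u \<Longrightarrow> count_list u a \<le> 1"
  by (induction u) (auto simp: count_list_0_iff)

text \<open>Somewhere the path has to move along the direction of \<open>a\<close>, and the two
  vertices of this step differ only in the place of \<open>a\<close>.\<close>

lemma keys_complete_removeAll_degenerate:
  assumes "ws \<in> keys (tcomplete u)" "count_list u a \<ge> 2"
  shows "\<not> distinct_adj (map (removeAll a) ws)"
  using assms
proof (induction "length u" arbitrary: u ws rule: less_induct)
  case less
  have "\<not> distinct u"
    using less.prems(2) count_list_distinct_le_1[of u a] by auto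
  then obtain w z where z: "w \<in> keys (first_bd {} u)" "z \<in> keys (tcomplete w)"
    "ws = first_occurrences u # z"
    using less.prems(1) by (auto simp: complete_rec dest!: keys_pre subsetD[OF keys_frag_extend])
  from keys_first_bd_cases[OF z(1), of a] show ?case
  proof
    assume "count_list w a = count_list u a"
    then have "\<not> distinct_adj (map (removeAll a) z)"
      using less.hyps[of w z] keys_first_bd[OF z(1)] z(2) less.prems by simp
    then show ?thesis
      by (auto simp: z(3) distinct_adj_Cons)
  next
    assume "removeAll a (first_occurrences w) = removeAll a (first_occurrences u)"
    then show ?thesis
      using keys_complete[OF z(2)] by (auto simp: z(3) distinct_adj_Cons hd_map)
  qed
qed

text \<open>If the leading letter \<open>a\<close> occurs once, it leads every row, and ending a row
  there would repeat it. If it occurs again, it has to end the first row, as the other branch is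
  degenerate. Either way \<open>a\<close> is read in one branch only, and the rest is
  shorter.\<close>

theorem reduce_complete:
  assumes "distinct_adj u"
  shows "frag_extend reduce (tcomplete u) = frag_of u"
  using assms
proof (induction "length u" arbitrary: u rule: less_induct)
  case less
  show ?case
  proof (cases u)
    case (Cons a v)
    have pre_v: "pre a (frag_of v) = frag_of u" and v: "distinct_adj v"
      using less.prems Cons by (auto simp: pre_of distinct_adj_Cons)
    show ?thesis
    proof (cases "a \<in> set v")
      case False
      have "frag_extend reduce (tcomplete u) = frag_extend (\<lambda>ws. pre a (reduce ws)) (tcomplete v)"
        unfolding Cons complete_Cons_notin[OF False] frag_extend_compose
      proof (rule frag_extend_eq)
        fix ws assume "ws \<in> keys (tcomplete v)"
        then obtain w z where w: "ws = w # z" "\<And>x. x \<in> set z \<Longrightarrow> a \<notin> set x"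
          using keys_complete[of ws v] False by (cases ws) (auto simp: permutations_of_set_def)
        then have "map (removeAll a \<circ> (#) a) z = z"
          by (intro map_idI) simp
        moreover have "pre a (reduce (map ((#) a) z)) = 0"
          by (cases z) auto
        ultimately show "(reduce \<circ> map ((#) a)) ws = pre a (reduce ws)"
          by (simp add: w(1) pre_add)
      qed
      also have "\<dots> = pre a (frag_of v)"
        using less.hyps[OF _ v] by (simp add: Cons flip: pre_frag_extend)
      finally show ?thesis
        by (simp add: pre_v)
    next
      case True
      let ?q = "removeAll a (first_occurrences v)"
      define Z where "Z = frag_extend tcomplete (first_bd {} u)"
      \<comment> \<open>The first step of the path either omits the leading \<open>a\<close>, and
        then the first two rows agree up to the place of \<open>a\<close>; or it keeps this letter,
        and then \<open>a\<close> occurs at least twice in \<open>w\<close>, so that a later step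
        moves \<open>a\<close> alone.\<close>
      have degenerate: "reduce (?q # map (removeAll a) z) = 0 \<and>
          (z \<noteq> [] \<and> hd z = a # ?q \<longrightarrow> reduce ((a # ?q) # z) = 0)" if zZ: "z \<in> keys Z" for z
      proof -
        obtain w where w: "w \<in> keys (first_bd {} u)" "z \<in> keys (tcomplete w)"
          using zZ unfolding Z_def by (auto dest!: subsetD[OF keys_frag_extend])
        note z = keys_complete[OF w(2)] keys_first_bd[OF w(1)]
        have "w \<in> keys (nrm v - pre a (first_bd {a} v))"
          using w(1) True by (simp add: Cons)
        then have "\<not> distinct_adj (?q # map (removeAll a) z)"
        proof (cases rule: keys_diffE)
          case 1
          with z show ?thesis by (auto dest!: keys_nrm simp: distinct_adj_Cons hd_map)
        next
          case 2
          then obtain w' where w': "w' \<in> keys (first_bd {a} v)" "w = a # w'"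
            by (blast dest: keys_pre)
          with True have "a \<in> set w'" using keys_first_bd by fastforce
          then have "count_list w a \<ge> 2"
            using w'(2) by (simp add: Suc_le_eq count_list_0_iff zero_less_iff_neq_zero)
          from keys_complete_removeAll_degenerate[OF w(2) this] show ?thesis
            by (auto simp: distinct_adj_Cons)
        qed
        moreover have perms: "set ((a # ?q) # z) \<subseteq> permutations_of_set (set u)"
          using z True Cons by (auto simp: permutations_of_set_def distinct_removeAll)
        note perms_Cons_Cons(3)[OF perms]
        ultimately have "reduce (?q # map (removeAll a) z) = 0"
          by (blast intro: reduce_degenerate)
        moreover have "reduce ((a # ?q) # z) = 0" if "z \<noteq> []" "hd z = a # ?q"
          using that by (intro reduce_degenerate[OF perms]) (simp add: distinct_adj_Cons)
        ultimately show ?thesis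
          by blast
      qed
      have u: "tcomplete u = pre (a # ?q) Z"
        using True by (simp add: Cons complete_rec first_occurrences_Cons Z_def)
      \<comment> \<open>A table whose second row repeats the first is killed by \<open>pre\<close>
        and by \<open>reduce\<close> alike, so that \<open>pre\<close> can be opened without a case
        distinction.\<close>
      have "frag_extend reduce (tcomplete u) = frag_extend (\<lambda>z. reduce ((a # ?q) # z)) Z"
        unfolding u frag_extend_pre using degenerate by (auto intro!: frag_extend_eq simp del: reduce.simps)
      also have "\<dots> = frag_extend (\<lambda>z. pre a (reduce z)) Z"
        using degenerate by (auto intro!: frag_extend_eq)
      also have "\<dots> = pre a (first_bd {} u)"
      proof -
        have "frag_extend reduce (tcomplete w) = frag_of w" if "w \<in> keys (first_bd {} u)" for w
          using keys_first_bd[OF that] less.hyps by auto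
        then have "frag_extend reduce Z = frag_extend frag_of (first_bd {} u)"
          unfolding Z_def frag_extend_frag_extend by (rule frag_extend_eq)
        then show ?thesis
          by (simp flip: pre_frag_extend)
      qed
      \<comment> \<open>The terms of \<open>first_bd {} u\<close> other than \<open>v\<close> begin
        with \<open>a\<close> and are killed by \<open>pre a\<close>.\<close>
      also have "\<dots> = frag_of u"
        using True pre_v v by (simp add: Cons pre_diff nrm_distinct_adj)
      finally show ?thesis .
    qed
  qed (simp add: complete_distinct)
qed

section \<open>Table completion is a chain map\<close>

text \<open>No signs of words are compared: \<open>u\<close> is the image of
  \<open>tcomplete u\<close> under \<open>reduce\<close>, which is compatible with boundaries, so
  the identity is inherited from simplices.\<close>

lemma word_bd_word_bd:
  assumes "distinct_adj u"
  shows "frag_extend word_bd (word_bd u) = 0"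
proof -
  have *: "frag_extend word_bd (frag_extend reduce x) = frag_extend reduce (frag_extend simplex_bd x)"
    if "\<And>ws. ws \<in> keys x \<Longrightarrow> set ws \<subseteq> permutations_of_set (set u)" for x
    unfolding frag_extend_frag_extend using that word_bd_reduce by (blast intro: frag_extend_eq)
  have perms: "set ws \<subseteq> permutations_of_set (set u)" if "ws \<in> keys (tcomplete u)" for ws
    using keys_complete[OF that] by blast
  have "frag_extend word_bd (frag_extend reduce (tcomplete u)) =
      frag_extend reduce (frag_extend simplex_bd (tcomplete u))"
    by (rule *) (rule perms)
  then have "word_bd u = frag_extend reduce (frag_extend simplex_bd (tcomplete u))"
    using reduce_complete[OF assms] by simp
  moreover have "set ws \<subseteq> permutations_of_set (set u)"
    if "ws \<in> keys (frag_extend simplex_bd (tcomplete u))" for ws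
    using that perms by (fastforce dest!: subsetD[OF keys_frag_extend] keys_simplex_bd)
  then have "frag_extend word_bd (frag_extend reduce (frag_extend simplex_bd (tcomplete u))) =
      frag_extend reduce (frag_extend simplex_bd (frag_extend simplex_bd (tcomplete u)))"
    by (rule *)
  moreover have "frag_extend simplex_bd (frag_extend simplex_bd (tcomplete u)) = 0"
    by (simp add: frag_extend_frag_extend simplex_bd_simplex_bd frag_extend_eq_0)
  ultimately show ?thesis
    by simp
qed

text \<open>The complementary part, for omissions of later occurrences. The values in
  \<open>A\<close> are those already met before \<open>u\<close> begins, so that for them every
  occurrence in \<open>u\<close> is a later one.\<close>

definition second_bd :: "'a set \<Rightarrow> 'a list \<Rightarrow> ('a list \<Rightarrow>\<^sub>0 int)" where
  "second_bd A u = word_bd u - first_bd A u"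

lemma second_bd_Cons:
  "second_bd A (a # u) =
    (if a \<in> set u then
       (if a \<in> A then nrm u else 0) - pre a (second_bd (insert a A) u) - pre a (erase_single a u)
     else pre a (second_bd A u))"
  by (simp add: second_bd_def pre_diff)

text \<open>Omitting a later occurrence does not affect the order of the first ones. The values in
  \<open>A\<close> are filtered out because their first occurrence lies before \<open>u\<close>; the
  case needed is \<open>A = {}\<close>.\<close>

lemma first_occurrences_second_bd:
  "w \<in> keys (second_bd A u) \<Longrightarrow>
    filter (\<lambda>x. x \<notin> A) (first_occurrences w) = filter (\<lambda>x. x \<notin> A) (first_occurrences u)"
proof (induction u arbitrary: w A)
  case (Cons a u)
  have filter_removeAll: "filter (\<lambda>x. x \<notin> A) (removeAll a x) = filter (\<lambda>x. x \<notin> insert a A) x" for x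
    by (auto simp: removeAll_filter_not_eq intro!: filter_cong)
  have filter_insert: "filter (\<lambda>x. x \<notin> insert a A) x = removeAll a (filter (\<lambda>x. x \<notin> A) x)" for x
    by (auto simp: removeAll_filter_not_eq intro!: filter_cong)
  show ?case
  proof (cases "a \<in> set u")
    case True
    with Cons.prems have "w \<in> keys ((if a \<in> A then nrm u else 0)
        - pre a (second_bd (insert a A) u) - pre a (erase_single a u))"
      by (simp add: second_bd_Cons)
    then consider "w \<in> keys (if a \<in> A then nrm u else 0)"
      | "w \<in> keys (pre a (second_bd (insert a A) u))" | "w \<in> keys (pre a (erase_single a u))"
      by (elim keys_diffE)
    then show ?thesis
    proof cases
      case 1
      then have "w = u" "a \<in> A"
        by (auto split: if_splits dest!: keys_nrm)
      moreover from \<open>a \<in> A\<close> have "insert a A = A" by blast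
      ultimately show ?thesis
        by (simp only: first_occurrences_Cons filter.simps filter_removeAll) simp
    next
      case 2
      with Cons.IH show ?thesis
        by (fastforce dest!: keys_pre simp: first_occurrences_Cons filter_removeAll)
    next
      case 3
      then obtain v where v: "v \<in> keys (erase_single a u)" "w = a # v"
        by (blast dest: keys_pre)
      then have "v = removeAll a u"
        by (auto simp: erase_single_def split: if_splits dest!: keys_nrm)
      then show ?thesis
        by (simp add: v(2) first_occurrences_Cons first_occurrences_removeAll)
    qed
  next
    case False
    with Cons.prems obtain v where "v \<in> keys (second_bd A u)" "w = a # v"
      by (auto simp: second_bd_Cons dest!: keys_pre)
    with Cons.IH[of v A] show ?thesis
      by (simp only: first_occurrences_Cons filter.simps filter_removeAll filter_insert)
  qed
qed (simp add: second_bd_def)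

lemma keys_second_bd:
  assumes "w \<in> keys (second_bd {} u)"
  shows "set w = set u" "distinct_adj w" "Suc (length w) = length u"
    "first_occurrences w = first_occurrences u"
proof -
  from assms have "w \<in> keys (word_bd u) \<or> w \<in> keys (first_bd {} u)"
    unfolding second_bd_def by (auto elim!: keys_diffE)
  then show "set w = set u" "distinct_adj w" "Suc (length w) = length u"
    using keys_word_bd[of w u] keys_first_bd[of w "{}" u] by auto
  show "first_occurrences w = first_occurrences u"
    using first_occurrences_second_bd[OF assms] by simp
qed

text \<open>Agrees with \<open>E_bd\<close> in positive degrees, but sends a vertex to the empty
  simplex.\<close>

definition norm_simplex_bd :: "'a list \<Rightarrow> ('a list \<Rightarrow>\<^sub>0 int)" where
  "norm_simplex_bd ws = frag_extend nrm (simplex_bd ws)"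

lemma norm_simplex_bd_Cons: "norm_simplex_bd (w # ws) = nrm ws - pre w (norm_simplex_bd ws)"
  by (simp add: norm_simplex_bd_def simplex_bd_Cons frag_linear frag_extend_frag_extend o_def nrm_Cons
      pre_frag_extend)

text \<open>Consistent on simplices that begin with \<open>w\<close>, since the faces omitting one
  of the two equal vertices cancel.\<close>

lemma norm_simplex_bd_pre:
  assumes "\<And>z. z \<in> keys x \<Longrightarrow> distinct_adj z"
  shows "frag_extend norm_simplex_bd (pre w x) = x - pre w (frag_extend norm_simplex_bd x)"
proof -
  have "(if z \<noteq> [] \<and> hd z = w then 0 else norm_simplex_bd (w # z)) =
      frag_of z - pre w (norm_simplex_bd z)" if "z \<in> keys x" for z
  proof (cases "z \<noteq> [] \<and> hd z = w")
    case True
    then obtain z' where z: "z = w # z'" by (cases z) auto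
    then have "frag_of z = pre w (nrm z')"
      using assms[OF that] nrm_Cons[of w z'] by (simp add: nrm_distinct_adj)
    then show ?thesis
      by (simp add: z norm_simplex_bd_Cons pre_diff)
  next
    case False
    then show ?thesis
      using assms[OF that] by (auto simp: norm_simplex_bd_Cons nrm_distinct_adj)
  qed
  then have "frag_extend norm_simplex_bd (pre w x) =
      frag_extend (\<lambda>z. frag_of z - pre w (norm_simplex_bd z)) x"
    unfolding frag_extend_pre by (rule frag_extend_eq)
  then show ?thesis
    by (simp add: frag_extend_fun_diff pre_frag_extend)
qed

text \<open>
  In the induction step, \<open>first_bd\<close> \<open>+\<close> \<open>second_bd\<close> is a differential, and \<open>second_bd\<close> preserves the
  initial vertex, so that the image of its square is degenerate.
\<close>

theorem norm_simplex_bd_complete: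
  assumes "distinct_adj u" "\<not> distinct u"
  shows "frag_extend norm_simplex_bd (tcomplete u) = frag_extend tcomplete (word_bd u)"
  using assms
proof (induction "length u" arbitrary: u rule: less_induct)
  case less
  have perms: "set ws \<subseteq> permutations_of_set (set u)" if "ws \<in> keys (tcomplete u)" for ws
    using keys_complete[OF that] by blast
  show ?case
  \<comment> \<open>In degree 1 the words of \<open>first_bd\<close> have degree 0, where the
    augmented formula fails. Instead, the boundary of \<open>tcomplete u\<close> consists of
    vertices, on which \<open>reduce\<close> and \<open>tcomplete\<close> are inverse to each other,
    so that \<open>word_bd_reduce\<close> can be read backwards.\<close>
  proof (cases "length u = Suc (card (set u))")
    case True
    define Y where "Y = frag_extend simplex_bd (tcomplete u)"
    have "frag_extend word_bd (frag_extend reduce (tcomplete u)) = frag_extend reduce Y"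
      unfolding Y_def frag_extend_frag_extend using perms word_bd_reduce by (blast intro: frag_extend_eq)
    then have "frag_extend tcomplete (word_bd u) = frag_extend (\<lambda>z. frag_extend tcomplete (reduce z)) Y"
      using reduce_complete[OF less.prems(1)] by (simp add: frag_extend_frag_extend)
    also have "\<dots> = frag_extend nrm Y"
    proof (rule frag_extend_eq)
      fix z assume "z \<in> keys Y"
      then obtain ws where "ws \<in> keys (tcomplete u)" "z \<in> keys (simplex_bd ws)"
        unfolding Y_def by (auto dest!: subsetD[OF keys_frag_extend])
      with keys_complete[of ws u] keys_simplex_bd[of z ws] True
      have "length z = 1" "set z \<subseteq> permutations_of_set (set u)" by auto
      then obtain w where "z = [w]" "distinct w"
        by (cases z) (auto simp: permutations_of_set_def)
      then show "frag_extend tcomplete (reduce z) = nrm z"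
        by (simp add: reduce_singleton complete_distinct nrm_def del: reduce.simps)
    qed
    finally show ?thesis
      by (simp add: Y_def norm_simplex_bd_def[abs_def] frag_extend_frag_extend)
  next
    case False
    let ?f = "first_occurrences u"
    define Z where "Z = frag_extend tcomplete (first_bd {} u)"
    have nd: "\<not> distinct w" if "set w = set u" "Suc (length w) = length u" for w
      using that False card_set_less_length[OF less.prems(2)] distinct_card[of w] by auto
    have "frag_extend norm_simplex_bd (tcomplete w) = frag_extend tcomplete (word_bd w)"
      if "w \<in> keys (first_bd {} u)" for w
      using keys_first_bd[OF that] nd by (intro less.hyps) auto
    then have IH: "frag_extend norm_simplex_bd Z = frag_extend tcomplete (frag_extend word_bd (first_bd {} u))"
      unfolding Z_def frag_extend_frag_extend by (rule frag_extend_eq)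
    have "distinct_adj z" if "z \<in> keys Z" for z
      using that unfolding Z_def by (auto dest!: subsetD[OF keys_frag_extend] keys_complete)
    then have 1: "frag_extend norm_simplex_bd (tcomplete u) =
        Z - pre ?f (frag_extend tcomplete (frag_extend word_bd (first_bd {} u)))"
      using less.prems(2) by (simp add: complete_rec norm_simplex_bd_pre IH flip: Z_def)
    \<comment> \<open>The terms of \<open>second_bd\<close> share the initial vertex
      \<open>?f\<close>, so that the recursion of \<open>tcomplete\<close> applies to all of them
      with a single \<open>pre ?f\<close>.\<close>
    have "frag_extend tcomplete (second_bd {} u) =
        frag_extend (\<lambda>w. pre ?f (frag_extend tcomplete (first_bd {} w))) (second_bd {} u)"
    proof (rule frag_extend_eq)
      fix w assume w: "w \<in> keys (second_bd {} u)"
      with nd have "\<not> distinct w" by (simp add: keys_second_bd)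
      with w show "tcomplete w = pre ?f (frag_extend tcomplete (first_bd {} w))"
        by (simp add: complete_rec keys_second_bd)
    qed
    moreover have "word_bd u = first_bd {} u + second_bd {} u"
      by (simp add: second_bd_def)
    then have "frag_extend tcomplete (word_bd u) = Z + frag_extend tcomplete (second_bd {} u)"
      by (simp add: Z_def frag_extend_add)
    ultimately have 2: "frag_extend tcomplete (word_bd u) =
        Z + pre ?f (frag_extend tcomplete (frag_extend (first_bd {}) (second_bd {} u)))"
      by (simp add: pre_frag_extend frag_extend_frag_extend)
    have "frag_extend word_bd (first_bd {} u) + frag_extend (first_bd {}) (second_bd {} u) =
        frag_extend word_bd (word_bd u) - frag_extend (second_bd {}) (second_bd {} u)"
      by (simp add: second_bd_def[of "{}", abs_def] frag_extend_fun_diff frag_extend_diff)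
    also have "\<dots> = - frag_extend (second_bd {}) (second_bd {} u)"
      by (simp add: word_bd_word_bd less.prems(1))
    finally have "pre ?f (frag_extend tcomplete (frag_extend word_bd (first_bd {} u)))
        + pre ?f (frag_extend tcomplete (frag_extend (first_bd {}) (second_bd {} u))) =
        - pre ?f (frag_extend tcomplete (frag_extend (second_bd {}) (second_bd {} u)))"
      by (simp flip: pre_linear frag_linear)
    also have "\<dots> = 0"
      unfolding pre_frag_extend neg_equal_0_iff_equal
    proof (rule frag_extend_eq_0)
      fix v assume "v \<in> keys (frag_extend (second_bd {}) (second_bd {} u))"
      then have "first_occurrences v = ?f"
        by (auto dest!: subsetD[OF keys_frag_extend] simp: keys_second_bd)
      with pre_complete[of v] show "pre ?f (tcomplete v) = 0" by simp
    qed
    finally show ?thesis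
      unfolding 1 2 by (simp add: algebra_simps add_eq_0_iff)
  qed
qed

section \<open>Cells\<close>

lemma variations_Nil [simp]: "variations [] = 0"
  and variations_singleton [simp]: "variations [a] = 0"
  by (simp_all add: variations_def)

lemma variations_Cons_Cons [simp]:
  "variations (a # b # xs) = (if a = b then 0 else 1) + variations (b # xs)"
proof -
  let ?V = "\<lambda>xs. {l \<in> {..<length xs - 1}. xs ! l \<noteq> xs ! Suc l}"
  have "?V (a # b # xs) = (if a = b then {} else {0}) \<union> Suc ` ?V (b # xs)"
    by (auto simp: less_Suc_eq_0_disj)
  then have "card (?V (a # b # xs)) = card ((if a = b then {} else {0}) \<union> Suc ` ?V (b # xs))"
    by (rule arg_cong)
  also have "\<dots> = (if a = b then 0 else 1) + card (?V (b # xs))"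
    by (subst card_Un_disjoint) (auto simp: card_image)
  finally show ?thesis
    unfolding variations_def .
qed

lemma variations_Cons:
  "variations (a # xs) = (if xs = [] \<or> a = hd xs then 0 else 1) + variations xs"
  by (cases xs) auto

lemma variations_Cons_mono:
  "subseq xs ys \<Longrightarrow> variations (a # xs) \<le> variations (a # ys)"
proof (induction arbitrary: a rule: list_emb.induct)
  case (list_emb_Cons xs ys y)
  have "variations (a # xs) \<le> variations (a # y # xs)"
    by (cases xs) auto
  also have "\<dots> \<le> variations (a # y # ys)"
    using list_emb_Cons.IH[of y] by simp
  finally show ?case .
next
  case (list_emb_Nil ys)
  then show ?case by simp
qed simp

lemma variations_pos:
  "i \<in> set xs \<Longrightarrow> j \<in> set xs \<Longrightarrow> i \<noteq> j \<Longrightarrow> 0 < variations xs"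
proof (induction xs)
  case (Cons a xs)
  then show ?case
    using hd_in_set[of xs] by (cases "xs = []") (auto simp: variations_Cons)
qed simp

lemma variations_Cons_constant:
  assumes "set xs = {b}" "a \<noteq> b"
  shows "variations (a # xs) = 1"
proof -
  have "set xs \<subseteq> {b} \<Longrightarrow> variations (b # xs) = 0" for xs
    by (induction xs) auto
  with assms show ?thesis
    by (cases xs) auto
qed

section \<open>Restriction of words to pairs of values\<close>

lemma restrict_pair_commute: "restrict_pair i j = restrict_pair j i"
  by (auto simp: restrict_pair_def fun_eq_iff intro!: filter_cong)

text \<open>The restriction depends only on the set of the two values, so the letter being read may
  be taken as the first of the pair.\<close>

lemma restrict_pair_other:
  assumes "a = i \<or> a = j" "i \<noteq> j"
  obtains b where "a \<noteq> b" "{i, j} = {a, b}" "restrict_pair i j = restrict_pair a b"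
proof (cases "a = i")
  case True
  with assms show ?thesis using that[of j] by simp
next
  case False
  with assms show ?thesis using that[of i] restrict_pair_commute[of i j] by auto
qed

lemma restrict_pair_Cons:
  "restrict_pair i j (a # w) = (if a = i \<or> a = j then a # restrict_pair i j w else restrict_pair i j w)"
  by (simp add: restrict_pair_def)

lemma set_restrict_pair: "set (restrict_pair i j w) = set w \<inter> {i, j}"
  by (auto simp: restrict_pair_def)

lemma restrict_pair_removeAll:
  "a \<noteq> i \<Longrightarrow> a \<noteq> j \<Longrightarrow> restrict_pair i j (removeAll a w) = restrict_pair i j w"
  by (auto simp: restrict_pair_def removeAll_filter_not_eq intro!: filter_cong)

lemma first_occurrences_filter:
  "first_occurrences (filter P w) = filter P (first_occurrences w)"
  by (simp add: first_occurrences_def rev_filter remdups_filter)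

lemma first_occurrences_restrict_pair:
  "first_occurrences (restrict_pair i j w) = restrict_pair i j (first_occurrences w)"
  by (simp add: restrict_pair_def first_occurrences_filter)

lemma distinct_pair_list:
  assumes "distinct l" "set l = {i, j}" "i \<noteq> j" "hd l = i"
  shows "l = [i, j]"
proof -
  have "length l = 2"
    using distinct_card[OF assms(1)] assms(2,3) by simp
  with assms show ?thesis
    by (auto simp: numeral_2_eq_2 length_Suc_conv)
qed

lemma hd_first_occurrences: "hd (first_occurrences w) = hd w"
  by (cases w) (auto simp: first_occurrences_Cons)

lemma first_occurrences_pair:
  assumes "set w = {i, j}" "i \<noteq> j" "hd w = i"
  shows "first_occurrences w = [i, j]"
  using assms by (intro distinct_pair_list) (auto simp: hd_first_occurrences)

text \<open>A letter that is not a caesura leaves only copies of the other value, hence one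
  variation. A caesura \<open>a\<close> adds a variation only if the rest begins with the other
  value; when the bound for the rest is attained, the next row then has the opposite order, and the
  table has one more variation as well.\<close>

lemma reduce_variations:
  assumes "set ws \<subseteq> permutations_of_set S" "u \<in> keys (reduce ws)" "i \<in> S" "j \<in> S" "i \<noteq> j"
  shows "variations (restrict_pair i j u) \<le> variations (map (restrict_pair i j) ws) \<or>
    variations (restrict_pair i j u) = Suc (variations (map (restrict_pair i j) ws)) \<and>
    first_occurrences (restrict_pair i j u) = restrict_pair i j (hd ws)"
  using assms
proof (induction ws arbitrary: S u rule: reduce.induct)
  case (2 ws)
  then show ?case by (auto simp: permutations_of_set_def)
next
  case (3 a q ws)
  note p = perms_Cons_Cons[OF "3.prems"(1)]
  have "u \<in> keys (pre a (reduce (q # map (removeAll a) ws) + reduce ws))"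
    using "3.prems"(2) by simp
  then obtain v where v: "v \<in> keys (reduce (q # map (removeAll a) ws) + reduce ws)"
    "u = a # v" "v = [] \<or> a \<noteq> hd v"
    by (blast dest: keys_pre)
  from v(1) have "v \<in> keys (reduce (q # map (removeAll a) ws)) \<union> keys (reduce ws)"
    by (rule subsetD[OF keys_add])
  then consider (closed) "v \<in> keys (reduce (q # map (removeAll a) ws))"
    | (caesura) w ws' where "v \<in> keys (reduce ws)" "ws = w # ws'"
    by (cases ws) auto
  note v_cases = this
  show ?case
  proof (cases "a = i \<or> a = j")
    case False
    then have u: "restrict_pair i j u = restrict_pair i j v"
      by (simp add: v(2) restrict_pair_Cons)
    from v_cases show ?thesis
    proof cases
      case closed
      have "map (restrict_pair i j) (map (removeAll a) ws) = map (restrict_pair i j) ws"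
        using False by (simp add: restrict_pair_removeAll)
      with "3.IH"(1)[OF p(3) closed] "3.prems" False u show ?thesis
        by (simp add: restrict_pair_Cons del: map_map)
    next
      case caesura
      with "3.IH"(2)[OF p(4) caesura(1)] "3.prems" u show ?thesis
        by (auto simp: caesura(2))
    qed
  next
    case True
    then obtain b where b: "a \<noteq> b" "{i, j} = {a, b}" "restrict_pair i j = restrict_pair a b"
      using "3.prems"(5) by (rule restrict_pair_other)
    then have "b \<in> S"
      using "3.prems"(3,4) by (auto simp: doubleton_eq_iff)
    have hd_ws: "restrict_pair a b (a # q) = [a, b]"
    proof (rule distinct_pair_list)
      show "distinct (restrict_pair a b (a # q))"
        using p(4,5) "3.prems"(1) by (simp add: restrict_pair_def permutations_of_set_def)
      have "set (a # q) = S"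
        using "3.prems"(1) by (simp add: permutations_of_set_def)
      then show "set (restrict_pair a b (a # q)) = {a, b}"
        using p(1) \<open>b \<in> S\<close> by (auto simp only: set_restrict_pair)
      show "hd (restrict_pair a b (a # q)) = a"
        by (simp add: restrict_pair_Cons)
    qed (rule b(1))
    have u: "restrict_pair a b u = a # restrict_pair a b v"
      by (simp add: v(2) restrict_pair_Cons)
    from v_cases show ?thesis
    proof cases
      case closed
      then have "set v = S - {a}"
        using keys_reduce[OF p(3)] by blast
      with b \<open>b \<in> S\<close> have "set (restrict_pair a b v) = {b}"
        by (auto simp: set_restrict_pair)
      then have "variations (a # restrict_pair a b v) = 1" "set (restrict_pair a b u) = {a, b}"
        using b(1) variations_Cons_constant[of "restrict_pair a b v" b a] by (auto simp: u)
      moreover have "first_occurrences (restrict_pair a b u) = [a, b]"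
        using \<open>set (restrict_pair a b u) = {a, b}\<close> b(1) by (intro first_occurrences_pair) (auto simp: u)
      ultimately show ?thesis
        using hd_ws by (auto simp: b(3) u)
    next
      case caesura
      have v': "set (restrict_pair a b v) = {a, b}"
        using keys_reduce[OF p(4) caesura(1)] \<open>b \<in> S\<close> p(1) by (auto simp: set_restrict_pair)
      then have ne: "restrict_pair a b v \<noteq> []" by auto
      have IH: "variations (restrict_pair a b v) \<le> variations (map (restrict_pair a b) ws) \<or>
        variations (restrict_pair a b v) = Suc (variations (map (restrict_pair a b) ws)) \<and>
        first_occurrences (restrict_pair a b v) = restrict_pair a b w"
        using "3.IH"(2)[OF p(4) caesura(1) "3.prems"(3-5)] by (simp add: b(3) caesura(2))
      have first_u: "first_occurrences (restrict_pair a b u) = [a, b]"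
        using v' b(1) by (intro first_occurrences_pair) (auto simp: u)
      show ?thesis
      proof (cases "hd (restrict_pair a b v) = a")
        case True
        then have "variations (restrict_pair a b u) = variations (restrict_pair a b v)"
          by (simp add: u variations_Cons)
        with IH first_u hd_ws True first_occurrences_pair[OF v' b(1)] show ?thesis
          by (auto simp: b(3) caesura(2))
      next
        case False
        with v' ne have "hd (restrict_pair a b v) = b"
          using hd_in_set[OF ne] by auto
        then have "first_occurrences (restrict_pair a b v) = [b, a]"
          using v' b(1) by (intro first_occurrences_pair) auto
        moreover have "variations (restrict_pair a b u) = Suc (variations (restrict_pair a b v))"
          using False ne by (auto simp: u variations_Cons)
        ultimately show ?thesis
          using IH first_u hd_ws b(1) by (auto simp: b(3) caesura(2)) (metis list.inject)
      qed
    qed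
  qed
qed simp

lemma subseq_first_bd: "w \<in> keys (first_bd A u) \<Longrightarrow> subseq w u"
proof (induction u arbitrary: w A)
  case (Cons b u)
  show ?case
  proof (cases "b \<in> set u")
    case True
    with Cons.prems have "w \<in> keys ((if b \<in> A then 0 else nrm u) - pre b (first_bd (insert b A) u))"
      by simp
    then consider "w \<in> keys (if b \<in> A then 0 else nrm u)"
      | "w \<in> keys (pre b (first_bd (insert b A) u))"
      by (elim keys_diffE)
    then show ?thesis
      using Cons.IH by cases (auto split: if_splits dest!: keys_nrm keys_pre)
  next
    case False
    with Cons show ?thesis by (auto dest!: keys_pre)
  qed
qed simp

text \<open>The order of a pair can change only if the first letter of the pair is omitted and the
  other one follows it; this loses a variation of the word. Otherwise it suffices that a subsequence
  with the same first letter has no more variations.\<close>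

lemma variations_first_bd:
  assumes "w \<in> keys (first_bd A u)" "i \<in> set u" "j \<in> set u" "i \<noteq> j"
  shows "(if restrict_pair i j (first_occurrences u) = restrict_pair i j (first_occurrences w)
      then 0 else 1) + variations (restrict_pair i j w) \<le> variations (restrict_pair i j u)"
  using assms
proof (induction u arbitrary: w A)
  case (Cons b u)
  have w: "set w = insert b (set u)" "subseq w (b # u)"
    using keys_first_bd[OF Cons.prems(1)] subseq_first_bd[OF Cons.prems(1)] by auto
  from Cons.prems(1)
  consider (head) "w = u" | (tail) v A' where "v \<in> keys (first_bd A' u)" "w = b # v"
    by (cases "b \<in> set u") (auto elim!: keys_diffE split: if_splits dest!: keys_nrm keys_pre)
  then show ?case
  proof cases
    case head
    then have "set u = insert b (set u)" using w by simp
    with Cons.prems(2-4) have u: "set (restrict_pair i j u) = {i, j}"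
      by (auto simp: set_restrict_pair)
    then have ne: "restrict_pair i j u \<noteq> []" by auto
    show ?thesis
    proof (cases "(b = i \<or> b = j) \<and> hd (restrict_pair i j u) = b")
      case True
      then have "first_occurrences (restrict_pair i j (b # u)) = first_occurrences (restrict_pair i j u)"
        using ne by (cases "restrict_pair i j u") (auto simp: restrict_pair_Cons first_occurrences_Cons)
      with True ne show ?thesis
        by (simp add: head restrict_pair_Cons variations_Cons flip: first_occurrences_restrict_pair)
    next
      case False
      with ne show ?thesis
        by (auto simp: head restrict_pair_Cons variations_Cons simp flip: first_occurrences_restrict_pair)
    qed
  next
    case tail
    show ?thesis
    proof (cases "b = i \<or> b = j")
      case True
      then obtain c where c: "b \<noteq> c" "{i, j} = {b, c}" "restrict_pair i j = restrict_pair b c"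
        using Cons.prems(4) by (rule restrict_pair_other)
      have *: "first_occurrences (restrict_pair b c (b # x)) = [b, c]" if "c \<in> set x" for x
        using that c(1)
        by (intro first_occurrences_pair) (auto simp: restrict_pair_Cons set_restrict_pair)
      have "c \<in> set u" "c \<in> set v"
        using Cons.prems(2-4) c keys_first_bd[OF tail(1)] by auto
      then have "first_occurrences (restrict_pair b c w) = first_occurrences (restrict_pair b c (b # u))"
        using tail(2) * by simp
      moreover have "variations (restrict_pair b c w) \<le> variations (restrict_pair b c (b # u))"
        using subseq_first_bd[OF tail(1)]
        by (auto simp: tail(2) restrict_pair_Cons restrict_pair_def intro!: variations_Cons_mono)
      ultimately show ?thesis
        by (simp add: c(3) flip: first_occurrences_restrict_pair)
    next
      case False
      with Cons.IH[OF tail(1)] Cons.prems(2-4) show ?thesis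
        by (auto simp: tail(2) restrict_pair_Cons simp flip: first_occurrences_restrict_pair)
    qed
  qed
qed simp

text \<open>Each step of the path that changes the order of the pair uses up a variation of the
  word, and one is left at the end; it accounts for the 1 in the definition of the cells of
  surjections.\<close>

lemma complete_variations:
  assumes "ws \<in> keys (tcomplete u)" "i \<in> set u" "j \<in> set u" "i \<noteq> j"
  shows "variations (map (restrict_pair i j) ws) < variations (restrict_pair i j u)"
  using assms
proof (induction "length u" arbitrary: u ws rule: less_induct)
  case less
  show ?case
  proof (cases "distinct u")
    case True
    with less.prems show ?thesis
      by (auto simp: complete_distinct set_restrict_pair intro!: variations_pos[of i _ j])
  next
    case False
    then obtain w z where z: "w \<in> keys (first_bd {} u)" "z \<in> keys (tcomplete w)"
      "ws = first_occurrences u # z"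
      using less.prems(1) by (auto simp: complete_rec dest!: keys_pre subsetD[OF keys_frag_extend])
    have "variations (map (restrict_pair i j) z) < variations (restrict_pair i j w)"
      using keys_first_bd[OF z(1)] less.prems by (intro less.hyps z(2)) auto
    then show ?thesis
      using variations_first_bd[OF z(1) less.prems(2-4)] keys_complete[OF z(2)]
      by (auto simp: z(3) variations_Cons hd_map split: if_splits)
  qed
qed

section \<open>Table reduction is compatible with the partial composites\<close>

lemma reduce_Cons_ext:
  "frag_extend reduce (frag_extend (frag_of \<circ> (#) (a # q)) Z) =
    pre a (frag_extend reduce (frag_extend (frag_of \<circ> (#) q)
        (frag_extend (frag_of \<circ> map (removeAll a)) Z)) + frag_extend reduce Z)"
  by (simp add: frag_extend_compose o_def frag_extend_frag_extend pre_frag_extend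
      flip: frag_extend_fun_add pre_add)

text \<open>The number of caesuras, that is, the degree of \<open>u\<close> as a surjection onto its
  set of values.\<close>

definition excess :: "'a list \<Rightarrow> nat" where
  "excess u = length u - card (set u)"

lemma excess_Nil [simp]: "excess [] = 0"
  by (simp add: excess_def)

lemma excess_Cons: "excess (a # u) = (if a \<in> set u then Suc (excess u) else excess u)"
  using card_length[of u] by (auto simp: excess_def insert_absorb Suc_diff_le)

text \<open>
  The values of \<open>u\<close> other than \<open>k\<close> are renamed by \<open>f\<close>, and those of the sequence inserted for \<open>k\<close>
  by \<open>g\<close>.
\<close>

locale composite =
  fixes k :: 'a and f :: "'a \<Rightarrow> 'c" and g :: "'b \<Rightarrow> 'c" and A :: "'a set" and B :: "'b set"
  assumes inj_f: "inj_on f (A - {k})" and inj_g: "inj_on g B"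
    and f_neq_g: "\<And>x b. x \<in> A - {k} \<Longrightarrow> b \<in> B \<Longrightarrow> f x \<noteq> g b"
begin

section \<open>Substitution of a block for a letter\<close>

definition subst_block :: "'a list \<Rightarrow> 'b list \<Rightarrow> 'c list" where
  "subst_block u v = concat (map (\<lambda>a. if a = k then map g v else [f a]) u)"

lemma subst_block_Nil [simp]: "subst_block [] v = []"
  and subst_block_Cons:
    "subst_block (x # u) v = (if x = k then map g v @ subst_block u v else f x # subst_block u v)"
  by (simp_all add: subst_block_def)

lemma subst_block_Nil2: "subst_block u [] = map f (removeAll k u)"
  by (induction u) (auto simp: subst_block_Cons)

lemma subst_block_removeAll_f:
  assumes "set u \<subseteq> A" "set v \<subseteq> B" "x \<in> A" "x \<noteq> k"
  shows "removeAll (f x) (subst_block u v) = subst_block (removeAll x u) v"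
proof -
  have "removeAll (f x) (map g v) = map g v"
    using assms(2-4) f_neq_g[of x] by (intro removeAll_id) auto
  with assms(1,3,4) show ?thesis
    using inj_onD[OF inj_f, of x] by (induction u) (auto simp: subst_block_Cons)
qed

lemma subst_block_removeAll_g:
  assumes "set u \<subseteq> A" "set v \<subseteq> B" "b \<in> B"
  shows "removeAll (g b) (subst_block u v) = subst_block u (removeAll b v)"
proof -
  have "removeAll (g b) (map g v) = map g (removeAll b v)"
    using assms(2,3) by (intro map_removeAll_inj_on[symmetric] inj_on_subset[OF inj_g]) auto
  moreover have "f x \<noteq> g b \<and> g b \<noteq> f x" if "x \<in> A" "x \<noteq> k" for x
    using f_neq_g[OF _ assms(3), of x] that by auto
  ultimately show ?thesis
    using assms(1) by (induction u) (auto simp: subst_block_Cons)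
qed

lemma set_subst_block:
  "set (subst_block u v) = f ` (set u - {k}) \<union> (if k \<in> set u then g ` set v else {})"
  by (auto simp: subst_block_def split: if_splits)

lemma distinct_subst_block:
  assumes "set u \<subseteq> A" "set v \<subseteq> B" "distinct u" "distinct v"
  shows "distinct (subst_block u v)"
proof -
  have g: "distinct (map g v)"
    using assms(2,4) inj_on_subset[OF inj_g] by (auto simp: distinct_map)
  from assms(1,3) show ?thesis
  proof (induction u)
    case (Cons x u)
    then have "set u \<subseteq> A" "x \<in> A" "x \<notin> set u" "distinct (subst_block u v)" by auto
    then show ?case
      using g assms(2) f_neq_g[of x] f_neq_g inj_onD[OF inj_f, of x]
      by (fastforce simp: subst_block_Cons set_subst_block)
  qed simp
qed

lemma subst_block_perms:
  assumes "u \<in> permutations_of_set S" "v \<in> permutations_of_set T" "S \<subseteq> A" "T \<subseteq> B"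
  shows "subst_block u v \<in>
    permutations_of_set (f ` (S - {k}) \<union> (if k \<in> S then g ` T else {}))"
  using assms distinct_subst_block[of u v]
  by (auto simp: permutations_of_set_def set_subst_block)

text \<open>The sum over the lattice paths of the Eilenberg-Zilber map, by the first step and
  without normalization. A step in the second direction passes the \<open>length us\<close> steps of
  the first direction still to come.\<close>

fun shuf :: "'a list list \<Rightarrow> 'b list list \<Rightarrow> ('c list list \<Rightarrow>\<^sub>0 int)" where
  "shuf (u # us) (v # vs) = frag_extend (frag_of \<circ> (#) (subst_block u v))
    (if us = [] \<and> vs = [] then frag_of []
     else shuf us (v # vs) + frag_cmul ((- 1) ^ length us) (shuf (u # us) vs))"
| "shuf _ _ = 0"

lemma shuf_Nil2 [simp]: "shuf us [] = 0"
  by (cases us) auto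

lemma shuf_map:
  assumes "\<And>u v. u \<in> set us \<Longrightarrow> v \<in> set vs \<Longrightarrow> h (subst_block u v) = subst_block (h1 u) (h2 v)"
  shows "frag_extend (frag_of \<circ> map h) (shuf us vs) = shuf (map h1 us) (map h2 vs)"
  using assms
proof (induction us vs rule: shuf.induct)
  case (1 u us v vs)
  define H where "H = frag_extend (frag_of \<circ> map h)"
  have H: "H (frag_extend (frag_of \<circ> (#) (subst_block u v)) Z) =
    frag_extend (frag_of \<circ> (#) (subst_block (h1 u) (h2 v))) (H Z)" for Z
    using "1.prems" by (simp add: H_def frag_extend_compose o_def frag_extend_frag_extend)
  have IH: "H (shuf us (v # vs)) = shuf (map h1 us) (h2 v # map h2 vs) \<and>
      H (shuf (u # us) vs) = shuf (h1 u # map h1 us) (map h2 vs)" if "\<not> (us = [] \<and> vs = [])"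
    unfolding H_def list.map(2)[symmetric] by (intro conjI "1.IH"[OF that] "1.prems") auto
  have "H (if us = [] \<and> vs = [] then frag_of []
      else shuf us (v # vs) + frag_cmul ((- 1) ^ length us) (shuf (u # us) vs)) =
    (if map h1 us = [] \<and> map h2 vs = [] then frag_of []
      else shuf (map h1 us) (h2 v # map h2 vs)
        + frag_cmul ((- 1) ^ length (map h1 us)) (shuf (h1 u # map h1 us) (map h2 vs)))"
    using IH by (cases "us = [] \<and> vs = []") (auto simp: H_def frag_linear)
  then show ?case
    by (simp only: shuf.simps list.map H flip: H_def)
qed auto

section \<open>Composition of tables followed by reduction\<close>

definition comp_L :: "'a list list \<Rightarrow> 'b list list \<Rightarrow> ('c list \<Rightarrow>\<^sub>0 int)" where
  "comp_L us vs = frag_extend reduce (shuf us vs)"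

lemma comp_L_Nil [simp]: "comp_L [] vs = 0" "comp_L us [] = 0"
  by (simp_all add: comp_L_def)

text \<open>If the row goes on after \<open>a\<close>, deleting \<open>a\<close> from the later
  vertices gives a sum of the same kind over smaller tables. If it ends, the next vertex is reached
  by a step in either direction.\<close>

lemma comp_L_letter:
  assumes "subst_block u v = a # subst_block u' v'"
    and "frag_extend (frag_of \<circ> map (removeAll a)) (shuf us (v # vs)) = shuf us' (v' # vs')"
    and "frag_extend (frag_of \<circ> map (removeAll a)) (shuf (u # us) vs) = shuf (u' # us') vs'"
    and "length us' = length us" "length vs' = length vs"
  shows "comp_L (u # us) (v # vs) = pre a (comp_L (u' # us') (v' # vs') + comp_L us (v # vs)
    + frag_cmul ((- 1) ^ length us) (comp_L (u # us) vs))"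
proof -
  define Z where "Z = (if us = [] \<and> vs = [] then frag_of []
     else shuf us (v # vs) + frag_cmul ((- 1) ^ length us) (shuf (u # us) vs))"
  define Z' where "Z' = (if us' = [] \<and> vs' = [] then frag_of []
     else shuf us' (v' # vs') + frag_cmul ((- 1) ^ length us') (shuf (u' # us') vs'))"
  have Z': "frag_extend (frag_of \<circ> map (removeAll a)) Z = Z'"
    using assms by (auto simp: Z_def Z'_def frag_linear)
  have Z: "frag_extend reduce Z = comp_L us (v # vs) + frag_cmul ((- 1) ^ length us) (comp_L (u # us) vs)"
    by (simp add: Z_def comp_L_def frag_linear)
  have "comp_L (u # us) (v # vs) =
      frag_extend reduce (frag_extend (frag_of \<circ> (#) (a # subst_block u' v')) Z)"
    by (simp add: comp_L_def Z_def assms(1) del: reduce.simps)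
  also have "\<dots> = pre a (comp_L (u' # us') (v' # vs') + frag_extend reduce Z)"
    by (simp only: reduce_Cons_ext Z' comp_L_def shuf.simps Z'_def)
  finally show ?thesis
    by (simp add: Z add.assoc)
qed

lemma comp_L_f:
  assumes "set ((x # q) # us) \<subseteq> permutations_of_set S" "set (v # vs) \<subseteq> permutations_of_set T"
    and "S \<subseteq> A" "T \<subseteq> B" "x \<noteq> k"
  shows "comp_L ((x # q) # us) (v # vs) =
    pre (f x) (comp_L (q # map (removeAll x) us) (v # vs) + comp_L us (v # vs))"
proof -
  have letter: "comp_L ((x # q) # us) (v # vs) =
      pre (f x) (comp_L (q # map (removeAll x) us) (v # vs) + comp_L us (v # vs)
        + frag_cmul ((- 1) ^ length us) (comp_L ((x # q) # us) vs))"
    if "set (v # vs) \<subseteq> permutations_of_set T" for v vs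
  proof (rule comp_L_letter)
    have *: "removeAll (f x) (subst_block u v') = subst_block (removeAll x u) (id v')"
      if "u \<in> set ((x # q) # us)" "v' \<in> set (v # vs)" for u v'
    proof -
      have "set u = S" "set v' = T" "x \<in> S"
        using that assms(1) \<open>set (v # vs) \<subseteq> permutations_of_set T\<close>
        by (auto simp: permutations_of_set_def)
      with assms(3-5) show ?thesis
        unfolding id_apply by (intro subst_block_removeAll_f) auto
    qed
    have q: "removeAll x (x # q) = q"
      using perms_Cons_Cons(6)[OF assms(1)] by simp
    show "frag_extend (frag_of \<circ> map (removeAll (f x))) (shuf us (v # vs)) =
        shuf (map (removeAll x) us) (v # vs)"
      using shuf_map[of us "v # vs" "removeAll (f x)" "removeAll x" id] * by simp
    show "frag_extend (frag_of \<circ> map (removeAll (f x))) (shuf ((x # q) # us) vs) =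
        shuf (q # map (removeAll x) us) vs"
      using shuf_map[of "(x # q) # us" vs "removeAll (f x)" "removeAll x" id] * q by simp
  qed (use assms(5) in \<open>auto simp: subst_block_Cons\<close>)
  have "pre (f x) (comp_L ((x # q) # us) vs) = 0"
  proof (cases vs)
    case (Cons v' vs')
    with assms(2) show ?thesis
      by (simp add: letter)
  qed simp
  then show ?thesis
    using letter[OF assms(2)] by (simp add: pre_linear)
qed

text \<open>The first letter lies in the block, so its deletion acts on the inserted words alone,
  and both directions of steps survive.\<close>

lemma comp_L_g:
  assumes "set ((k # q) # us) \<subseteq> permutations_of_set S" "set ((b # z) # vs) \<subseteq> permutations_of_set T"
    and "S \<subseteq> A" "T \<subseteq> B"
  shows "comp_L ((k # q) # us) ((b # z) # vs) =
    pre (g b) (comp_L ((k # q) # us) (z # map (removeAll b) vs) + comp_L us ((b # z) # vs)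
      + frag_cmul ((- 1) ^ length us) (comp_L ((k # q) # us) vs))"
proof -
  note p = perms_Cons_Cons[OF assms(2)]
  have *: "removeAll (g b) (subst_block u v) = subst_block (id u) (removeAll b v)"
    if "u \<in> set ((k # q) # us)" "v \<in> set ((b # z) # vs)" for u v
  proof -
    have "set u = S" "set v = T"
      using that assms(1,2) by (auto simp: permutations_of_set_def)
    with assms(3,4) p(1) show ?thesis
      unfolding id_apply by (intro subst_block_removeAll_g) auto
  qed
  have z: "removeAll b (b # z) = z"
    using p(6) by simp
  have "k \<notin> set q"
    using perms_Cons_Cons(5)[OF assms(1)] .
  then have "subst_block q v = subst_block q v'" for v v'
    by (induction q) (auto simp: subst_block_Cons)
  then have head: "subst_block (k # q) (b # z) = g b # subst_block (k # q) z"
    by (auto simp: subst_block_Cons)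
  show ?thesis
  proof (rule comp_L_letter[OF head])
    show "frag_extend (frag_of \<circ> map (removeAll (g b))) (shuf us ((b # z) # vs)) =
        shuf us (z # map (removeAll b) vs)"
      using shuf_map[of us "(b # z) # vs" "removeAll (g b)" id "removeAll b"] * z by simp
    show "frag_extend (frag_of \<circ> map (removeAll (g b))) (shuf ((k # q) # us) vs) =
        shuf ((k # q) # us) (map (removeAll b) vs)"
      using shuf_map[of "(k # q) # us" vs "removeAll (g b)" id "removeAll b"] * by simp
  qed auto
qed

lemma shuf_singleton_Nil: "us \<noteq> [] \<Longrightarrow> shuf us [[]] = frag_of (map (map f \<circ> removeAll k) us)"
proof (induction us)
  case (Cons u us)
  then show ?case by (cases "us = []") (auto simp: subst_block_Nil2)
qed simp

lemma keys_shuf: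
  "z \<in> keys (shuf us vs) \<Longrightarrow> z \<noteq> [] \<and> hd z = subst_block (hd us) (hd vs) \<and>
    set z \<subseteq> {subst_block u v | u v. u \<in> set us \<and> v \<in> set vs}"
proof (induction us vs arbitrary: z rule: shuf.induct)
  case (1 u us v vs)
  from "1.prems" obtain z' where z: "z = subst_block u v # z'" "z' \<in> keys
     (if us = [] \<and> vs = [] then frag_of []
     else shuf us (v # vs) + frag_cmul ((- 1) ^ length us) (shuf (u # us) vs))"
    by (auto dest!: subsetD[OF keys_frag_extend])
  then consider "z' = []" | "\<not> (us = [] \<and> vs = [])" "z' \<in> keys (shuf us (v # vs))"
    | "\<not> (us = [] \<and> vs = [])" "z' \<in> keys (shuf (u # us) vs)"
    by (auto split: if_splits dest!: subsetD[OF keys_add])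
  then show ?case
  proof cases
    case 1
    with z(1) show ?thesis by auto
  next
    case 2
    from "1.IH"(1)[OF 2] show ?thesis unfolding z(1) by simp blast
  next
    case 3
    from "1.IH"(2)[OF 3] show ?thesis unfolding z(1) by simp blast
  qed
qed auto

text \<open>Every path has a step between the two empty blocks, and this step repeats a
  vertex.\<close>

lemma keys_shuf_Nil_degenerate:
  "z \<in> keys (shuf us ([] # [] # vs)) \<Longrightarrow> \<not> distinct_adj z"
proof (induction us arbitrary: z)
  case (Cons u us)
  have "z \<in> keys (frag_extend (frag_of \<circ> (#) (subst_block u []))
      (shuf us ([] # [] # vs) + frag_cmul ((- 1) ^ length us) (shuf (u # us) ([] # vs))))"
    using Cons.prems by (simp only: shuf.simps(1)[of u us "[]" "[] # vs"]) (simp del: shuf.simps)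
  then obtain z' where z: "z = subst_block u [] # z'"
    "z' \<in> keys (shuf us ([] # [] # vs)) \<or> z' \<in> keys (shuf (u # us) ([] # vs))"
    by (auto dest!: subsetD[OF keys_frag_extend] subsetD[OF keys_add] simp del: shuf.simps)
  from z(2) show ?case
  proof
    assume "z' \<in> keys (shuf us ([] # [] # vs))"
    with Cons.IH[of z'] z(1) show ?thesis by (auto simp: distinct_adj_Cons)
  next
    assume "z' \<in> keys (shuf (u # us) ([] # vs))"
    from keys_shuf[OF this] z(1) show ?thesis by (auto simp: distinct_adj_Cons)
  qed
qed simp

text \<open>Supplies the case of a block that has been used up, which \<open>reduce_shuf\<close>
  excludes by \<open>T \<noteq> {}\<close>.\<close>

lemma comp_L_Nil_block:
  assumes "set us \<subseteq> permutations_of_set S" "S \<subseteq> A" "us \<noteq> []" "set vs \<subseteq> {[]}"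
  shows "comp_L us ([] # vs) = (if vs = [] then reduce (map (map f \<circ> removeAll k) us) else 0)"
proof (cases vs)
  case Nil
  with assms show ?thesis by (simp add: comp_L_def shuf_singleton_Nil)
next
  case (Cons v vs')
  with assms(4) have vs: "vs = [] # vs'" by auto
  have "reduce z = 0" if "z \<in> keys (shuf us ([] # vs))" for z
  proof (rule reduce_degenerate)
    have "subst_block u v \<in> permutations_of_set (f ` (S - {k}) \<union> (if k \<in> S then g ` {} else {}))"
      if "u \<in> set us" "v \<in> set ([] # vs)" for u v
      by (rule subst_block_perms) (use that assms in auto)
    with keys_shuf[OF that] show "set z \<subseteq> permutations_of_set (f ` (S - {k}) \<union> (if k \<in> S then g ` {} else {}))"
      by blast
    show "\<not> distinct_adj z"
      using that keys_shuf_Nil_degenerate by (simp add: vs)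
  qed
  then show ?thesis
    by (simp add: comp_L_def frag_extend_eq_0 vs)
qed

text \<open>
  The partial composite of surjections, read letter by letter: after a letter \<open>b\<close> of \<open>V\<close>, the
  segment inserted for the current occurrence of \<open>k\<close> either goes on or ends. In the first case,
  \<open>b\<close> is a caesura of type \<open>v\<close> if it occurs again, and it passes all the caesuras of \<open>u\<close> still to come.
\<close>

fun word_comp :: "'a list \<Rightarrow> 'b list \<Rightarrow> ('c list \<Rightarrow>\<^sub>0 int)" where
  "word_comp [] V = frag_of []"
| "word_comp (x # U) [] = (if x = k then 0 else pre (f x) (word_comp U []))"
| "word_comp (x # U) (b # V) =
    (if x = k then
       pre (g b)
         ((if V = [] then 0
           else frag_cmul (if b \<in> set V then (- 1) ^ excess (k # U) else 1) (word_comp (k # U) V))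
          + (if k \<in> set U then word_comp U (b # V) else if V = [] then word_comp U [] else 0))
     else pre (f x) (word_comp U (b # V)))"

lemma word_comp_Cons: "x \<noteq> k \<Longrightarrow> word_comp (x # U) V = pre (f x) (word_comp U V)"
  by (cases V) auto

lemma word_comp_notin: "k \<notin> set U \<Longrightarrow> word_comp U V = word_comp U []"
  by (induction U) (auto simp: word_comp_Cons)

lemma word_comp_Nil2:
  assumes "distinct_adj U" "k \<notin> set U" "set U \<subseteq> A"
  shows "word_comp U [] = frag_of (map f U)"
  using assms
proof (induction U)
  case (Cons x U)
  have "f (hd U) \<noteq> f x" if "U \<noteq> []"
  proof -
    have "hd U \<in> A - {k}" "x \<in> A - {k}" "hd U \<noteq> x"
      using that Cons.prems hd_in_set[OF that] by (auto simp: distinct_adj_Cons)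
    then show ?thesis
      using inj_onD[OF inj_f, of "hd U" x] by blast
  qed
  with Cons show ?case
    by (auto simp: pre_of distinct_adj_Cons hd_map)
qed simp

text \<open>For a doubled \<open>k\<close> the two segments meet in the same letter. With
  \<open>word_comp_degenerate2\<close>, the composite passes to the quotient by degenerate words,
  and \<open>pre\<close> can be opened inside \<open>comp_R\<close>.\<close>

lemma word_comp_degenerate1: "\<not> distinct_adj U \<Longrightarrow> word_comp U V = 0"
proof (induction U V rule: word_comp.induct)
  case (2 x U)
  then show ?case
    by (cases U) (auto simp: distinct_adj_Cons)
next
  case (3 x U b V)
  show ?case
  proof (cases "distinct_adj U")
    case True
    with "3.prems" obtain U' where "U = x # U'" by (cases U) auto
    with "3.IH" "3.prems" show ?thesis
      by (auto simp: pre_linear)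
  next
    case False
    then have "\<not> distinct_adj (k # U)" by (auto simp: distinct_adj_Cons)
    with False 3 show ?thesis by auto
  qed
qed simp

lemma word_comp_degenerate2: "k \<in> set U \<Longrightarrow> \<not> distinct_adj V \<Longrightarrow> word_comp U V = 0"
proof (induction U V rule: word_comp.induct)
  case (3 x U b V)
  show ?case
  proof (cases "x = k")
    case True
    have V: "V \<noteq> []" using "3.prems"(2) by auto
    have "k \<in> set U \<Longrightarrow> word_comp U (b # V) = 0"
      using 3 True by auto
    moreover have "pre (g b) (word_comp (k # U) V) = 0"
    proof (cases "distinct_adj V")
      case True
      with "3.prems" obtain V' where "V = b # V'" by (cases V) auto
      then show ?thesis by simp
    next
      case False
      with 3 True V show ?thesis by auto
    qed
    ultimately show ?thesis
      using True V by (auto simp: pre_linear)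
  next
    case False
    with 3 show ?thesis by auto
  qed
qed auto

section \<open>Reduction followed by composition of words\<close>

definition comp_R :: "('a list \<Rightarrow>\<^sub>0 int) \<Rightarrow> ('b list \<Rightarrow>\<^sub>0 int) \<Rightarrow> ('c list \<Rightarrow>\<^sub>0 int)" where
  "comp_R X Y = frag_extend (\<lambda>U. frag_extend (word_comp U) Y) X"

lemma comp_R_0 [simp]: "comp_R 0 Y = 0" "comp_R X 0 = 0"
  by (simp_all add: comp_R_def frag_extend_eq_0)

lemma comp_R_add1: "comp_R (X + X') Y = comp_R X Y + comp_R X' Y"
  by (simp add: comp_R_def frag_extend_add)

lemma comp_R_f:
  assumes "x \<noteq> k"
  shows "comp_R (pre x X) Y = pre (f x) (comp_R X Y)"
  unfolding comp_R_def frag_extend_pre pre_frag_extend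
proof (rule frag_extend_eq)
  fix U
  have "pre (f x) (word_comp U V) = 0" if "U \<noteq> []" "hd U = x" for V
    using that assms by (cases U) (auto simp: word_comp_Cons)
  with assms show "(if U \<noteq> [] \<and> hd U = x then 0 else frag_extend (word_comp (x # U)) Y) =
      frag_extend (\<lambda>V. pre (f x) (word_comp U V)) Y"
    by (auto simp: word_comp_Cons frag_extend_eq_0 intro!: frag_extend_eq)
qed

lemma comp_R_pre1: "comp_R (pre x X) Y = frag_extend (\<lambda>U. frag_extend (word_comp (x # U)) Y) X"
  unfolding comp_R_def frag_extend_pre
proof (rule frag_extend_eq)
  fix U
  have "\<not> distinct_adj (x # U)" if "U \<noteq> []" "hd U = x"
    using that by (auto simp: distinct_adj_Cons)
  then show "(if U \<noteq> [] \<and> hd U = x then 0 else frag_extend (word_comp (x # U)) Y) =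
      frag_extend (word_comp (x # U)) Y"
    by (auto simp: word_comp_degenerate1 frag_extend_eq_0)
qed

lemma comp_R_pre2:
  assumes "\<And>U. U \<in> keys X \<Longrightarrow> k \<in> set U"
  shows "comp_R X (pre b Y) = frag_extend (\<lambda>U. frag_extend (\<lambda>V. word_comp U (b # V)) Y) X"
  unfolding comp_R_def frag_extend_pre
proof (intro frag_extend_eq)
  fix U V assume "U \<in> keys X"
  moreover have "\<not> distinct_adj (b # V)" if "V \<noteq> []" "hd V = b"
    using that by (auto simp: distinct_adj_Cons)
  ultimately show "(if V \<noteq> [] \<and> hd V = b then 0 else word_comp U (b # V)) = word_comp U (b # V)"
    using assms by (auto simp: word_comp_degenerate2)
qed

text \<open>The summands \<open>P\<close>, \<open>Q\<close> and \<open>M\<close>, \<open>N\<close>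
  model the two branches of \<open>reduce\<close> for the outer and the inserted table. The segment
  goes on with \<open>b\<close> not returning, or with \<open>b\<close> a caesura of type
  \<open>v\<close>; or it ends and a later \<open>k\<close> repeats \<open>b\<close>; or it ends for
  good, which requires \<open>b\<close> to be the last inserted letter.\<close>

lemma comp_R_g:
  assumes P: "\<And>U. U \<in> keys P \<Longrightarrow> k \<notin> set U \<and> excess (k # U) = n"
    and Q: "\<And>U. U \<in> keys Q \<Longrightarrow> k \<in> set U \<and> excess (k # U) = n"
    and M: "\<And>V. V \<in> keys M \<Longrightarrow> b \<notin> set V"
    and N: "\<And>V. V \<in> keys N \<Longrightarrow> b \<in> set V"
  shows "comp_R (pre k (P + Q)) (pre b (M + N)) =
    pre (g b) (comp_R (pre k (P + Q)) (frag_extend (\<lambda>V. if V = [] then 0 else frag_of V) M)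
      + frag_cmul ((- 1) ^ n) (comp_R (pre k (P + Q)) N)
      + comp_R Q (pre b (M + N))
      + comp_R P (frag_extend (\<lambda>V. if V = [] then frag_of [] else 0) M))"
proof -
  let ?X = "P + Q" and ?Y = "M + N"
  define a1 where "a1 = (\<lambda>U V. if V = [] then 0
    else frag_cmul (if b \<in> set V then (- 1) ^ excess (k # U) else 1) (word_comp (k # U) V))"
  define a2 where "a2 = (\<lambda>U V. if k \<in> set U then word_comp U (b # V) else 0)"
  define a3 where "a3 = (\<lambda>U (V :: 'b list). if k \<in> set U then 0 else if V = [] then word_comp U [] else 0)"
  have X: "excess (k # U) = n" if "U \<in> keys ?X" for U
    using that P Q keys_add[of P Q] by blast
  have "comp_R (pre k ?X) (pre b ?Y) = frag_extend (\<lambda>U. frag_extend (\<lambda>V. word_comp (k # U) (b # V)) ?Y) ?X"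
  proof -
    have "comp_R (pre k ?X) (pre b ?Y) = frag_extend (\<lambda>U. comp_R (frag_of (k # U)) (pre b ?Y)) ?X"
      by (simp add: comp_R_pre1) (simp add: comp_R_def)
    also have "\<dots> = frag_extend (\<lambda>U. frag_extend (\<lambda>V. word_comp (k # U) (b # V)) ?Y) ?X"
      by (intro frag_extend_eq, subst comp_R_pre2) (simp_all del: word_comp.simps)
    finally show ?thesis .
  qed
  also have "\<dots> = frag_extend (\<lambda>U. frag_extend (\<lambda>V. pre (g b) (a1 U V + a2 U V + a3 U V)) ?Y) ?X"
    by (intro frag_extend_eq) (auto simp: a1_def a2_def a3_def)
  also have "\<dots> = pre (g b) (frag_extend (\<lambda>U. frag_extend (a1 U) ?Y) ?X
      + frag_extend (\<lambda>U. frag_extend (a2 U) ?Y) ?X + frag_extend (\<lambda>U. frag_extend (a3 U) ?Y) ?X)"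
    by (simp add: frag_extend_fun_add pre_add flip: pre_frag_extend)
  also have "frag_extend (\<lambda>U. frag_extend (a1 U) ?Y) ?X =
      comp_R (pre k ?X) (frag_extend (\<lambda>V. if V = [] then 0 else frag_of V) M)
      + frag_cmul ((- 1) ^ n) (comp_R (pre k ?X) N)"
  proof -
    have "frag_extend (\<lambda>U. frag_extend (a1 U) M) ?X =
        frag_extend (\<lambda>U. frag_extend (word_comp (k # U))
          (frag_extend (\<lambda>V. if V = [] then 0 else frag_of V) M)) ?X"
      unfolding frag_extend_frag_extend using M by (intro frag_extend_eq) (auto simp: a1_def)
    moreover have "frag_extend (\<lambda>U. frag_extend (a1 U) N) ?X =
        frag_extend (\<lambda>U. frag_extend (\<lambda>V. frag_cmul ((- 1) ^ n) (word_comp (k # U) V)) N) ?X"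
      using N X by (intro frag_extend_eq) (auto simp: a1_def)
    ultimately show ?thesis
      by (simp add: comp_R_pre1 frag_extend_add frag_extend_fun_add frag_extend_fun_cmul)
  qed
  also have "frag_extend (\<lambda>U. frag_extend (a2 U) ?Y) ?X = comp_R Q (pre b ?Y)"
  proof -
    have "frag_extend (\<lambda>U. frag_extend (a2 U) ?Y) P = 0"
      using P by (intro frag_extend_eq_0) (simp add: a2_def)
    moreover have "frag_extend (\<lambda>U. frag_extend (a2 U) ?Y) Q = comp_R Q (pre b ?Y)"
      using Q by (subst comp_R_pre2) (auto simp: a2_def intro!: frag_extend_eq)
    ultimately show ?thesis
      by (simp add: frag_extend_add)
  qed
  also have "frag_extend (\<lambda>U. frag_extend (a3 U) ?Y) ?X =
      comp_R P (frag_extend (\<lambda>V. if V = [] then frag_of [] else 0) M)"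
  proof -
    have "frag_extend (\<lambda>U. frag_extend (a3 U) ?Y) Q = 0"
      using Q by (intro frag_extend_eq_0) (simp add: a3_def)
    moreover have "frag_extend (a3 U) N = 0" for U
      using N by (intro frag_extend_eq_0) (force simp: a3_def)
    moreover have "frag_extend (\<lambda>U. frag_extend (a3 U) M) P =
        comp_R P (frag_extend (\<lambda>V. if V = [] then frag_of [] else 0) M)"
      unfolding comp_R_def frag_extend_frag_extend
      using P by (intro frag_extend_eq) (auto simp: a3_def)
    ultimately show ?thesis
      by (simp add: frag_extend_add)
  qed
  finally show ?thesis
    by (simp add: add.assoc)
qed

text \<open>The induction is on the letters of both tables together, as a step may shorten either of
  them. For an empty block the left side would delete \<open>k\<close>, whereas
  \<open>word_comp\<close> would vanish.\<close>

theorem reduce_shuf: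
  assumes "set us \<subseteq> permutations_of_set S" "set vs \<subseteq> permutations_of_set T"
    and "S \<subseteq> A" "T \<subseteq> B" "k \<in> S" "T \<noteq> {}"
  shows "frag_extend reduce (shuf us vs) = comp_R (reduce us) (reduce vs)"
  unfolding comp_L_def[symmetric] using assms
proof (induction "sum_list (map length us) + sum_list (map length vs)"
    arbitrary: us vs S T rule: less_induct)
  case less
  show ?case
  proof (cases "us = [] \<or> vs = []")
    case False
    then obtain x q us' b z vs' where us: "us = (x # q) # us'" and vs: "vs = (b # z) # vs'"
      using less.prems by (cases us; cases "hd us"; cases vs; cases "hd vs")
        (auto simp: permutations_of_set_def)
    note pu = perms_Cons_Cons[OF less.prems(1)[unfolded us]]
    note pv = perms_Cons_Cons[OF less.prems(2)[unfolded vs]]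
    have size_us: "sum_list (map length (q # map (removeAll x) us')) < sum_list (map length us)"
      using sum_list_length_removeAll_le[of x us'] by (simp add: us o_def)
    have size_vs: "sum_list (map length (z # map (removeAll b) vs')) < sum_list (map length vs)"
      using sum_list_length_removeAll_le[of b vs'] by (simp add: vs o_def)
    have us'_vs: "comp_L us' vs = comp_R (reduce us') (reduce vs)"
      by (rule less.hyps) (use less.prems us in auto)
    have us_vs': "comp_L us vs' = comp_R (reduce us) (reduce vs')"
      by (rule less.hyps) (use less.prems vs in auto)
    show ?thesis
    proof (cases "x = k")
      case False
      have "comp_L (q # map (removeAll x) us') vs = comp_R (reduce (q # map (removeAll x) us')) (reduce vs)"
        by (rule less.hyps[OF _ pu(3) less.prems(2)]) (use size_us less.prems False in auto)
      moreover have "comp_L us vs = pre (f x) (comp_L (q # map (removeAll x) us') vs + comp_L us' vs)"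
        unfolding us vs using less.prems us vs False by (intro comp_L_f) auto
      moreover have "reduce us = pre x (reduce (q # map (removeAll x) us') + reduce us')"
        by (simp add: us)
      ultimately show ?thesis
        by (simp only: us'_vs comp_R_f[OF False] comp_R_add1)
    next
      case True
      define P Q where "P = reduce (q # map (removeAll k) us')" and "Q = reduce us'"
      define M N where "M = reduce (z # map (removeAll b) vs')" and "N = reduce vs'"
      have reduce_us: "reduce us = pre k (P + Q)" and reduce_vs: "reduce vs = pre b (M + N)"
        by (simp_all add: us vs True P_def Q_def M_def N_def)
      have P: "set U = S - {k} \<and> distinct_adj U \<and> excess (k # U) = length us'" if "U \<in> keys P" for U
      proof -
        have U: "set U = S - {k}" "distinct_adj U" "length U + 1 = card (S - {k}) + Suc (length us')"
          using keys_reduce[OF pu(3), of U] that True by (simp_all add: P_def del: card_Diff_insert)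
        have "excess U = length us'"
          using U(3) unfolding excess_def U(1) by linarith
        with U(1,2) show ?thesis
          by (simp add: excess_Cons)
      qed
      have Q: "set U = S \<and> excess (k # U) = length us'" if "U \<in> keys Q" for U
      proof -
        have U: "set U = S" "length U + 1 = card S + length us'"
          using keys_reduce[OF pu(4), of U] that by (simp_all add: Q_def)
        have "us' \<noteq> []"
          using that by (auto simp: Q_def)
        then have "0 < length us'"
          by simp
        then have "Suc (excess U) = length us'"
          using U(2) unfolding excess_def U(1) by linarith
        then show ?thesis
          using U(1) less.prems(5) by (simp add: excess_Cons)
      qed
      have M: "set V = T - {b}" if "V \<in> keys M" for V
        using keys_reduce[OF pv(3), of V] that by (simp add: M_def)
      have N: "set V = T" if "V \<in> keys N" for V
        using keys_reduce[OF pv(4), of V] that by (simp add: N_def)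
      have R: "comp_R (reduce us) (reduce vs) = pre (g b)
         (comp_R (reduce us) (frag_extend (\<lambda>V. if V = [] then 0 else frag_of V) M)
          + frag_cmul ((- 1) ^ length us') (comp_R (reduce us) N)
          + comp_R Q (reduce vs)
          + comp_R P (frag_extend (\<lambda>V. if V = [] then frag_of [] else 0) M))"
        unfolding reduce_us reduce_vs
        by (rule comp_R_g) (use P Q M N less.prems(5) pv(1) in auto)
      have L: "comp_L us vs = pre (g b) (comp_L us (z # map (removeAll b) vs') + comp_L us' vs
          + frag_cmul ((- 1) ^ length us') (comp_L us vs'))"
        unfolding us vs True using less.prems us vs True by (intro comp_L_g) auto
      have "comp_L us (z # map (removeAll b) vs') =
        comp_R (reduce us) (frag_extend (\<lambda>V. if V = [] then 0 else frag_of V) M)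
        + comp_R P (frag_extend (\<lambda>V. if V = [] then frag_of [] else 0) M)"
      proof (cases "T = {b}")
        case False
        then have T: "T - {b} \<noteq> {}" using pv(1) by auto
        have V: "V \<noteq> []" if "V \<in> keys M" for V
          using M[OF that] T by (metis list.set(1))
        then have "frag_extend (\<lambda>V. if V = [] then 0 else frag_of V) M = frag_extend frag_of M"
          by (intro frag_extend_eq) auto
        moreover have "frag_extend (\<lambda>V. if V = [] then frag_of ([] :: 'b list) else 0) M = 0"
          using V by (intro frag_extend_eq_0) auto
        moreover have "comp_L us (z # map (removeAll b) vs') = comp_R (reduce us) M"
          unfolding M_def
          by (rule less.hyps[OF _ less.prems(1) pv(3)]) (use size_vs less.prems T in auto)
        ultimately show ?thesis by simp
      next
        case True
        have z: "z = []" "set (map (removeAll b) vs') \<subseteq> {[]}"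
          using pv(3) True by (auto simp: permutations_of_set_def)
        have "comp_L us ([] # map (removeAll b) vs') =
            (if vs' = [] then reduce (map (map f \<circ> removeAll k) us) else 0)"
          using comp_L_Nil_block[OF less.prems(1,3) _ z(2)] by (simp add: us)
        moreover have "reduce (map (map f \<circ> removeAll k) us) = frag_extend (frag_of \<circ> map f) P"
        proof -
          have "map (map f \<circ> removeAll k) us = map (map f) (q # map (removeAll k) us')"
            using pu(6) \<open>x = k\<close> by (simp add: us)
          then show ?thesis
            unfolding P_def using pu(3) \<open>x = k\<close> less.prems(3)
            by (simp only:) (rule reduce_map[of _ "S - {k}"], auto intro: inj_on_subset[OF inj_f])
        qed
        moreover have "frag_extend (frag_of \<circ> map f) P = comp_R P (frag_of [])"
          unfolding comp_R_def
        proof (rule frag_extend_eq)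
          fix U assume "U \<in> keys P"
          from P[OF this] less.prems(3) show "(frag_of \<circ> map f) U = frag_extend (word_comp U) (frag_of [])"
            by (subst frag_extend_of, subst word_comp_Nil2) auto
        qed
        moreover have "M = (if vs' = [] then frag_of [] else 0)"
          by (simp add: M_def z(1))
        ultimately show ?thesis
          by (simp add: z(1))
      qed
      then show ?thesis
        unfolding R L us'_vs us_vs' Q_def N_def by (simp add: algebra_simps)
    qed
  qed auto
qed

end

section \<open>Shuffle signs and lattice paths\<close>

lemma pre_sum: "pre a (\<Sum>i\<in>I. h i) = (\<Sum>i\<in>I. pre a (h i))"
  by (induction I rule: infinite_finite_induct) (auto simp: pre_add)

definition initial_cycle :: "nat \<Rightarrow> nat \<Rightarrow> nat" where
  "initial_cycle p i = (if i = 0 then p else if i \<le> p then i - 1 else i)"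

lemma initial_cycle_permutes: "initial_cycle p permutes {..p} \<and> sign (initial_cycle p) = (- 1) ^ p"
proof (induction p)
  case 0
  have "initial_cycle 0 = id" by (auto simp: initial_cycle_def)
  then show ?case by (simp only: permutes_id sign_id power_0 simp_thms)
next
  case (Suc p)
  have eq: "initial_cycle (Suc p) = transpose p (Suc p) \<circ> initial_cycle p"
    by (auto simp: initial_cycle_def transpose_def fun_eq_iff)
  have "initial_cycle p permutes {..Suc p}"
    using Suc by (auto intro: permutes_subset)
  moreover have "transpose p (Suc p) permutes {..Suc p}"
    by (rule permutes_swap_id) auto
  moreover have "permutation (initial_cycle p)"
    using Suc permutation_permutes by blast
  ultimately have "transpose p (Suc p) \<circ> initial_cycle p permutes {..Suc p}"
    "sign (transpose p (Suc p) \<circ> initial_cycle p) = - sign (initial_cycle p)"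
    by (simp_all only: permutes_compose sign_compose permutation_swap_id sign_swap_id) simp
  then show ?case
    unfolding eq by (simp only: conjunct2[OF Suc] power_Suc mult_minus1 simp_thms)
qed

text \<open>A leading \<open>True\<close> stays in place, and a leading \<open>False\<close> jumps
  over all letters \<open>True\<close>. Transport along \<open>Suc\<close> makes room for the new
  position 0.\<close>

lemma shuffle_perm_Cons:
  assumes "shuffle_perm ts permutes {..<length ts}"
  shows "shuffle_perm (True # ts) = map_permutation {..<length ts} Suc (shuffle_perm ts)"
    and "shuffle_perm (False # ts) =
      initial_cycle (count_list ts True) \<circ> map_permutation {..<length ts} Suc (shuffle_perm ts)"
proof -
  let ?M = "map_permutation {..<length ts} Suc (shuffle_perm ts)"
  have M: "?M i = (case i of 0 \<Rightarrow> 0 | Suc n \<Rightarrow> Suc (shuffle_perm ts n))" for i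
  proof (cases "i \<in> Suc ` {..<length ts}")
    case True
    then obtain n where "i = Suc n" "n \<in> {..<length ts}" by auto
    then show ?thesis
      using map_permutation_apply[of Suc "{..<length ts}" n "shuffle_perm ts"] by simp
  next
    case False
    then have "?M i = i"
      by (simp add: map_permutation_def restrict_id_def)
    moreover have "shuffle_perm ts n = n" if "i = Suc n" for n
      using False that by (auto simp: shuffle_perm_def)
    ultimately show ?thesis
      by (auto split: nat.split)
  qed
  have le: "count_list (take n ts) True < count_list ts True" if "n < length ts" "ts ! n" for n
  proof -
    have "ts = take n ts @ ts ! n # drop (Suc n) ts"
      using that(1) by (rule id_take_nth_drop)
    then have "count_list ts True = count_list (take n ts @ ts ! n # drop (Suc n) ts) True"
      by simp
    with that(2) show ?thesis by simp
  qed
  have "count_list ts True \<le> length ts" by (simp add: count_le_length)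
  with le show "shuffle_perm (True # ts) = ?M"
    "shuffle_perm (False # ts) = initial_cycle (count_list ts True) \<circ> ?M"
    by (auto simp: fun_eq_iff M shuffle_perm_def initial_cycle_def Suc_le_eq split: nat.split)
qed

lemma shuffle_perm_permutes: "shuffle_perm ts permutes {..<length ts}"
proof (induction ts)
  case Nil
  then show ?case
    by (simp add: shuffle_perm_def permutes_def)
next
  case (Cons t ts)
  have "map_permutation {..<length ts} Suc (shuffle_perm ts) permutes Suc ` {..<length ts}"
    using Cons by (intro map_permutation_permutes) (auto simp: bij_betw_def)
  then have "map_permutation {..<length ts} Suc (shuffle_perm ts) permutes {..<Suc (length ts)}"
    by (rule permutes_subset) auto
  moreover have "initial_cycle (count_list ts True) permutes {..<Suc (length ts)}"
    using initial_cycle_permutes[of "count_list ts True"] count_le_length[of ts True]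
    by (auto intro: permutes_subset)
  ultimately show ?case
    using shuffle_perm_Cons[OF Cons] permutes_compose by (cases t) (simp_all only: length_Cons)
qed

lemma shuffle_sign_Nil [simp]: "shuffle_sign [] = 1"
proof -
  have "shuffle_perm [] = id" by (auto simp: shuffle_perm_def)
  then show ?thesis by (simp add: shuffle_sign_def)
qed

lemma shuffle_sign_Cons:
  "shuffle_sign (t # ts) = (if t then 1 else (- 1) ^ count_list ts True) * shuffle_sign ts"
proof -
  let ?M = "map_permutation {..<length ts} Suc (shuffle_perm ts)"
  have "sign ?M = shuffle_sign ts"
    unfolding shuffle_sign_def by (rule sign_map_permutation) (auto simp: shuffle_perm_permutes)
  moreover have "?M permutes Suc ` {..<length ts}"
    using shuffle_perm_permutes by (intro map_permutation_permutes) (auto simp: bij_betw_def)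
  then have "permutation ?M"
    using permutation_permutes by blast
  moreover have "permutation (initial_cycle p)" for p
    using initial_cycle_permutes permutation_permutes by blast
  ultimately show ?thesis
    using shuffle_perm_Cons[OF shuffle_perm_permutes, of ts] initial_cycle_permutes
    by (simp add: shuffle_sign_def sign_compose)
qed

lemma sum_lattice_paths:
  "(\<Sum>ts \<in> lattice_paths d e. h ts) = (if d = 0 \<and> e = 0 then h [] else
    (if d = 0 then 0 else \<Sum>ts \<in> lattice_paths (d - 1) e. h (True # ts)) +
    (if e = 0 then 0 else \<Sum>ts \<in> lattice_paths d (e - 1). h (False # ts)))"
proof (cases "d = 0 \<and> e = 0")
  case True
  then have "lattice_paths d e = {[]}" by (auto simp: lattice_paths_def)
  with True show ?thesis by simp
next
  case False
  have count: "count_list ts True \<le> length ts" for ts by (rule count_le_length)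
  let ?T = "if d = 0 then {} else (#) True ` lattice_paths (d - 1) e"
  let ?F = "if e = 0 then {} else (#) False ` lattice_paths d (e - 1)"
  have "ts \<in> lattice_paths d e \<longleftrightarrow> ts \<in> ?T \<union> ?F" for ts
  proof (cases ts)
    case Nil
    with False show ?thesis by (auto simp: lattice_paths_def)
  next
    case (Cons t us)
    then show ?thesis
      using count[of us] by (cases t) (auto simp: lattice_paths_def)
  qed
  then have "lattice_paths d e = ?T \<union> ?F" by blast
  then have "sum h (lattice_paths d e) = sum h ?T + sum h ?F"
    by (simp only:) (rule sum.union_disjoint, auto simp: finite_lattice_paths)
  with False show ?thesis
    by (auto simp: sum.reindex)
qed

section \<open>Composites along lattice paths and the renaming of values\<close>

lemma W_path_Nil: "W_path k (u # us) (v # vs) [] = [perm_comp k u v]"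
  by (simp add: W_path_def)

lemma W_path_Cons:
  "W_path k (u # us) (v # vs) (t # ts) =
    perm_comp k u v # W_path k (if t then us else u # us) (if t then v # vs else vs) ts"
  by (simp add: W_path_def upt_conv_Cons map_Suc_upt[symmetric] o_def del: upt_Suc map_Suc_upt)

definition shift_out :: "nat \<Rightarrow> nat \<Rightarrow> nat \<Rightarrow> nat" where
  "shift_out k s a = (if a > k then a + s - 1 else a)"

definition shift_in :: "nat \<Rightarrow> nat \<Rightarrow> nat" where
  "shift_in k b = b + k - 1"

locale nat_composite = composite k f g A B
  for k :: nat and f g :: "nat \<Rightarrow> nat" and A B

lemma composite_shift:
  assumes "k \<ge> 1" "s \<ge> 1"
  shows "nat_composite k (shift_out k s) (shift_in k) {1..r} {1..s}"
proof
  show "inj_on (shift_out k s) ({1..r} - {k})"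
    using assms by (auto simp: inj_on_def shift_out_def split: if_splits)
  show "inj_on (shift_in k) {1..s}"
    using assms by (auto simp: inj_on_def shift_in_def)
  show "shift_out k s x \<noteq> shift_in k b" if "x \<in> {1..r} - {k}" "b \<in> {1..s}" for x b
    using that assms by (auto simp: shift_out_def shift_in_def split: if_splits)
qed

lemma image_shift:
  assumes "k \<in> {1..r}" "s \<ge> 1"
  shows "shift_out k s ` ({1..r} - {k}) \<union> shift_in k ` {1..s} = {1..r + s - 1}"
proof (intro equalityI subsetI)
  fix c assume c: "c \<in> {1..r + s - 1}"
  consider "c < k" | "k \<le> c" "c < k + s" | "k + s \<le> c" by linarith
  then show "c \<in> shift_out k s ` ({1..r} - {k}) \<union> shift_in k ` {1..s}"
  proof cases
    case 1
    with c assms have "c \<in> {1..r} - {k}" "shift_out k s c = c" by (auto simp: shift_out_def)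
    then show ?thesis by (metis UnI1 imageI)
  next
    case 2
    then have "c + 1 - k \<in> {1..s}" "shift_in k (c + 1 - k) = c" by (auto simp: shift_in_def)
    then show ?thesis by (metis UnI2 imageI)
  next
    case 3
    with c assms have "c + 1 - s \<in> {1..r} - {k}" "shift_out k s (c + 1 - s) = c"
      by (auto simp: shift_out_def)
    then show ?thesis by (metis UnI1 imageI)
  qed
qed (use assms in \<open>auto simp: shift_out_def shift_in_def split: if_splits\<close>)

section \<open>Insertions\<close>

text \<open>The rest of a subdivision after its entry \<open>j\<close>, the current position in the
  inserted word. Including \<open>j\<close> under \<open>last\<close> makes sense of
  \<open>n = 0\<close>, where \<open>j = l\<close> is forced.\<close>

definition cuts :: "nat \<Rightarrow> nat \<Rightarrow> nat \<Rightarrow> nat list set" where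
  "cuts n j l = {js. length js = n \<and> sorted (j # js) \<and> last (j # js) = l}"

lemma subdivisions_eq: "subdivisions n l = (#) 1 ` cuts n 1 l"
proof -
  have "js ! n = last js" if "length js = Suc n" for js :: "nat list"
    using that by (cases js rule: rev_cases) auto
  then have "js \<in> subdivisions n l \<longleftrightarrow> js \<in> (#) 1 ` cuts n 1 l" for js
    by (cases js) (auto simp: subdivisions_def cuts_def simp del: sorted_simps last.simps nth_Cons_Suc)
  then show ?thesis by blast
qed

lemma cuts_0: "cuts 0 j l = (if j = l then {[]} else {})"
  by (auto simp: cuts_def)

lemma cuts_le: "js \<in> cuts n j l \<Longrightarrow> j \<le> l"
  using last_in_set[of js] by (cases js) (auto simp: cuts_def split: if_splits)

text \<open>The current segment ends at \<open>j\<close> or goes on: the two branches of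
  \<open>word_comp\<close>.\<close>

lemma cuts_Suc:
  "cuts (Suc n) j l = (#) j ` cuts n j l \<union> (if j < l then cuts (Suc n) (Suc j) l else {})"
proof (intro equalityI subsetI)
  fix js assume js: "js \<in> cuts (Suc n) j l"
  then obtain j' js' where js': "js = j' # js'" by (cases js) (auto simp: cuts_def)
  show "js \<in> (#) j ` cuts n j l \<union> (if j < l then cuts (Suc n) (Suc j) l else {})"
  proof (cases "j' = j")
    case True
    with js js' show ?thesis by (auto simp: cuts_def)
  next
    case False
    with js js' have "js \<in> cuts (Suc n) (Suc j) l" by (auto simp: cuts_def)
    with cuts_le[OF this] show ?thesis by auto
  qed
qed (auto simp: cuts_def split: if_splits)

lemma finite_cuts: "finite (cuts n j l)"
proof -
  have "set js \<subseteq> {..l}" if "js \<in> cuts n j l" for js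
  proof (cases "js = []")
    case False
    with that have "sorted js" "last js = l" by (auto simp: cuts_def)
    then show ?thesis
      using False by (auto simp: in_set_conv_nth last_conv_nth intro!: sorted_nth_mono)
  qed simp
  moreover have "length js = n" if "js \<in> cuts n j l" for js
    using that by (simp add: cuts_def)
  ultimately have "cuts n j l \<subseteq> {js. set js \<subseteq> {..l} \<and> length js = n}"
    by blast
  then show ?thesis
    by (rule finite_subset) (simp add: finite_lists_length_eq)
qed

lemma caesura_types_Nil [simp]: "caesura_types [] = []"
  by (simp add: caesura_types_def)

lemma caesura_types_Cons:
  "caesura_types ((y, t) # c) = (if y \<in> fst ` set c then t # caesura_types c else caesura_types c)"
proof -
  have "filter (caesura (y # map fst c)) [0..<Suc (length c)] =
      (if y \<in> fst ` set c then [0] else []) @ map Suc (filter (caesura (map fst c)) [0..<length c])"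
    by (simp add: upt_conv_Cons map_Suc_upt[symmetric] filter_map o_def caesura_Cons_0
        del: upt_Suc map_Suc_upt)
  then show ?thesis
    by (simp add: caesura_types_def o_def del: upt_Suc)
qed

definition signed_word :: "(nat \<times> bool) list \<Rightarrow> (nat list \<Rightarrow>\<^sub>0 int)" where
  "signed_word c = frag_cmul (shuffle_sign (caesura_types c)) (nrm (map fst c))"

lemma signed_word_Cons:
  "signed_word ((y, t) # c) = frag_cmul
    (if y \<in> fst ` set c \<and> \<not> t then (- 1) ^ count_list (caesura_types c) True else 1)
    (pre y (signed_word c))"
  by (simp add: signed_word_def caesura_types_Cons shuffle_sign_Cons nrm_Cons pre_cmul)

context nat_composite
begin

text \<open>A form of \<open>X_insert\<close> that carries the current position \<open>j\<close> in
  \<open>v\<close> and consumes one entry of the subdivision at each \<open>k\<close>. For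
  \<open>js\<close> as long as the number of these, \<open>js' \<noteq> []\<close> says that another
  \<open>k\<close> follows.\<close>

fun insertion :: "nat list \<Rightarrow> nat list \<Rightarrow> nat \<Rightarrow> nat list \<Rightarrow> (nat \<times> bool) list" where
  "insertion [] v j js = []"
| "insertion (x # U) v j js =
    (if x \<noteq> k then (f x, True) # insertion U v j js
     else case js of [] \<Rightarrow> []
       | j' # js' \<Rightarrow> map (\<lambda>l. (g (v ! (l - 1)), l = j' \<and> js' \<noteq> [])) [j..<Suc j'] @ insertion U v j' js')"

lemma insertion_end:
  "insertion (k # U) v j (j # js) = (g (v ! (j - 1)), js \<noteq> []) # insertion U v j js"
  by simp

lemma insertion_continue:
  "j < j' \<Longrightarrow> insertion (k # U) v j (j' # js) =
    (g (v ! (j - 1)), False) # insertion (k # U) v (Suc j) (j' # js)"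
  by (simp add: upt_conv_Cons del: upt_Suc)

lemma drop_pos: "1 \<le> j \<Longrightarrow> j \<le> length v \<Longrightarrow> drop (j - 1) v = v ! (j - 1) # drop j v"
  using Cons_nth_drop_Suc[of "j - 1" v] by simp

text \<open>What the sign of a preceding letter depends on: the letters still to come decide whether
  it is a caesura, and the number of type \<open>u\<close> caesuras it passes is the same for all
  cuts.\<close>

lemma insertion_letters:
  assumes "js \<in> cuts (count_list U k) j (length v)" "1 \<le> j" "set U \<subseteq> A" "set v \<subseteq> B"
  shows "fst ` set (insertion U v j js) =
      f ` (set U - {k}) \<union> (if k \<in> set U then g ` set (drop (j - 1) v) else {}) \<and>
    count_list (caesura_types (insertion U v j js)) True = excess U"
  using assms
proof (induction "length U + (length v - j)" arbitrary: U j js rule: less_induct)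
  case less
  show ?case
  proof (cases U)
    case (Cons x U')
    show ?thesis
    proof (cases "x = k")
      case False
      have IH: "fst ` set (insertion U' v j js) =
          f ` (set U' - {k}) \<union> (if k \<in> set U' then g ` set (drop (j - 1) v) else {}) \<and>
        count_list (caesura_types (insertion U' v j js)) True = excess U'"
        using less.prems Cons False by (intro less.hyps) auto
      have "f x \<noteq> g b" if "b \<in> set (drop (j - 1) v)" for b
        using that set_drop_subset[of "j - 1" v] less.prems Cons False by (intro f_neq_g) auto
      moreover have "f x \<in> f ` (set U' - {k}) \<longleftrightarrow> x \<in> set U'"
        using less.prems Cons False inj_on_image_mem_iff[OF inj_f, of x "set U' - {k}"] by auto
      ultimately have "f x \<in> fst ` set (insertion U' v j js) \<longleftrightarrow> x \<in> set U'"
        using IH by auto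
      with IH False show ?thesis
        by (auto simp: Cons caesura_types_Cons excess_Cons)
    next
      case True
      have j: "j \<le> length v"
        using cuts_le[OF less.prems(1)] .
      have b: "v ! (j - 1) \<in> B"
        using less.prems(2,4) j by (auto intro!: nth_mem)
      define n where "n = count_list U' k"
      have n: "n = 0 \<longleftrightarrow> k \<notin> set U'" by (simp add: n_def count_list_0_iff)
      have "js \<in> cuts (Suc n) j (length v)"
        using less.prems(1) True Cons by (simp add: n_def)
      then have "js \<in> (#) j ` cuts n j (length v) \<union>
          (if j < length v then cuts (Suc n) (Suc j) (length v) else {})"
        unfolding cuts_Suc[of n j] .
      then consider (stop) js' where "js = j # js'" "js' \<in> cuts n j (length v)"
        | (continue) "j < length v" "js \<in> cuts (Suc n) (Suc j) (length v)"
        by (auto split: if_splits)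
      then show ?thesis
      proof cases
        case stop
        let ?I = "insertion U' v j js'"
        have IH: "fst ` set ?I =
            f ` (set U' - {k}) \<union> (if k \<in> set U' then g ` set (drop (j - 1) v) else {}) \<and>
          count_list (caesura_types ?I) True = excess U'"
          using less.prems Cons stop by (intro less.hyps) (auto simp: n_def)
        have eq: "insertion U v j js = (g (v ! (j - 1)), js' \<noteq> []) # ?I"
          using True by (simp only: Cons stop(1) insertion_end)
        have js': "js' \<noteq> [] \<longleftrightarrow> k \<in> set U'"
          using stop(2) n by (auto simp: cuts_def)
        have "v ! (j - 1) \<in> set (drop (j - 1) v)"
          unfolding drop_pos[OF less.prems(2) j] by simp
        moreover have "g (v ! (j - 1)) \<notin> f ` (set U' - {k})"
          using f_neq_g[OF _ b] less.prems(3) Cons by fastforce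
        ultimately have mem: "g (v ! (j - 1)) \<in> fst ` set ?I \<longleftrightarrow> k \<in> set U'"
          using IH by auto
        show ?thesis
        proof (cases "k \<in> set U'")
          case False
          then have "j = length v"
            using stop(2) n by (simp add: cuts_0 split: if_splits)
          then have "set (drop (j - 1) v) = {v ! (j - 1)}"
            unfolding drop_pos[OF less.prems(2) j] by simp
          with False IH mem js' True show ?thesis
            unfolding eq caesura_types_Cons by (simp add: Cons excess_Cons)
        next
          case in_U': True
          with IH mem js' True \<open>v ! (j - 1) \<in> set (drop (j - 1) v)\<close> show ?thesis
            unfolding eq caesura_types_Cons by (auto simp: Cons excess_Cons)
        qed
      next
        case continue
        define I where "I = insertion U v (Suc j) js"
        have "fst ` set I =
            f ` (set U - {k}) \<union> (if k \<in> set U then g ` set (drop (Suc j - 1) v) else {}) \<and>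
          count_list (caesura_types I) True = excess U"
          unfolding I_def using less.prems Cons continue True by (intro less.hyps) (auto simp: n_def)
        moreover have "k \<in> set U"
          using True Cons by simp
        ultimately have IH: "fst ` set I = f ` (set U - {k}) \<union> g ` set (drop j v)"
          "count_list (caesura_types I) True = excess U"
          by simp_all
        obtain j' js' where js: "js = j' # js'" "j < j'"
          using continue(2) by (cases js) (auto simp: cuts_def)
        have eq: "insertion U v j js = (g (v ! (j - 1)), False) # I"
          using True by (simp only: Cons js insertion_continue I_def)
        have drop: "set (drop (j - 1) v) = insert (v ! (j - 1)) (set (drop j v))"
          unfolding drop_pos[OF less.prems(2) j] by simp
        show ?thesis
          using \<open>k \<in> set U\<close> unfolding eq caesura_types_Cons drop by (simp add: IH)
      qed
    qed
  qed simp
qed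

text \<open>The last hypothesis excludes an unfinished \<open>v\<close> without a \<open>k\<close>
  left to insert it for: there are no cuts then, whereas \<open>word_comp\<close> ignores
  \<open>v\<close>.\<close>

theorem sum_insertions:
  assumes "1 \<le> j" "j \<le> length v" "set U \<subseteq> A" "set v \<subseteq> B" "k \<in> set U \<or> j = length v"
  shows "(\<Sum>js \<in> cuts (count_list U k) j (length v). signed_word (insertion U v j js)) =
    word_comp U (drop (j - 1) v)"
  using assms
proof (induction "length U + (length v - j)" arbitrary: U j rule: less_induct)
  case less
  show ?case
  proof (cases U)
    case Nil
    with less.prems show ?thesis
      by (auto simp: cuts_0 signed_word_def)
  next
    case (Cons x U')
    show ?thesis
    proof (cases "x = k")
      case False
      have "(\<Sum>js \<in> cuts (count_list U' k) j (length v). signed_word (insertion U' v j js)) =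
          word_comp U' (drop (j - 1) v)"
        using less.prems Cons False by (intro less.hyps) auto
      moreover have "signed_word (insertion U v j js) = pre (f x) (signed_word (insertion U' v j js))" for js
        using False by (simp add: Cons signed_word_Cons)
      ultimately show ?thesis
        using False by (simp add: Cons word_comp_Cons pre_sum[symmetric])
    next
      case True
      define n where "n = count_list U' k"
      define b V where "b = v ! (j - 1)" and "V = drop j v"
      have n: "n = 0 \<longleftrightarrow> k \<notin> set U'" by (simp add: n_def count_list_0_iff)
      have U: "U = k # U'" using True Cons by simp
      have bV: "drop (j - 1) v = b # V" "V = [] \<longleftrightarrow> j = length v"
        using drop_pos[OF less.prems(1,2)] less.prems(2) unfolding b_def V_def by auto
      have b: "b \<in> B" "set V \<subseteq> B"
        using less.prems(1,2,4) set_drop_subset[of j v] by (auto simp: b_def V_def intro!: nth_mem)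
      have mem: "g b \<in> f ` (set U - {k}) \<union> g ` X \<longleftrightarrow> b \<in> X" if "X \<subseteq> B" for X
        using f_neq_g[OF _ b(1)] less.prems(3) inj_on_image_mem_iff[OF inj_g b(1) that] by fastforce
      have stop: "(\<Sum>js \<in> (#) j ` cuts n j (length v). signed_word (insertion U v j js)) =
          pre (g b) (if k \<in> set U' then word_comp U' (b # V) else if V = [] then word_comp U' [] else 0)"
      proof -
        \<comment> \<open>No sign arises at the end of a segment: it is a caesura of type
          \<open>u\<close>, or it ends the last segment and its letter does not occur again.\<close>
        have "signed_word (insertion U v j (j # js)) = pre (g b) (signed_word (insertion U' v j js))"
          if "js \<in> cuts n j (length v)" for js
        proof -
          have "js \<noteq> [] \<longleftrightarrow> k \<in> set U'"
            using that n by (auto simp: cuts_def)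
          moreover have "g b \<notin> fst ` set (insertion U' v j js)" if "k \<notin> set U'"
            using insertion_letters[of js U' j v] \<open>js \<in> _\<close> that less.prems mem[of "{}"]
            by (auto simp: n_def U)
          ultimately show ?thesis
            unfolding U insertion_end signed_word_Cons b_def by auto
        qed
        then have "(\<Sum>js \<in> (#) j ` cuts n j (length v). signed_word (insertion U v j js)) =
            (\<Sum>js \<in> cuts n j (length v). pre (g b) (signed_word (insertion U' v j js)))"
          by (simp add: sum.reindex)
        also have "\<dots> = pre (g b)
            (if k \<in> set U' then word_comp U' (b # V) else if V = [] then word_comp U' [] else 0)"
        proof (cases "k \<in> set U' \<or> j = length v")
          case True
          then have "(\<Sum>js \<in> cuts n j (length v). signed_word (insertion U' v j js)) =
              word_comp U' (drop (j - 1) v)"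
            unfolding n_def using less.prems U by (intro less.hyps) auto
          then show ?thesis
            using True bV word_comp_notin[of U' "[b]"] by (auto simp: pre_sum[symmetric])
        next
          case False
          with n bV show ?thesis by (simp add: cuts_0)
        qed
        finally show ?thesis .
      qed
      have continue: "(\<Sum>js \<in> (if j < length v then cuts (Suc n) (Suc j) (length v) else {}).
            signed_word (insertion U v j js)) =
          pre (g b) (if V = [] then 0
            else frag_cmul (if b \<in> set V then (- 1) ^ excess (k # U') else 1) (word_comp (k # U') V))"
      proof (cases "j < length v")
        case False
        with less.prems(2) bV show ?thesis by simp
      next
        case True
        have "signed_word (insertion U v j js) = frag_cmul (if b \<in> set V then (- 1) ^ excess U else 1)
            (pre (g b) (signed_word (insertion U v (Suc j) js)))"
          if js_in: "js \<in> cuts (Suc n) (Suc j) (length v)" for js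
        proof -
          obtain j' js' where js: "js = j' # js'" "j < j'"
            using js_in by (cases js) (auto simp: cuts_def)
          have eq: "insertion U v j js = (g b, False) # insertion U v (Suc j) js"
            by (simp only: U js insertion_continue b_def)
          have "fst ` set (insertion U v (Suc j) js) = f ` (set U - {k}) \<union> g ` set V \<and>
              count_list (caesura_types (insertion U v (Suc j) js)) True = excess U"
            using insertion_letters[of js U "Suc j" v] js_in less.prems by (simp add: U n_def V_def)
          with mem[OF b(2)] show ?thesis
            unfolding eq signed_word_Cons by simp
        qed
        then have "(\<Sum>js \<in> cuts (Suc n) (Suc j) (length v). signed_word (insertion U v j js)) =
            frag_cmul (if b \<in> set V then (- 1) ^ excess U else 1) (pre (g b)
              (\<Sum>js \<in> cuts (Suc n) (Suc j) (length v). signed_word (insertion U v (Suc j) js)))"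
          by (simp add: frag_cmul_sum pre_sum)
        also have "(\<Sum>js \<in> cuts (Suc n) (Suc j) (length v). signed_word (insertion U v (Suc j) js)) =
            word_comp U V"
          using less.hyps[of U "Suc j"] less.prems True by (simp add: U n_def V_def)
        finally show ?thesis
          using True bV(2) by (simp add: U pre_cmul)
      qed
      have "(\<Sum>js \<in> cuts (count_list U k) j (length v). signed_word (insertion U v j js)) =
          (\<Sum>js \<in> (#) j ` cuts n j (length v). signed_word (insertion U v j js)) +
          (\<Sum>js \<in> (if j < length v then cuts (Suc n) (Suc j) (length v) else {}).
            signed_word (insertion U v j js))"
      proof -
        have "cuts (count_list U k) j (length v) = cuts (Suc n) j (length v)"
          by (simp add: U n_def)
        moreover have "(#) j ` cuts n j (length v) \<inter>
            (if j < length v then cuts (Suc n) (Suc j) (length v) else {}) = {}"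
          by (auto simp: cuts_def)
        ultimately show ?thesis
          unfolding cuts_Suc[of n j] by (simp add: sum.union_disjoint finite_cuts)
      qed
      also have "\<dots> = word_comp U (drop (j - 1) v)"
        unfolding stop continue by (simp add: bV(1)[unfolded One_nat_def] U pre_add add.commute)
      finally show ?thesis .
    qed
  qed
qed

end

section \<open>The morphisms of operads\<close>

lemma E_basisD:
  assumes "ws \<in> E_basis r d"
  shows "ws \<noteq> []" "set ws \<subseteq> permutations_of_set {1..r}" "distinct_adj ws" "length ws = Suc d"
  using assms by (auto simp: E_basis_def W_simplices_def)

lemma E_basis_UnD:
  assumes "ws \<in> (\<Union>d. E_basis r d)"
  shows "ws \<noteq> []" "set ws \<subseteq> permutations_of_set {1..r}" "distinct_adj ws"
  using assms E_basisD by blast+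

lemma X_basis_UnD:
  assumes "u \<in> (\<Union>d. X_basis r d)"
  shows "set u = {1..r}" "distinct_adj u"
  using assms by (auto simp: X_basis_def)

lemma keys_reduce_X_basis:
  assumes "ws \<in> E_basis r d"
  shows "keys (reduce ws) \<subseteq> X_basis r d"
  using keys_reduce[OF E_basisD(2)[OF assms]] E_basisD(4)[OF assms] by (auto simp: X_basis_def)

lemma keys_complete_E_basis:
  assumes "u \<in> X_basis r d"
  shows "keys (tcomplete u) \<subseteq> E_basis r d"
proof
  fix ws assume "ws \<in> keys (tcomplete u)"
  from keys_complete[OF this] assms show "ws \<in> E_basis r d"
    by (auto simp: E_basis_def W_simplices_def X_basis_def)
qed

lemma keys_frag_extend_subset:
  assumes "keys c \<subseteq> S" "\<And>x. x \<in> S \<Longrightarrow> keys (h x) \<subseteq> T"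
  shows "keys (frag_extend h c) \<subseteq> T"
  using keys_frag_extend[of h c] assms by blast

lemma frag_extend_hom:
  assumes "\<And>x. x \<in> S \<Longrightarrow> keys (h x) \<subseteq> T"
  shows "frag_extend h \<in> hom (free_Abelian_group S) (free_Abelian_group T)"
  using keys_frag_extend_subset[of _ S h T, OF _ assms] by (auto simp: hom_def frag_extend_add)

lemma chain_morphism_frag_extend:
  assumes "\<And>d x. x \<in> op_basis C r d \<Longrightarrow> keys (h x) \<subseteq> op_basis D r d"
    and "\<And>c. keys c \<subseteq> (\<Union>d. op_basis C r d) \<Longrightarrow>
      frag_extend h (op_bd C r c) = op_bd D r (frag_extend h c)"
  shows "chain_morphism C D r (frag_extend h)"
  unfolding chain_morphism_def op_total_def graded_part_def
proof (intro conjI allI ballI)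
  show "frag_extend h \<in>
      hom (free_Abelian_group (\<Union>d. op_basis C r d)) (free_Abelian_group (\<Union>d. op_basis D r d))"
    using assms(1) by (intro frag_extend_hom) blast
  show "frag_extend h ` carrier (free_Abelian_group (op_basis C r d)) \<subseteq>
      carrier (free_Abelian_group (op_basis D r d))" for d
    using keys_frag_extend_subset[of _ "op_basis C r d" h "op_basis D r d", OF _ assms(1)] by auto
qed (use assms(2) in auto)

lemma reduce_E_norm:
  assumes "set ws \<subseteq> permutations_of_set S"
  shows "frag_extend reduce (E_norm ws) = reduce ws"
  using reduce_degenerate[OF assms] by (cases "ws = []") (auto simp: E_norm_def)

lemma X_bd_eq:
  assumes "\<And>u. u \<in> keys c \<Longrightarrow> set u = {1..r}"
  shows "X_bd r c = frag_extend word_bd c"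
proof -
  have "X_bd r c = frag_extend (\<lambda>u. X_bd r (frag_of u)) c"
    by (simp add: X_bd_def)
  also have "\<dots> = frag_extend word_bd c"
    using assms by (intro frag_extend_eq) (simp add: X_bd_frag_of)
  finally show ?thesis .
qed

lemma E_bd_eq: "E_bd r c = frag_extend (\<lambda>ws. frag_extend E_norm (simplex_bd ws)) c"
  unfolding E_bd_frag_of[symmetric, of _ r] by (simp add: E_bd_def)

lemma reduce_bd:
  assumes "keys c \<subseteq> (\<Union>d. E_basis r d)"
  shows "frag_extend reduce (E_bd r c) = X_bd r (frag_extend reduce c)"
proof -
  have "frag_extend reduce (frag_extend E_norm (simplex_bd ws)) = frag_extend word_bd (reduce ws)"
    if "ws \<in> keys c" for ws
  proof -
    have ws: "set ws \<subseteq> permutations_of_set {1..r}"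
      using E_basis_UnD(2) that assms by blast
    have "frag_extend reduce (E_norm z) = reduce z" if "z \<in> keys (simplex_bd ws)" for z
      using keys_simplex_bd[OF that] ws by (intro reduce_E_norm) blast
    then have "frag_extend reduce (frag_extend E_norm (simplex_bd ws)) = frag_extend reduce (simplex_bd ws)"
      unfolding frag_extend_frag_extend by (rule frag_extend_eq)
    with word_bd_reduce[OF ws] show ?thesis by simp
  qed
  then have "frag_extend reduce (E_bd r c) = frag_extend (\<lambda>ws. frag_extend word_bd (reduce ws)) c"
    unfolding E_bd_eq frag_extend_frag_extend by (rule frag_extend_eq)
  also have "\<dots> = X_bd r (frag_extend reduce c)"
  proof (subst X_bd_eq)
    have "keys (frag_extend reduce c) \<subseteq> (\<Union>d. X_basis r d)"
      using keys_reduce_X_basis by (intro keys_frag_extend_subset[OF assms]) blast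
    then show "set u = {1..r}" if "u \<in> keys (frag_extend reduce c)" for u
      using X_basis_UnD(1) that by blast
  qed (simp add: frag_extend_frag_extend)
  finally show ?thesis .
qed

lemma complete_bd:
  assumes "keys c \<subseteq> (\<Union>d. X_basis r d)"
  shows "frag_extend tcomplete (X_bd r c) = E_bd r (frag_extend tcomplete c)"
proof -
  have "frag_extend tcomplete (word_bd u) = E_bd r (tcomplete u)" if "u \<in> keys c" for u
  proof (cases "distinct u")
    case True
    then show ?thesis
      by (simp add: word_bd_distinct complete_distinct E_bd_eq simplex_bd_Cons E_norm_def)
  next
    case False
    \<comment> \<open>In positive degree no face is empty, so that \<open>E_norm\<close> and
      \<open>nrm\<close> agree on the faces. In degree 0 both sides of the claim vanished because
      \<open>E_norm\<close> kills the empty simplex.\<close>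
    have "E_bd r (tcomplete u) = frag_extend norm_simplex_bd (tcomplete u)"
      unfolding E_bd_eq
    proof (rule frag_extend_eq)
      fix ws assume "ws \<in> keys (tcomplete u)"
      with keys_complete[of ws u] card_set_less_length[OF False] have "1 < length ws" by auto
      then show "frag_extend E_norm (simplex_bd ws) = norm_simplex_bd ws"
        unfolding norm_simplex_bd_def
        by (intro frag_extend_eq) (auto simp: E_norm_def nrm_def dest!: keys_simplex_bd)
    qed
    moreover have "distinct_adj u"
      using X_basis_UnD(2) that assms by blast
    ultimately show ?thesis
      using norm_simplex_bd_complete[OF _ False] by simp
  qed
  then have "frag_extend (\<lambda>u. frag_extend tcomplete (word_bd u)) c = frag_extend (\<lambda>u. E_bd r (tcomplete u)) c"
    by (rule frag_extend_eq)
  moreover have "X_bd r c = frag_extend word_bd c"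
    using X_basis_UnD(1) assms by (intro X_bd_eq) blast
  ultimately show ?thesis
    by (simp add: E_bd_eq frag_extend_frag_extend)
qed

section \<open>Partial composites of basis elements\<close>

lemma X_insert_insertion:
  assumes "k \<ge> 1" "s \<ge> 1" "length js = count_list u k"
  shows "X_insert s k u v (j # js) = nat_composite.insertion k (shift_out k s) (shift_in k) u v j js"
proof -
  \<comment> \<open>\<open>insertion\<close> is determined by \<open>k\<close> and the two
    renamings, so any admissible alphabets will do.\<close>
  interpret nat_composite k "shift_out k s" "shift_in k" "{1..1}" "{1..s}"
    using assms by (intro composite_shift)
  show ?thesis
    using assms(3)
  proof (induction u arbitrary: j js)
    case Nil
    then show ?case by (simp add: X_insert_def)
  next
    case (Cons x u)
    show ?case
    proof (cases "x = k")
      case False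
      then have "X_insert s k (x # u) v (j # js) = (shift_out k s x, True) # X_insert s k u v (j # js)"
        by (simp add: X_insert_def upt_conv_Cons map_Suc_upt[symmetric] o_def shift_out_def
            del: upt_Suc map_Suc_upt cong: if_cong)
      with False Cons show ?thesis by simp
    next
      case True
      with Cons.prems obtain j' js' where js: "js = j' # js'" "length js' = count_list u k"
        by (cases js) auto
      \<comment> \<open>The count includes the current \<open>k\<close>; so \<open>m - 1\<close> is
        not truncated, and dropping the first entry of the subdivision shifts both indices by
        one.\<close>
      have pos: "0 < count_list (take (Suc i) u) k" if "i < length u" "u ! i = k" for i
        using that by (simp add: take_Suc_conv_app_nth)
      have head: "(0 < count_list u k) = (js' \<noteq> [])"
        by (simp flip: js(2))
      define T where "T = (\<lambda>u js i.
        if u ! i = k then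
          (let m = count_list (take (Suc i) u) k
           in map (\<lambda>l. (v ! (l - 1) + k - 1, l = js ! m \<and> m < count_list u k))
                [js ! (m - 1)..<Suc (js ! m)])
        else if u ! i > k then [(u ! i + s - 1, True)]
        else [(u ! i, True)])"
      have X_insert: "X_insert s k u v js = concat (map (T u js) [0..<length u])" for u js
        by (simp add: X_insert_def T_def)
      have "T (k # u) (j # j' # js') (Suc i) = T u (j' # js') i" if i: "i < length u" for i
      proof (cases "u ! i = k")
        case True
        then obtain m where "count_list (take (Suc i) u) k = Suc m"
          using pos[OF i] gr0_implies_Suc by blast
        with True show ?thesis by (simp add: T_def)
      qed (simp add: T_def)
      then have "concat (map (T (k # u) (j # j' # js') \<circ> Suc) [0..<length u]) =
          concat (map (T u (j' # js')) [0..<length u])"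
        by (intro arg_cong[of _ _ concat]) simp
      moreover have "T (k # u) (j # j' # js') 0 =
          map (\<lambda>l. (shift_in k (v ! (l - 1)), l = j' \<and> js' \<noteq> [])) [j..<Suc j']"
        by (simp add: T_def shift_in_def head del: upt_Suc)
      ultimately have "X_insert s k (x # u) v (j # js) =
          map (\<lambda>l. (shift_in k (v ! (l - 1)), l = j' \<and> js' \<noteq> [])) [j..<Suc j']
          @ X_insert s k u v (j' # js')"
        unfolding X_insert True js(1)
        by (simp add: upt_conv_Cons map_Suc_upt[symmetric] del: upt_Suc map_Suc_upt)
      with True Cons.IH[OF js(2)] js(1) show ?thesis by simp
    qed
  qed
qed

lemma X_comp_frag_of:
  assumes "k \<in> {1..r}" "u \<in> (\<Union>d. X_basis r d)" "v \<in> (\<Union>d. X_basis s d)" "s \<ge> 1"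
  shows "X_comp r s k (frag_of u) (frag_of v) =
    composite.word_comp k (shift_out k s) (shift_in k) u v"
proof -
  interpret nat_composite k "shift_out k s" "shift_in k" "{1..r}" "{1..s}"
    using assms by (intro composite_shift) auto
  note u = X_basis_UnD[OF assms(2)] and v = X_basis_UnD[OF assms(3)]
  have "v \<noteq> []" using v(1) assms(4) by auto
  have "X_comp r s k (frag_of u) (frag_of v) =
      (\<Sum>js \<in> cuts (count_list u k) 1 (length v).
        frag_cmul (shuffle_sign (caesura_types (X_insert s k u v (1 # js))))
          (X_norm (r + s - 1) (map fst (X_insert s k u v (1 # js)))))"
    by (simp add: X_comp_def subdivisions_eq sum.reindex)
  also have "\<dots> = (\<Sum>js \<in> cuts (count_list u k) 1 (length v). signed_word (insertion u v 1 js))"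
  proof (rule sum.cong)
    fix js assume js: "js \<in> cuts (count_list u k) 1 (length v)"
    then have "X_insert s k u v (1 # js) = insertion u v 1 js"
      using assms by (intro X_insert_insertion) (auto simp: cuts_def)
    moreover have "fst ` set (insertion u v 1 js) = {1..r + s - 1}"
      using insertion_letters[OF js] u v assms(1) image_shift[OF assms(1,4)] by simp
    ultimately show "frag_cmul (shuffle_sign (caesura_types (X_insert s k u v (1 # js))))
          (X_norm (r + s - 1) (map fst (X_insert s k u v (1 # js)))) =
        signed_word (insertion u v 1 js)"
      by (simp add: signed_word_def X_norm_def nrm_def)
  qed simp
  also have "\<dots> = word_comp u (drop (1 - 1) v)"
    using u v assms(1) \<open>v \<noteq> []\<close> by (intro sum_insertions) (auto simp: Suc_le_eq)
  finally show ?thesis by simp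
qed

lemma X_comp_extend:
  "X_comp r s k a b = frag_extend (\<lambda>u. frag_extend (\<lambda>v. X_comp r s k (frag_of u) (frag_of v)) b) a"
  by (simp add: X_comp_def)

lemma E_comp_extend:
  "E_comp r s k a b = frag_extend (\<lambda>us. frag_extend (\<lambda>vs. E_comp r s k (frag_of us) (frag_of vs)) b) a"
  by (simp add: E_comp_def)

lemma sum_W_path:
  assumes "k \<ge> 1" "s \<ge> 1" "us \<noteq> []" "vs \<noteq> []" "\<And>v. v \<in> set vs \<Longrightarrow> length v = s"
  shows "(\<Sum>ts \<in> lattice_paths (length us - 1) (length vs - 1).
      frag_cmul (shuffle_sign ts) (frag_of (W_path k us vs ts))) =
    composite.shuf k (shift_out k s) (shift_in k) us vs"
proof -
  interpret nat_composite k "shift_out k s" "shift_in k" "{1..1}" "{1..s}"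
    using assms by (intro composite_shift) auto
  \<comment> \<open>\<open>perm_comp\<close> shifts by the length of the inserted word,
    \<open>shift_out\<close> by the fixed arity \<open>s\<close>.\<close>
  have perm_comp: "perm_comp k u v = subst_block u v" if "length v = s" for u v
    using that by (auto simp: perm_comp_def subst_block_def shift_out_def shift_in_def
        intro!: arg_cong[of _ _ concat])
  have count: "count_list ts True = d" if "ts \<in> lattice_paths d e" for ts d e
    using that by (simp add: lattice_paths_def)
  let ?F = "\<lambda>us vs. \<Sum>ts \<in> lattice_paths (length us - 1) (length vs - 1).
      frag_cmul (shuffle_sign ts) (frag_of (W_path k us vs ts))"
  show ?thesis
    using assms(3-5)
  proof (induction us vs rule: shuf.induct)
    case (1 u us v vs)
    let ?c = "frag_extend (frag_of \<circ> (#) (subst_block u v))"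
    have c: "perm_comp k u v = subst_block u v"
      using "1.prems" by (intro perm_comp) simp
    show ?case
    proof (cases "us = [] \<and> vs = []")
      case True
      then show ?thesis
        by (simp add: sum_lattice_paths[of _ 0 0] W_path_Nil c)
    next
      case False
      have x: "(\<Sum>ts \<in> lattice_paths (length us - 1) (length vs).
          frag_cmul (shuffle_sign (True # ts)) (frag_of (W_path k (u # us) (v # vs) (True # ts)))) =
          ?c (shuf us (v # vs))" if "us \<noteq> []"
      proof -
        have "?F us (v # vs) = shuf us (v # vs)"
          using "1.IH"(1)[OF False] "1.prems" that by simp
        then show ?thesis
          by (simp add: shuffle_sign_Cons W_path_Cons c frag_extend_sum o_def frag_extend_cmul
              finite_lattice_paths flip: \<open>?F us (v # vs) = _\<close>)
      qed
      have y: "(\<Sum>ts \<in> lattice_paths (length us) (length vs - 1).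
          frag_cmul (shuffle_sign (False # ts)) (frag_of (W_path k (u # us) (v # vs) (False # ts)))) =
          ?c (frag_cmul ((- 1) ^ length us) (shuf (u # us) vs))" if "vs \<noteq> []"
      proof -
        have "?F (u # us) vs = shuf (u # us) vs"
          using "1.IH"(2)[OF False] "1.prems" that by simp
        then show ?thesis
          by (simp add: shuffle_sign_Cons W_path_Cons c frag_extend_sum o_def frag_extend_cmul
              finite_lattice_paths count frag_cmul_sum flip: \<open>?F (u # us) vs = _\<close>)
      qed
      have "?F (u # us) (v # vs) = (if us = [] then 0 else ?c (shuf us (v # vs))) +
          (if vs = [] then 0 else ?c (frag_cmul ((- 1) ^ length us) (shuf (u # us) vs)))"
        using False x y by (subst sum_lattice_paths) auto
      also have "\<dots> = shuf (u # us) (v # vs)"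
        using False by (auto simp: frag_extend_add)
      finally show ?thesis .
    qed
  qed auto
qed

lemma reduce_comp_frag_of:
  assumes "k \<in> {1..r}" "s \<ge> 1" "us \<in> (\<Union>d. E_basis r d)" "vs \<in> (\<Union>d. E_basis s d)"
  shows "frag_extend reduce (E_comp r s k (frag_of us) (frag_of vs)) = X_comp r s k (reduce us) (reduce vs)"
proof -
  interpret nat_composite k "shift_out k s" "shift_in k" "{1..r}" "{1..s}"
    using assms by (intro composite_shift) auto
  note us = E_basis_UnD[OF assms(3)] and vs = E_basis_UnD[OF assms(4)]
  have len: "length v = s" if "v \<in> set vs" for v
    using vs(2) that distinct_card[of v] by (auto simp: permutations_of_set_def)
  let ?S = "shift_out k s ` ({1..r} - {k}) \<union> (if k \<in> {1..r} then shift_in k ` {1..s} else {})"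
  have perms: "set (W_path k us vs ts) \<subseteq> permutations_of_set ?S"
    if ts: "ts \<in> lattice_paths (length us - 1) (length vs - 1)" for ts
  proof
    fix w assume "w \<in> set (W_path k us vs ts)"
    then obtain i where w: "w = perm_comp k (us ! count_list (take i ts) True)
        (vs ! count_list (take i ts) False)"
      by (auto simp only: W_path_def set_map)
    have le: "count_list (take i ts) b \<le> count_list ts b" for b
      using count_list_append[of "take i ts" "drop i ts" b] by simp
    have "count_list ts True + count_list ts False = length ts"
      by (induction ts) auto
    with ts le[of True] le[of False] us(1) vs(1)
    have "us ! count_list (take i ts) True \<in> set us" "vs ! count_list (take i ts) False \<in> set vs"
      by (auto simp: lattice_paths_def simp flip: length_greater_0_conv intro!: nth_mem)
    moreover from this(2) have "w = subst_block (us ! count_list (take i ts) True)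
        (vs ! count_list (take i ts) False)"
      using len unfolding w by (auto simp: perm_comp_def subst_block_def shift_out_def shift_in_def
          intro!: arg_cong[of _ _ concat])
    ultimately show "w \<in> permutations_of_set ?S"
      using us(2) vs(2) subst_block_perms[of "us ! count_list (take i ts) True" "{1..r}"
          "vs ! count_list (take i ts) False" "{1..s}"] by blast
  qed
  have "frag_extend reduce (E_comp r s k (frag_of us) (frag_of vs)) =
      (\<Sum>ts \<in> lattice_paths (length us - 1) (length vs - 1).
        frag_cmul (shuffle_sign ts) (reduce (W_path k us vs ts)))"
    unfolding E_comp_def frag_extend_of using reduce_E_norm[OF perms]
    by (simp add: frag_extend_sum finite_lattice_paths frag_extend_cmul)
  also have "\<dots> = frag_extend reduce (\<Sum>ts \<in> lattice_paths (length us - 1) (length vs - 1).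
        frag_cmul (shuffle_sign ts) (frag_of (W_path k us vs ts)))"
    by (simp add: frag_extend_sum finite_lattice_paths frag_extend_cmul)
  also have "\<dots> = frag_extend reduce (shuf us vs)"
    using assms(1,2) us(1) vs(1) len by (subst sum_W_path) auto
  also have "\<dots> = comp_R (reduce us) (reduce vs)"
    using us(2) vs(2) assms(1,2) by (intro reduce_shuf) auto
  also have "\<dots> = X_comp r s k (reduce us) (reduce vs)"
  proof -
    have "u \<in> (\<Union>d. X_basis r d)" if "u \<in> keys (reduce us)" for u
      using keys_reduce_X_basis assms(3) that by blast
    moreover have "v \<in> (\<Union>d. X_basis s d)" if "v \<in> keys (reduce vs)" for v
      using keys_reduce_X_basis assms(4) that by blast
    ultimately show ?thesis
      unfolding comp_R_def X_comp_extend[of r s k "reduce us"]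
      using assms(1,2) by (intro frag_extend_eq) (simp add: X_comp_frag_of)
  qed
  finally show ?thesis .
qed

lemma reduce_comp:
  assumes "k \<in> {1..r}" "s \<ge> 1" "keys a \<subseteq> (\<Union>d. E_basis r d)" "keys b \<subseteq> (\<Union>d. E_basis s d)"
  shows "frag_extend reduce (E_comp r s k a b) = X_comp r s k (frag_extend reduce a) (frag_extend reduce b)"
proof -
  have "frag_extend reduce (E_comp r s k a b) =
      frag_extend (\<lambda>us. frag_extend (\<lambda>vs. X_comp r s k (reduce us) (reduce vs)) b) a"
    unfolding E_comp_extend[of r s k a b] frag_extend_frag_extend
    using assms by (intro frag_extend_eq reduce_comp_frag_of) auto
  also have "\<dots> = X_comp r s k (frag_extend reduce a) (frag_extend reduce b)"
    unfolding X_comp_extend[of r s k "reduce _"] X_comp_extend[of r s k "frag_extend reduce a"]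
      frag_extend_frag_extend
    by (intro frag_extend_eq) (rule frag_extend_swap)
  finally show ?thesis .
qed

lemma reduce_act:
  assumes "\<sigma> permutes {1..r}" "keys c \<subseteq> (\<Union>d. E_basis r d)"
  shows "frag_extend reduce (E_act \<sigma> c) = X_act \<sigma> (frag_extend reduce c)"
  unfolding E_act_def X_act_def frag_extend_frag_extend
proof (rule frag_extend_eq)
  fix ws assume "ws \<in> keys c"
  then have "set ws \<subseteq> permutations_of_set {1..r}"
    using assms(2) E_basis_UnD(2) by blast
  from reduce_map[OF this permutes_inj_on[OF assms(1)]]
  show "frag_extend reduce (frag_of (map (map \<sigma>) ws)) = frag_extend (\<lambda>u. frag_of (map \<sigma> u)) (reduce ws)"
    by (simp add: o_def)
qed

section \<open>Cells and filtrations\<close>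

lemma generate_frag_of:
  assumes "keys c \<subseteq> S" "S \<subseteq> T"
  shows "c \<in> generate (free_Abelian_group T) (frag_of ` S)"
  using assms(1)
proof (induction c rule: frag_induction)
  case zero
  then show ?case using generate.one[of "free_Abelian_group T"] by simp
next
  case (one x)
  then show ?case by (intro generate.incl) simp
next
  case (diff a b)
  have S: "frag_of ` S \<subseteq> carrier (free_Abelian_group T)"
    using assms(2) by auto
  interpret subgroup "generate (free_Abelian_group T) (frag_of ` S)" "free_Abelian_group T"
    using group.generate_is_subgroup[OF group_free_Abelian_group S] .
  have "b \<in> carrier (free_Abelian_group T)"
    using diff(2) subset by blast
  then have "keys b \<subseteq> T"
    by simp
  with m_closed[OF diff(1) m_inv_closed[OF diff(2)]] show ?case by simp
qed

lemma frag_extend_generate: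
  assumes "\<And>x. x \<in> S \<Longrightarrow> keys (h x) \<subseteq> T" "X \<subseteq> carrier (free_Abelian_group S)"
    and "frag_extend h ` X \<subseteq> generate (free_Abelian_group T) Y" "Y \<subseteq> carrier (free_Abelian_group T)"
  shows "frag_extend h ` generate (free_Abelian_group S) X \<subseteq> generate (free_Abelian_group T) Y"
proof -
  interpret group_hom "free_Abelian_group S" "free_Abelian_group T" "frag_extend h"
    using frag_extend_hom[OF assms(1)] by (simp add: group_hom_def group_hom_axioms_def)
  show ?thesis
    using generate_img[OF assms(2)] H.generate_is_subgroup[OF assms(4)]
      H.generate_subgroup_incl[OF assms(3)] by simp
qed

lemma reduce_X_cell_basis:
  assumes "ws \<in> W_cell r n w" "u \<in> keys (reduce ws)"
  shows "u \<in> X_cell_basis r n w"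
proof -
  obtain d where d: "length ws = d + 1" "set ws \<subseteq> permutations_of_set {1..r}"
    using assms(1) by (auto simp: W_cell_def W_simplices_def)
  note u = keys_reduce[OF d(2) assms(2)]
  have "u \<in> X_basis r d"
    using u d(1) by (simp add: X_basis_def)
  moreover have "variations (restrict_pair i j u) - 1 < n i j \<or>
      variations (restrict_pair i j u) - 1 = n i j \<and>
      first_occurrences (restrict_pair i j u) = restrict_pair i j w"
    if ij: "1 \<le> i" "i < j" "j \<le> r" for i j
  proof -
    let ?V = "variations (map (restrict_pair i j) ws)"
    have "?V < n i j \<or> ?V = n i j \<and> restrict_pair i j (hd ws) = restrict_pair i j w"
      using assms(1) ij unfolding W_cell_def Let_def by blast
    \<comment> \<open>Ensures that the subtraction of 1 is not truncated.\<close>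
    moreover have "0 < variations (restrict_pair i j u)"
      using u ij by (intro variations_pos[of i _ j]) (auto simp: set_restrict_pair)
    moreover have "variations (restrict_pair i j u) \<le> ?V \<or>
        variations (restrict_pair i j u) = Suc ?V \<and>
        first_occurrences (restrict_pair i j u) = restrict_pair i j (hd ws)"
      using ij by (intro reduce_variations[OF d(2) assms(2)]) auto
    ultimately show ?thesis by auto
  qed
  ultimately show ?thesis
    unfolding X_cell_basis_def Let_def by blast
qed

lemma complete_W_cell:
  assumes "u \<in> X_cell_basis r n w" "ws \<in> keys (tcomplete u)"
  shows "ws \<in> W_cell r n w"
proof -
  obtain d where d: "u \<in> X_basis r d"
    using assms(1) by (auto simp: X_cell_basis_def)
  have "ws \<in> W_simplices r d"
    using keys_complete_E_basis[OF d] assms(2) by (auto simp: E_basis_def)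
  moreover have "variations (map (restrict_pair i j) ws) < n i j \<or>
      variations (map (restrict_pair i j) ws) = n i j \<and>
      restrict_pair i j (hd ws) = restrict_pair i j w"
    if ij: "1 \<le> i" "i < j" "j \<le> r" for i j
  proof -
    have "variations (restrict_pair i j u) - 1 < n i j \<or>
        variations (restrict_pair i j u) - 1 = n i j \<and>
        first_occurrences (restrict_pair i j u) = restrict_pair i j w"
      using assms(1) ij unfolding X_cell_basis_def Let_def by blast
    moreover have "variations (map (restrict_pair i j) ws) < variations (restrict_pair i j u)"
      using ij d by (intro complete_variations[OF assms(2)]) (auto simp: X_basis_def)
    moreover have "restrict_pair i j (hd ws) = first_occurrences (restrict_pair i j u)"
      using keys_complete[OF assms(2)] by (simp add: first_occurrences_restrict_pair)
    ultimately show ?thesis by fastforce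
  qed
  ultimately show ?thesis
    unfolding W_cell_def Let_def by blast
qed

lemma E_norm_W_cell_subset: "E_norm ` W_cell r n w \<subseteq> carrier (free_Abelian_group (\<Union>d. E_basis r d))"
proof -
  have "keys (E_norm ws) \<subseteq> (\<Union>d. E_basis r d)" if "ws \<in> W_cell r n w" for ws
    using that by (auto simp: E_norm_def W_cell_def E_basis_def)
  then show ?thesis by auto
qed

lemma reduce_cell: "frag_extend reduce ` E_cell r n w \<subseteq> X_cell r n w"
  unfolding E_cell_def X_cell_def
proof (rule frag_extend_generate)
  show "keys (reduce ws) \<subseteq> (\<Union>d. X_basis r d)" if "ws \<in> (\<Union>d. E_basis r d)" for ws
    using that keys_reduce_X_basis by blast
  have sub: "X_cell_basis r n w \<subseteq> (\<Union>d. X_basis r d)"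
    by (auto simp: X_cell_basis_def)
  show "frag_of ` X_cell_basis r n w \<subseteq> carrier (free_Abelian_group (\<Union>d. X_basis r d))"
    by (auto simp: X_cell_basis_def)
  show "frag_extend reduce ` E_norm ` W_cell r n w \<subseteq>
      generate (free_Abelian_group (\<Union>d. X_basis r d)) (frag_of ` X_cell_basis r n w)"
  proof clarify
    fix ws assume ws: "ws \<in> W_cell r n w"
    then have "frag_extend reduce (E_norm ws) = reduce ws"
      by (intro reduce_E_norm[of ws "{1..r}"]) (auto simp: W_cell_def W_simplices_def)
    with reduce_X_cell_basis[OF ws] sub
    show "frag_extend reduce (E_norm ws) \<in>
        generate (free_Abelian_group (\<Union>d. X_basis r d)) (frag_of ` X_cell_basis r n w)"
      by (auto intro: generate_frag_of)
  qed
qed (rule E_norm_W_cell_subset)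

lemma complete_cell: "frag_extend tcomplete ` X_cell r n w \<subseteq> E_cell r n w"
  unfolding E_cell_def X_cell_def
proof (rule frag_extend_generate)
  show "keys (tcomplete u) \<subseteq> (\<Union>d. E_basis r d)" if "u \<in> (\<Union>d. X_basis r d)" for u
    using that keys_complete_E_basis by blast
  show "frag_of ` X_cell_basis r n w \<subseteq> carrier (free_Abelian_group (\<Union>d. X_basis r d))"
    by (auto simp: X_cell_basis_def)
  \<comment> \<open>The simplices of the cell whose class is a basis element; the degenerate ones
    have class 0.\<close>
  let ?S = "{ws \<in> W_cell r n w. ws \<noteq> [] \<and> distinct_adj ws}"
  have "tcomplete u \<in> generate (free_Abelian_group (\<Union>d. E_basis r d)) (E_norm ` W_cell r n w)"
    if "u \<in> X_cell_basis r n w" for u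
  proof -
    have "?S \<subseteq> (\<Union>d. E_basis r d)"
      by (auto simp: W_cell_def E_basis_def)
    moreover have "keys (tcomplete u) \<subseteq> ?S"
      using complete_W_cell[OF that] keys_complete by blast
    ultimately have "tcomplete u \<in> generate (free_Abelian_group (\<Union>d. E_basis r d)) (frag_of ` ?S)"
      by (intro generate_frag_of)
    moreover have "frag_of ` ?S \<subseteq> E_norm ` W_cell r n w"
      by (auto simp: E_norm_def image_iff)
    ultimately show ?thesis
      using group.mono_generate[OF group_free_Abelian_group] by blast
  qed
  then show "frag_extend tcomplete ` frag_of ` X_cell_basis r n w \<subseteq>
      generate (free_Abelian_group (\<Union>d. E_basis r d)) (E_norm ` W_cell r n w)"
    by auto
qed (rule E_norm_W_cell_subset)

lemma op_filt_frag_extend: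
  assumes h: "\<And>d x. x \<in> op_basis C r d \<Longrightarrow> keys (h x) \<subseteq> op_basis D r d"
    and cell: "\<And>n w. frag_extend h ` op_cell C r n w \<subseteq> op_cell D r n w"
    and C: "\<And>n w. op_cell C r n w \<subseteq> carrier (op_total C r)"
    and D: "\<And>n w. op_cell D r n w \<subseteq> carrier (op_total D r)"
  shows "frag_extend h ` op_filt C N r \<subseteq> op_filt D N r"
proof (cases N)
  case (enat m)
  let ?I = "{(n, w). w \<in> permutations_of_set {1..r} \<and>
    (\<forall>i j. 1 \<le> i \<and> i < j \<and> j \<le> r \<longrightarrow> (n :: nat \<Rightarrow> nat \<Rightarrow> nat) i j < m)}"
  \<comment> \<open>The index set no longer refers to the operad, so that cells with the same index
    can be compared.\<close>
  have filt: "op_filt X N r = generate (free_Abelian_group (\<Union>d. op_basis X r d))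
      (\<Union>(n, w) \<in> ?I. op_cell X r n w)" for X :: "'x cellular_operad"
    unfolding op_filt_def op_total_def enat enat.case
    by (rule arg_cong[of _ _ "generate _"]) blast
  show ?thesis
    unfolding filt
  proof (rule frag_extend_generate)
    show "keys (h x) \<subseteq> (\<Union>d. op_basis D r d)" if "x \<in> (\<Union>d. op_basis C r d)" for x
      using that h by blast
    show "(\<Union>(n, w) \<in> ?I. op_cell C r n w) \<subseteq> carrier (free_Abelian_group (\<Union>d. op_basis C r d))"
      using C unfolding op_total_def by blast
    show "(\<Union>(n, w) \<in> ?I. op_cell D r n w) \<subseteq> carrier (free_Abelian_group (\<Union>d. op_basis D r d))"
      using D unfolding op_total_def by blast
    have "frag_extend h ` (\<Union>(n, w) \<in> ?I. op_cell C r n w) \<subseteq> (\<Union>(n, w) \<in> ?I. op_cell D r n w)"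
      by (intro image_subsetI) (use cell in \<open>auto intro: subsetD[OF cell imageI]\<close>)
    also have "\<dots> \<subseteq> generate (free_Abelian_group (\<Union>d. op_basis D r d))
        (\<Union>(n, w) \<in> ?I. op_cell D r n w)"
      by (auto intro: generate.incl)
    finally show "frag_extend h ` (\<Union>(n, w) \<in> ?I. op_cell C r n w) \<subseteq>
      generate (free_Abelian_group (\<Union>d. op_basis D r d)) (\<Union>(n, w) \<in> ?I. op_cell D r n w)" .
  qed
next
  case infinity
  have "keys (h x) \<subseteq> (\<Union>d. op_basis D r d)" if "x \<in> (\<Union>d. op_basis C r d)" for x
    using that h by blast
  then have "keys (frag_extend h c) \<subseteq> (\<Union>d. op_basis D r d)" if "keys c \<subseteq> (\<Union>d. op_basis C r d)" for c
    by (rule keys_frag_extend_subset[OF that])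
  then show ?thesis
    by (simp add: op_filt_def op_total_def infinity image_subset_iff)
qed

lemmas operad_simps = barratt_eccles_def surjection_operad_def

lemma E_cell_carrier: "op_cell barratt_eccles r n w \<subseteq> carrier (op_total barratt_eccles r)"
  using group.generate_incl[OF group_free_Abelian_group E_norm_W_cell_subset]
  by (simp add: operad_simps op_total_def E_cell_def)

lemma X_cell_carrier: "op_cell surjection_operad r n w \<subseteq> carrier (op_total surjection_operad r)"
proof -
  have "frag_of ` X_cell_basis r n w \<subseteq> carrier (free_Abelian_group (\<Union>d. X_basis r d))"
    by (auto simp: X_cell_basis_def)
  from group.generate_incl[OF group_free_Abelian_group this] show ?thesis
    by (simp add: operad_simps op_total_def X_cell_def)
qed

theorem mainTheorem1:
  shows "\<exists>(TR :: nat \<Rightarrow> (nat list list \<Rightarrow>\<^sub>0 int) \<Rightarrow> (nat list \<Rightarrow>\<^sub>0 int))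
          (TC :: nat \<Rightarrow> (nat list \<Rightarrow>\<^sub>0 int) \<Rightarrow> (nat list list \<Rightarrow>\<^sub>0 int)).
    (\<forall>r \<ge> 1. chain_morphism barratt_eccles surjection_operad r (TR r)) \<and>
    (\<forall>r \<ge> 1. chain_morphism surjection_operad barratt_eccles r (TC r)) \<and>
    (\<forall>r \<ge> 1. \<forall>w \<in> permutations_of_set {1..r}.
       TR r (frag_of [w]) = frag_of w \<and> TC r (frag_of w) = frag_of [w]) \<and>
    (\<forall>r \<ge> 1. \<forall>c \<in> carrier (op_total surjection_operad r). TR r (TC r c) = c) \<and>
    (\<forall>r \<ge> 1. \<forall>(n :: nat \<Rightarrow> nat \<Rightarrow> nat). \<forall>w \<in> permutations_of_set {1..r}.
       TR r ` op_cell barratt_eccles r n w \<subseteq> op_cell surjection_operad r n w \<and>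
       TC r ` op_cell surjection_operad r n w \<subseteq> op_cell barratt_eccles r n w) \<and>
    (\<forall>r \<ge> 1. \<forall>N :: enat. N \<ge> 1 \<longrightarrow>
       TR r ` op_filt barratt_eccles N r \<subseteq> op_filt surjection_operad N r \<and>
       TC r ` op_filt surjection_operad N r \<subseteq> op_filt barratt_eccles N r) \<and>
    operad_morphism barratt_eccles surjection_operad TR"
proof (intro exI conjI)
  \<comment> \<open>The arity is implicit in the words, so one linear map serves for all
    \<open>r\<close>.\<close>
  let ?TR = "\<lambda>r :: nat. frag_extend (reduce :: nat list list \<Rightarrow> _)"
  let ?TC = "\<lambda>r :: nat. frag_extend (tcomplete :: nat list \<Rightarrow> _)"
  have TR: "chain_morphism barratt_eccles surjection_operad r (?TR r)" for r
    by (rule chain_morphism_frag_extend)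
      (simp_all add: operad_simps keys_reduce_X_basis reduce_bd)
  then show "\<forall>r \<ge> 1. chain_morphism barratt_eccles surjection_operad r (?TR r)"
    by blast
  have "chain_morphism surjection_operad barratt_eccles r (?TC r)" for r
    by (rule chain_morphism_frag_extend)
      (simp_all add: operad_simps keys_complete_E_basis complete_bd)
  then show "\<forall>r \<ge> 1. chain_morphism surjection_operad barratt_eccles r (?TC r)"
    by blast
  show "\<forall>r \<ge> 1. \<forall>w \<in> permutations_of_set {1..r}.
      ?TR r (frag_of [w]) = frag_of w \<and> ?TC r (frag_of w) = frag_of [w]"
    by (auto simp: permutations_of_set_def reduce_singleton complete_distinct simp del: reduce.simps)
  have "?TR r (?TC r c) = c" if "c \<in> carrier (op_total surjection_operad r)" for r c
  proof -
    have "frag_extend reduce (tcomplete u) = frag_of u" if "u \<in> keys c" for u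
      using that \<open>c \<in> _\<close> X_basis_UnD(2)[of u r]
      by (intro reduce_complete) (auto simp: operad_simps op_total_def)
    then have "?TR r (?TC r c) = frag_extend frag_of c"
      unfolding frag_extend_frag_extend by (rule frag_extend_eq)
    then show ?thesis by simp
  qed
  then show "\<forall>r \<ge> 1. \<forall>c \<in> carrier (op_total surjection_operad r). ?TR r (?TC r c) = c"
    by blast
  have cell: "?TR r ` op_cell barratt_eccles r n w \<subseteq> op_cell surjection_operad r n w"
    "?TC r ` op_cell surjection_operad r n w \<subseteq> op_cell barratt_eccles r n w" for r n w
    using reduce_cell complete_cell by (simp_all add: operad_simps)
  then show "\<forall>r \<ge> 1. \<forall>n. \<forall>w \<in> permutations_of_set {1..r}.
      ?TR r ` op_cell barratt_eccles r n w \<subseteq> op_cell surjection_operad r n w \<and>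
      ?TC r ` op_cell surjection_operad r n w \<subseteq> op_cell barratt_eccles r n w"
    by blast
  have "?TR r ` op_filt barratt_eccles N r \<subseteq> op_filt surjection_operad N r" for r N
    by (rule op_filt_frag_extend[OF _ cell(1) E_cell_carrier X_cell_carrier])
      (simp add: operad_simps keys_reduce_X_basis)
  moreover have "?TC r ` op_filt surjection_operad N r \<subseteq> op_filt barratt_eccles N r" for r N
    by (rule op_filt_frag_extend[OF _ cell(2) X_cell_carrier E_cell_carrier])
      (simp add: operad_simps keys_complete_E_basis)
  ultimately show "\<forall>r \<ge> 1. \<forall>N :: enat. N \<ge> 1 \<longrightarrow>
      ?TR r ` op_filt barratt_eccles N r \<subseteq> op_filt surjection_operad N r \<and>
      ?TC r ` op_filt surjection_operad N r \<subseteq> op_filt barratt_eccles N r"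
    by blast
  show "operad_morphism barratt_eccles surjection_operad ?TR"
    unfolding operad_morphism_def
  proof (intro conjI allI impI ballI)
    show "chain_morphism barratt_eccles surjection_operad r (?TR r)" for r
      by (rule TR)
    show "?TR r (op_act barratt_eccles \<sigma> c) = op_act surjection_operad \<sigma> (?TR r c)"
      if "\<sigma> permutes {1..r} \<and> c \<in> carrier (op_total barratt_eccles r)" for r \<sigma> c
      using that reduce_act[of \<sigma> r c] by (simp add: operad_simps op_total_def)
    show "?TR 1 (op_one barratt_eccles) = op_one surjection_operad"
      using reduce_singleton[of "[1 :: nat]"] by (simp add: operad_simps del: reduce.simps)
    show "?TR (r + s - 1) (op_comp barratt_eccles r s k a b) =
        op_comp surjection_operad r s k (?TR r a) (?TR s b)"
      if "1 \<le> s" "k \<in> {1..r}" "a \<in> carrier (op_total barratt_eccles r)"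
        "b \<in> carrier (op_total barratt_eccles s)" for r s k a b
      using that reduce_comp[of k r s a b] by (simp add: operad_simps op_total_def)
  qed
qed

end
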